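(* Let $n\ge3$ be an integer and $s\in(0,1)$. Let $$\Gamma(x)=\int_0^\infty H(x,t)\,dt,\qquad H(x,t)=\frac{1}{(2\pi)^n}\int_{\mathbb R^n}e^{-t(|\xi|^2+|\xi|^{2s})+ix\cdot\xi}\,d\xi\quad(x\in\mathbb R^n,\ t>0).$$ Then $\Gamma$ is nonnegative, radially symmetric, and nonincreasing as a function of $r=|x|$, and there exists a positive constant $C$ such that $$\frac1C\frac{1}{|x|^{n-2}}\le\Gamma(x)\le C\frac{1}{|x|^{n-2}}\quad\text{for }0<|x|<1,$$ $$\frac1C\frac{1}{|x|^{n-2s}}\le\Gamma(x)\le C\frac{1}{|x|^{n-2s}}\quad\text{for }|x|\ge1.$$ Moreover, $\Gamma$ is a fundamental solution of the operator $-\Delta+(-\Delta)^s$, i.e. $[-\Delta+(-\Delta)^s]\Gamma=\delta_0$ in $\mathbb R^n$ in the distribution sense, where $\delta_0$ denotes the Dirac mass at the point $0$.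
   Context: $H$ is the heat kernel associated with $-\Delta+(-\Delta)^s$, the operator with Fourier multiplier $|\xi|^2+|\xi|^{2s}$. The fractional Laplacian is $$(-\Delta)^s u(x)=C_{n,s}\lim_{\varepsilon\searrow 0}\int_{\mathbb R^n\setminus B_\varepsilon(x)}\frac{u(x)-u(y)}{|x-y|^{n+2s}}\,dy,\qquad C_{n,s}=\frac{2^{2s}\Gamma_E(s+n/2)}{\pi^{n/2}|\Gamma_E(-s)|},$$ with $\Gamma_E$ the Euler Gamma function. The identity $[-\Delta+(-\Delta)^s]\Gamma=\delta_0$ in the distribution sense means $\int_{\mathbb R^n}\Gamma\,[-\Delta\phi+(-\Delta)^s\phi]\,dx=\phi(0)$ for every $\phi\in C_c^\infty(\mathbb R^n)$. *)

theory Defs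
  imports "HOL-Analysis.Analysis"
begin

text \<open>The general definitions are over an arbitrary Euclidean space of dimension n = DIM('a);
  Lebesgue integrals are taken with respect to lborel.\<close>

definition partial_deriv :: "'a::euclidean_space \<Rightarrow> ('a \<Rightarrow> real) \<Rightarrow> 'a \<Rightarrow> real" where
  "partial_deriv b u x = deriv (\<lambda>h. u (x + h *\<^sub>R b)) 0"

text \<open>The list gives the directions of an iterated partial derivative, outermost first.\<close>

definition iter_partial :: "'a::euclidean_space list \<Rightarrow> ('a \<Rightarrow> real) \<Rightarrow> 'a \<Rightarrow> real" where
  "iter_partial bs u = foldr partial_deriv bs u"

definition smooth_fun :: "('a::euclidean_space \<Rightarrow> real) \<Rightarrow> bool" where
  "smooth_fun u \<longleftrightarrow>
     (\<forall>bs. set bs \<subseteq> Basis \<longrightarrow>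
        continuous_on UNIV (iter_partial bs u) \<and>
        (\<forall>b\<in>Basis. \<forall>x. (\<lambda>h. iter_partial bs u (x + h *\<^sub>R b)) differentiable (at 0)))"

definition test_function :: "('a::euclidean_space \<Rightarrow> real) \<Rightarrow> bool" where
  "test_function \<phi> \<longleftrightarrow> smooth_fun \<phi> \<and> compact (closure {x. \<phi> x \<noteq> 0})"

definition laplacian :: "('a::euclidean_space \<Rightarrow> real) \<Rightarrow> 'a \<Rightarrow> real" where
  "laplacian u x = (\<Sum>b\<in>Basis. partial_deriv b (partial_deriv b u) x)"

definition frac_laplacian_const :: "nat \<Rightarrow> real \<Rightarrow> real" where
  "frac_laplacian_const n s =
     2 powr (2 * s) * Gamma (s + real n / 2) / (pi powr (real n / 2) * \<bar>Gamma (- s)\<bar>)"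

definition frac_laplacian :: "real \<Rightarrow> ('a::euclidean_space \<Rightarrow> real) \<Rightarrow> 'a \<Rightarrow> real" where
  "frac_laplacian s u x =
     frac_laplacian_const DIM('a) s *
     Lim (at_right 0) (\<lambda>\<epsilon>. LINT y : UNIV - ball x \<epsilon> | lborel.
        (u x - u y) / norm (x - y) powr (real DIM('a) + 2 * s))"

definition heat_kernel :: "real \<Rightarrow> 'a::euclidean_space \<Rightarrow> real \<Rightarrow> complex" where
  "heat_kernel s x t =
     1 / (2 * of_real pi) ^ DIM('a) *
     (LINT \<xi> | lborel.
        exp (- of_real (t * (norm \<xi> ^ 2 + norm \<xi> powr (2 * s))) + \<i> * of_real (x \<bullet> \<xi>)))"

text \<open>Complex-valued, because the integral defining the heat kernel is; that the values are real
  is not built in. At x = 0 the integral diverges, so the value there is the default 0 of the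
  Bochner integral and carries no information.\<close>

definition Gamma_kernel :: "real \<Rightarrow> 'a::euclidean_space \<Rightarrow> complex" where
  "Gamma_kernel s x = (LINT t : {0<..} | lborel. heat_kernel s x t)"

text \<open>The distributional identity for the operator applied to G. Integrability of the integrand
  is part of \<^const>\<open>has_bochner_integral\<close>; real-valued test functions suffice by linearity.\<close>

definition fundamental_solution :: "real \<Rightarrow> ('a::euclidean_space \<Rightarrow> complex) \<Rightarrow> bool" where
  "fundamental_solution s G \<longleftrightarrow>
     (\<forall>\<phi>. test_function \<phi> \<longrightarrow>
        has_bochner_integral lborel
          (\<lambda>x. G x * of_real (- laplacian \<phi> x + frac_laplacian s \<phi> x)) (of_real (\<phi> 0)))"

end

theory Submission
  imports Defs "HOL-Probability.Probability"
begin

text \<open>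
  The symbol of the operator is \<psi>(|\<xi>|^2) with \<psi>(l) = l + l^s. Since l^s is a positive
  multiple of the integral of (1 - exp(-l r)) r^(-1-s) over r > 0, the function exp(-t l^s) is a
  limit of mixtures of the exponentials exp(-l r), r \<ge> 0, with nonnegative weights. Hence an
  inequality between two Laplace transforms (the integrals of v exp(-\<tau> f) and of w
  exp(-\<tau> g), possibly over different measure spaces) that holds for all \<tau> \<ge> t
  survives when both exponentials are replaced by exp(-t \<psi>(f)) and exp(-t \<psi>(g)). This is
  laplace_order_powr and its form with drift, laplace_order_symbol.

  The heat kernel is a multiple of the integral of cos(x \<bullet> \<xi>) exp(-t \<psi>(|\<xi>|^2))
  over \<xi>. With exp(-\<tau> |\<xi>|^2) in place of the second factor the integral is
  (\<pi>/\<tau>)^(n/2) exp(-|x|^2/(4\<tau>)), so every bound on this explicit function of \<tau>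
  by a combination of exponentials in \<tau> is inherited by the heat kernel. Gaussians are
  positive and decrease in |x|, so the heat kernel is nonnegative and radially nonincreasing. With
  R = |x|^2, the Gaussian is at most a constant times the integral of l^(n/2-1) exp(-\<tau> l)
  over 0 < l \<le> 1/R (gauss_le_laplace) and at least a constant times R^(-n/2) (exp(-\<tau>/R) -
  2 exp(-B \<tau>/R)) (exp_difference_le_gauss). Transferring both and integrating over t > 0,
  which turns exp(-t \<psi>(l)) into 1/\<psi>(l), gives the two-sided estimate: 1/\<psi>(l) is at
  most 1/l and at most l^(-s), and choosing B^s = 4 makes the second term of the lower bound at
  most half of the first.

  For the distributional identity write g for the operator applied to a test function \<phi>.
  Everything is even in \<xi>, so cosine transforms suffice, and that of g is \<psi>(|\<xi>|^2)
  times that of \<phi>. Therefore the integral of H(x,t) g(x) over x is minus the time derivative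
  of the integral J(t) of H(x,t) \<phi>(x), and integrating over t > 0 leaves J(0+) -
  J(\<infinity>) = \<phi>(0). The limit at 0 comes from the maximum principle for H (again the
  comparison of Laplace transforms), and J decays like t^(-n/2). The same two facts bound the
  integral of H |g| over space and time, for n \<ge> 3 (green_pairing). It remains to compute the
  cosine transform of the fractional Laplacian, including its constant; writing |z|^(-n-2s) as a
  mixture of Gaussians reduces this to the Levy integral above.

  Below, heat_transform and green are H and \<Gamma> without the factor (2 \<pi>)^(-n).
\<close>

section \<open>Fourier transforms of Gaussians\<close>

text \<open>The characteristic function of the standard normal distribution, rescaled by the
  factor sqrt (2 * \<tau>).\<close>

lemma gaussian_fourier_1d:
  fixes y \<tau> :: real
  assumes "\<tau> > 0"
  shows "has_bochner_integral lborel (\<lambda>u. cis (y * u) * of_real (exp (- \<tau> * u\<^sup>2)))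
           (of_real (sqrt (pi / \<tau>) * exp (- y\<^sup>2 / (4 * \<tau>))))"
proof -
  define c where "c = sqrt (2 * \<tau>)"
  have c: "c > 0" "c\<^sup>2 = 2 * \<tau>"
    using assms by (auto simp: c_def)
  let ?f = "\<lambda>u. complex_of_real (std_normal_density u) * cis ((y / c) * u)"
  have "integrable lborel ?f"
    by (rule Bochner_Integration.integrable_bound[of _ std_normal_density])
       (use c in \<open>auto simp: norm_mult norm_divide std_normal_density_def
          intro!: borel_measurable_continuous_onI continuous_intros\<close>)
  moreover have "integral\<^sup>L lborel ?f = of_real (exp (- (y / c)\<^sup>2 / 2))"
    using fun_cong[OF char_std_normal_distribution, of "y / c"]
    by (simp add: char_def integral_density scaleR_conv_of_real cis_conv_exp)
  ultimately have "has_bochner_integral lborel ?f (of_real (exp (- (y / c)\<^sup>2 / 2)))"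
    by (simp add: has_bochner_integral_iff)
  then have "has_bochner_integral lborel (\<lambda>u. ?f (0 + c * u)) (of_real (exp (- (y / c)\<^sup>2 / 2)) /\<^sub>R \<bar>c\<bar>)"
    using c by (subst (asm) lborel_has_bochner_integral_real_affine_iff[of c _ _ 0]) auto
  then have "has_bochner_integral lborel (\<lambda>u. of_real (sqrt (2 * pi)) * ?f (0 + c * u))
     (of_real (sqrt (2 * pi)) * (of_real (exp (- (y / c)\<^sup>2 / 2)) /\<^sub>R \<bar>c\<bar>))"
    by (intro has_bochner_integral_mult_right) auto
  moreover have "of_real (sqrt (2 * pi)) * ?f (0 + c * u) = cis (y * u) * of_real (exp (- \<tau> * u\<^sup>2))" for u
  proof -
    have "sqrt (2 * pi) * std_normal_density (0 + c * u) = exp (- \<tau> * u\<^sup>2)"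
      using c by (simp add: std_normal_density_def power_mult_distrib)
    moreover have "(y / c) * (0 + c * u) = y * u"
      using c by simp
    ultimately show ?thesis
      by (simp only: mult.assoc[symmetric] of_real_mult[symmetric]) (simp only: mult.commute)
  qed
  moreover have "of_real (sqrt (2 * pi)) * (of_real (exp (- (y / c)\<^sup>2 / 2)) /\<^sub>R \<bar>c\<bar>)
     = complex_of_real (sqrt (pi / \<tau>) * exp (- y\<^sup>2 / (4 * \<tau>)))"
  proof -
    have 1: "sqrt (pi / \<tau>) = sqrt (2 * pi) * inverse \<bar>c\<bar>"
      using c by (simp add: c_def real_sqrt_divide real_sqrt_mult field_simps)
    have 2: "- y\<^sup>2 / (4 * \<tau>) = - (y / c)\<^sup>2 / 2"
      using c by (simp add: power_divide)
    show ?thesis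
      unfolding 1 2 scaleR_conv_of_real of_real_mult by (simp only: mult_ac)
  qed
  ultimately show ?thesis by simp
qed

text \<open>In complex form the integrand is a product over the coordinates, so the
  one-dimensional formula can be applied to each factor; its cosine part alone is not such a
  product.\<close>

lemma gaussian_fourier_cis:
  fixes x :: "'a::euclidean_space"
  assumes \<tau>: "\<tau> > 0"
  shows "has_bochner_integral lborel (\<lambda>\<xi>. cis (x \<bullet> \<xi>) * of_real (exp (- \<tau> * (norm \<xi>)\<^sup>2)))
           (of_real ((pi / \<tau>) powr (DIM('a) / 2) * exp (- (norm x)\<^sup>2 / (4 * \<tau>))))"
proof -
  interpret product_sigma_finite "\<lambda>b::'a. lborel :: real measure" ..
  let ?g = "\<lambda>b u. cis ((x \<bullet> b) * u) * of_real (exp (- \<tau> * u\<^sup>2))"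
  let ?F = "\<lambda>\<xi>. cis (x \<bullet> \<xi>) * complex_of_real (exp (- \<tau> * (norm \<xi>)\<^sup>2))"
  have F: "?F (\<Sum>b\<in>Basis. f b *\<^sub>R b) = (\<Prod>b\<in>Basis. ?g b (f b))" for f :: "'a \<Rightarrow> real"
  proof -
    have "(norm (\<Sum>b\<in>Basis. f b *\<^sub>R b))\<^sup>2 = (\<Sum>b\<in>Basis. (f b)\<^sup>2)"
      unfolding power2_norm_eq_inner
      by (subst euclidean_inner) (simp add: power2_eq_square)
    moreover have "x \<bullet> (\<Sum>b\<in>Basis. f b *\<^sub>R b) = (\<Sum>b\<in>Basis. (x \<bullet> b) * f b)"
      by (simp add: inner_sum_right mult.commute)
    moreover have "cis (\<Sum>b\<in>Basis. (x \<bullet> b) * f b) = (\<Prod>b\<in>Basis. cis ((x \<bullet> b) * f b))"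
      by (simp add: cis_conv_exp sum_distrib_left exp_sum)
    moreover have "exp (- \<tau> * (\<Sum>b\<in>(Basis::'a set). (f b)\<^sup>2)) = (\<Prod>b\<in>(Basis::'a set). exp (- \<tau> * (f b)\<^sup>2))"
      unfolding sum_distrib_left by (rule exp_sum) simp
    ultimately show ?thesis
      by (simp only: prod.distrib of_real_prod)
  qed
  have g: "has_bochner_integral lborel (?g b) (of_real (sqrt (pi / \<tau>) * exp (- (x \<bullet> b)\<^sup>2 / (4 * \<tau>))))" for b
    by (rule gaussian_fourier_1d[OF \<tau>])
  have F_meas: "?F \<in> borel_measurable borel"
    by (intro borel_measurable_continuous_onI continuous_intros)
  have S: "(\<lambda>f. \<Sum>b\<in>Basis. f b *\<^sub>R b) \<in> measurable (\<Pi>\<^sub>M b\<in>Basis. lborel) (borel :: 'a measure)"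
    by measurable
  have "integrable (\<Pi>\<^sub>M b\<in>Basis. lborel) (\<lambda>f::'a\<Rightarrow>real. \<Prod>b\<in>Basis. ?g b (f b))"
    by (rule product_integrable_prod) (use g in \<open>auto simp: has_bochner_integral_iff\<close>)
  then have "integrable lborel ?F"
    unfolding lborel_eq[where 'a='a] by (subst integrable_distr_eq[OF S F_meas]) (simp only: F)
  moreover have "integral\<^sup>L lborel ?F = (\<Prod>b\<in>Basis. of_real (sqrt (pi / \<tau>) * exp (- (x \<bullet> b)\<^sup>2 / (4 * \<tau>))))"
    unfolding lborel_eq[where 'a='a]
    unfolding integral_distr[OF S F_meas] F
    by (subst product_integral_prod) (use g in \<open>simp_all only: has_bochner_integral_iff finite_Basis\<close>)
  moreover have "(\<Prod>b\<in>(Basis::'a set). sqrt (pi / \<tau>) * exp (- (x \<bullet> b)\<^sup>2 / (4 * \<tau>)))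
      = (pi / \<tau>) powr (DIM('a) / 2) * exp (- (norm x)\<^sup>2 / (4 * \<tau>))"
  proof -
    have "sqrt (pi / \<tau>) ^ DIM('a) = (pi / \<tau>) powr (DIM('a) / 2)"
      using \<tau> by (simp add: powr_half_sqrt[symmetric] powr_powr flip: powr_realpow)
    moreover have "(norm x)\<^sup>2 = (\<Sum>b\<in>Basis. (x \<bullet> b)\<^sup>2)"
      unfolding power2_norm_eq_inner by (subst euclidean_inner) (simp add: power2_eq_square)
    moreover have "exp (- (\<Sum>b\<in>Basis. (x \<bullet> b)\<^sup>2) / (4 * \<tau>)) = (\<Prod>b\<in>Basis. exp (- (x \<bullet> b)\<^sup>2 / (4 * \<tau>)))"
      unfolding sum_negf[symmetric] sum_divide_distrib by (rule exp_sum) simp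
    ultimately show ?thesis
      by (simp only: prod.distrib prod_constant)
  qed
  ultimately show ?thesis
    unfolding has_bochner_integral_iff of_real_prod[symmetric] by (simp only: simp_thms)
qed

lemma gaussian_fourier:
  fixes x :: "'a::euclidean_space"
  assumes \<tau>: "\<tau> > 0"
  shows "has_bochner_integral lborel (\<lambda>\<xi>. cos (x \<bullet> \<xi>) * exp (- \<tau> * (norm \<xi>)\<^sup>2))
           ((pi / \<tau>) powr (DIM('a) / 2) * exp (- (norm x)\<^sup>2 / (4 * \<tau>)))"
  using has_bochner_integral_bounded_linear[OF bounded_linear_Re gaussian_fourier_cis[OF assms, of x]]
  by (simp add: Re_divide)

lemma gaussian_integral:
  assumes \<tau>: "\<tau> > 0"
  shows "has_bochner_integral lborel (\<lambda>\<xi>::'a::euclidean_space. exp (- \<tau> * (norm \<xi>)\<^sup>2)) ((pi / \<tau>) powr (DIM('a) / 2))"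
  using gaussian_fourier[OF assms, of "0::'a"] by simp

section \<open>Power and exponential integrals on the half-line\<close>

lemma nn_integral_Gamma_scaled:
  fixes a l :: real
  assumes "a > 0" "l > 0"
  shows "(\<integral>\<^sup>+v. ennreal (indicator {0<..} v * (v powr (a - 1) * exp (- l * v))) \<partial>lborel) = ennreal (Gamma a / l powr a)"
proof -
  have "ennreal (Gamma a) = (\<integral>\<^sup>+v. ennreal (indicator {0<..} v * (v powr (a - 1) * exp (- v))) \<partial>lborel)"
    unfolding Gamma_conv_nn_integral_real[OF assms(1)]
    by (intro nn_integral_cong_AE eventually_mono[OF AE_lborel_singleton[of 0]])
       (auto simp: indicator_def exp_minus field_simps)
  also have "\<dots> = ennreal \<bar>l\<bar> * (\<integral>\<^sup>+v. ennreal (indicator {0<..} (0 + l * v) * ((0 + l * v) powr (a - 1) * exp (- (0 + l * v)))) \<partial>lborel)"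
    using assms by (intro nn_integral_real_affine) auto
  also have "\<dots> = ennreal (l powr a) * (\<integral>\<^sup>+v. ennreal (indicator {0<..} v * (v powr (a - 1) * exp (- l * v))) \<partial>lborel)"
  proof -
    have "ennreal \<bar>l\<bar> * ennreal (indicator {0<..} (0 + l * v) * ((0 + l * v) powr (a - 1) * exp (- (0 + l * v))))
       = ennreal (l powr a) * ennreal (indicator {0<..} v * (v powr (a - 1) * exp (- l * v)))" for v
      using assms by (auto simp: indicator_def zero_less_mult_iff powr_mult powr_diff simp flip: ennreal_mult'')
    then show ?thesis
      by (subst (1 2) nn_integral_cmult[symmetric]) (auto intro!: nn_integral_cong)
  qed
  finally have *: "ennreal (Gamma a) = ennreal (l powr a) * (\<integral>\<^sup>+v. ennreal (indicator {0<..} v * (v powr (a - 1) * exp (- l * v))) \<partial>lborel)" .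
  have "ennreal (Gamma a / l powr a) = ennreal (1 / l powr a) * ennreal (Gamma a)"
    using assms by (simp flip: ennreal_mult'')
  also have "\<dots> = (ennreal (1 / l powr a) * ennreal (l powr a)) * (\<integral>\<^sup>+v. ennreal (indicator {0<..} v * (v powr (a - 1) * exp (- l * v))) \<partial>lborel)"
    unfolding * by (simp add: mult.assoc)
  also have "ennreal (1 / l powr a) * ennreal (l powr a) = 1"
    using assms by (simp flip: ennreal_mult'')
  finally show ?thesis by simp
qed

lemma nn_integral_powr_tail:
  fixes s q :: real
  assumes "s > 0" "q > 0"
  shows "(\<integral>\<^sup>+r. ennreal (indicator {q..} r * r powr (- 1 - s)) \<partial>lborel) = ennreal (q powr (- s) / s)"
proof -
  have "(\<integral>\<^sup>+r. ennreal (r powr (- 1 - s)) * indicator {q..} r \<partial>lborel) = 0 - (- (q powr (- s) / s))"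
  proof (rule nn_integral_FTC_atLeast)
    show "((\<lambda>r. - (r powr (- s) / s)) \<longlongrightarrow> 0) at_top"
    proof -
      have "((\<lambda>r::real. r powr (- s)) \<longlongrightarrow> 0) at_top"
        using assms by (intro tendsto_neg_powr filterlim_ident) auto
      from tendsto_minus[OF tendsto_divide[OF this tendsto_const[of s]]] assms show ?thesis by simp
    qed
    show "DERIV (\<lambda>r. - (r powr (- s) / s)) x :> x powr (- 1 - s)" if "q \<le> x" for x
      using assms that by (auto intro!: derivative_eq_intros simp: field_simps minus_diff_commute)
  qed auto
  moreover have "(\<integral>\<^sup>+r. ennreal (indicator {q..} r * r powr (- 1 - s)) \<partial>lborel)
     = (\<integral>\<^sup>+r. ennreal (r powr (- 1 - s)) * indicator {q..} r \<partial>lborel)"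
    by (intro nn_integral_cong) (auto split: split_indicator)
  ultimately show ?thesis by simp
qed

lemma nn_integral_powr_head:
  fixes a q :: real
  assumes "a > 0" "q \<ge> 0"
  shows "(\<integral>\<^sup>+r. ennreal (indicator {0<..q} r * r powr (a - 1)) \<partial>lborel) = ennreal (q powr a / a)"
proof -
  have "((\<lambda>x. x powr (a - 1)) has_integral (q powr (a - 1 + 1) / (a - 1 + 1))) {0..q}"
    by (rule has_integral_powr_from_0) (use assms in auto)
  then have "((\<lambda>x. x powr (a - 1)) has_integral (q powr a / a)) {0..q}" by simp
  then have "(\<integral>\<^sup>+r. ennreal (indicator {0..q} r * r powr (a - 1)) \<partial>lborel) = ennreal (q powr a / a)"
    by (intro nn_integral_has_integral_lebesgue) auto
  also have "(\<integral>\<^sup>+r. ennreal (indicator {0..q} r * r powr (a - 1)) \<partial>lborel)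
     = (\<integral>\<^sup>+r. ennreal (indicator {0<..q} r * r powr (a - 1)) \<partial>lborel)"
    by (intro nn_integral_cong_AE eventually_mono[OF AE_lborel_singleton[of 0]])
       (auto simp: indicator_def)
  finally show ?thesis .
qed

lemma nn_integral_exp_interval:
  fixes l r :: real
  assumes "l \<ge> 0" "r \<ge> 0"
  shows "(\<integral>\<^sup>+q. ennreal (indicator {0<..r} q * (l * exp (- l * q))) \<partial>lborel) = ennreal (1 - exp (- l * r))"
proof -
  have "(\<integral>\<^sup>+q. ennreal (l * exp (- l * q)) * indicator {0..r} q \<partial>lborel) = (- exp (- l * r)) - (- exp (- l * 0))"
    using assms by (intro nn_integral_FTC_Icc) (auto intro!: derivative_eq_intros)
  also have "(\<integral>\<^sup>+q. ennreal (l * exp (- l * q)) * indicator {0..r} q \<partial>lborel)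
     = (\<integral>\<^sup>+q. ennreal (indicator {0<..r} q * (l * exp (- l * q))) \<partial>lborel)"
    by (intro nn_integral_cong_AE eventually_mono[OF AE_lborel_singleton[of 0]])
       (auto simp: indicator_def)
  finally show ?thesis by simp
qed

lemma nn_integral_exp_powr:
  fixes l s :: real
  assumes "l \<ge> 0" "0 < s" "s < 1"
  shows "(\<integral>\<^sup>+q. ennreal (indicator {0<..} q * (l * exp (- l * q) * (q powr (- s) / s))) \<partial>lborel)
    = ennreal (l powr s * (Gamma (1 - s) / s))"
proof (cases "l = 0")
  case False
  then have l: "l > 0" using assms by simp
  have "(\<integral>\<^sup>+q. ennreal (indicator {0<..} q * (l * exp (- l * q) * (q powr (- s) / s))) \<partial>lborel)
     = (\<integral>\<^sup>+q. ennreal (l / s) * ennreal (indicator {0<..} q * (q powr ((1 - s) - 1) * exp (- l * q))) \<partial>lborel)"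
    using assms l by (intro nn_integral_cong) (auto simp: indicator_def simp flip: ennreal_mult'')
  also have "\<dots> = ennreal (l / s) * ennreal (Gamma (1 - s) / l powr (1 - s))"
    using assms l by (subst nn_integral_cmult, simp, subst nn_integral_Gamma_scaled) auto
  also have "\<dots> = ennreal (l / s * (Gamma (1 - s) / l powr (1 - s)))"
    using assms l by (simp flip: ennreal_mult'')
  also have "l / s * (Gamma (1 - s) / l powr (1 - s)) = l powr s * (Gamma (1 - s) / s)"
    using assms l by (simp add: powr_diff)
  finally show ?thesis .
qed simp

text \<open>The difference 1 - exp (- l * f r) is the integral of l * exp (- l * q) over 0 < q
  \<le> f r, so Tonelli's theorem reduces the integral to the measure of the sets {f \<ge> q}
  under the weight w. Power law tails lead to a Gamma integral. The weights used below are r powr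
  (- 1 - s) with f r = r, for the Levy representation of l powr s, and r powr (s - 1) with f r = 1
  / r, for the constant of the fractional Laplacian.\<close>

lemma nn_integral_one_minus_exp:
  fixes l s :: real and f w :: "real \<Rightarrow> real"
  assumes l: "l \<ge> 0" and s: "0 < s" "s < 1"
    and [measurable]: "f \<in> borel_measurable borel" "w \<in> borel_measurable borel"
    and nonneg: "\<And>r. r > 0 \<Longrightarrow> 0 \<le> f r" "\<And>r. 0 \<le> w r"
    and tail: "\<And>q. q > 0 \<Longrightarrow> (\<integral>\<^sup>+r. ennreal (indicator {r. 0 < r \<and> q \<le> f r} r * w r) \<partial>lborel) = ennreal (q powr (- s) / s)"
  shows "(\<integral>\<^sup>+r. ennreal (indicator {0<..} r * ((1 - exp (- l * f r)) * w r)) \<partial>lborel)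
    = ennreal (l powr s * (Gamma (1 - s) / s))"
proof -
  let ?k = "\<lambda>r q. indicator {0<..} r * (indicator {0<..f r} q * (l * exp (- l * q)) * w r) :: real"
  have "(\<integral>\<^sup>+r. ennreal (indicator {0<..} r * ((1 - exp (- l * f r)) * w r)) \<partial>lborel)
     = (\<integral>\<^sup>+r. (\<integral>\<^sup>+q. ennreal (?k r q) \<partial>lborel) \<partial>lborel)"
  proof (intro nn_integral_cong)
    fix r :: real
    show "ennreal (indicator {0<..} r * ((1 - exp (- l * f r)) * w r)) = (\<integral>\<^sup>+q. ennreal (?k r q) \<partial>lborel)"
    proof (cases "r > 0")
      case True
      have "(\<integral>\<^sup>+q. ennreal (?k r q) \<partial>lborel)
        = (\<integral>\<^sup>+q. ennreal (indicator {0<..f r} q * (l * exp (- l * q))) * ennreal (w r) \<partial>lborel)"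
        using True l nonneg by (intro nn_integral_cong) (auto simp: indicator_def ennreal_mult'')
      also have "\<dots> = ennreal (1 - exp (- l * f r)) * ennreal (w r)"
        using l nonneg(1)[OF True] by (subst nn_integral_multc, simp, subst nn_integral_exp_interval) auto
      finally show ?thesis using True nonneg by (simp add: ennreal_mult'')
    qed simp
  qed
  also have "\<dots> = (\<integral>\<^sup>+q. (\<integral>\<^sup>+r. ennreal (?k r q) \<partial>lborel) \<partial>lborel)"
  proof (rule lborel_pair.Fubini'[of "\<lambda>q r. ennreal (?k r q)"])
    have *: "(\<lambda>(q, r). ennreal (?k r q)) = (\<lambda>p. ennreal (if 0 < snd p \<and> 0 < fst p \<and> fst p \<le> f (snd p) then l * exp (- l * fst p) * w (snd p) else 0))"
      by (auto simp: fun_eq_iff indicator_def)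
    show "(\<lambda>(q, r). ennreal (?k r q)) \<in> borel_measurable (lborel \<Otimes>\<^sub>M lborel)"
      unfolding * by measurable
  qed
  also have "\<dots> = (\<integral>\<^sup>+q. ennreal (indicator {0<..} q * (l * exp (- l * q) * (q powr (- s) / s))) \<partial>lborel)"
  proof (intro nn_integral_cong)
    fix q :: real
    show "(\<integral>\<^sup>+r. ennreal (?k r q) \<partial>lborel) = ennreal (indicator {0<..} q * (l * exp (- l * q) * (q powr (- s) / s)))"
    proof (cases "q > 0")
      case True
      have "(\<integral>\<^sup>+r. ennreal (?k r q) \<partial>lborel)
        = (\<integral>\<^sup>+r. ennreal (l * exp (- l * q)) * ennreal (indicator {r. 0 < r \<and> q \<le> f r} r * w r) \<partial>lborel)"
        using True l nonneg by (intro nn_integral_cong) (auto simp: indicator_def ennreal_mult'')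
      also have "\<dots> = ennreal (l * exp (- l * q)) * ennreal (q powr (- s) / s)"
        by (subst nn_integral_cmult, measurable, subst tail[OF True]) auto
      finally show ?thesis using True s by (simp flip: ennreal_mult'')
    qed (auto simp: indicator_def)
  qed
  also have "\<dots> = ennreal (l powr s * (Gamma (1 - s) / s))"
    by (rule nn_integral_exp_powr) (use l s in auto)
  finally show ?thesis .
qed

text \<open>The representation of l powr s as a mixture of the functions 1 - exp (- l * r), which
  is what makes the power with exponent s a Bernstein function.\<close>

lemma nn_integral_levy:
  fixes l s :: real
  assumes "l \<ge> 0" "0 < s" "s < 1"
  shows "(\<integral>\<^sup>+r. ennreal (indicator {0<..} r * ((1 - exp (- l * r)) * r powr (- 1 - s))) \<partial>lborel)
    = ennreal (l powr s * (Gamma (1 - s) / s))"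
proof (rule nn_integral_one_minus_exp[OF assms])
  fix q :: real assume "q > 0"
  moreover from this have "{r. 0 < r \<and> q \<le> r} = {q..}" by auto
  ultimately show "(\<integral>\<^sup>+r. ennreal (indicator {r. 0 < r \<and> q \<le> r} r * r powr (- 1 - s)) \<partial>lborel) = ennreal (q powr (- s) / s)"
    using nn_integral_powr_tail[of s q] assms by simp
qed auto

lemma nn_integral_levy_inverse:
  fixes l s :: real
  assumes "l \<ge> 0" "0 < s" "s < 1"
  shows "(\<integral>\<^sup>+v. ennreal (indicator {0<..} v * ((1 - exp (- l / v)) * v powr (s - 1))) \<partial>lborel)
    = ennreal (l powr s * (Gamma (1 - s) / s))"
proof -
  have "(\<integral>\<^sup>+v. ennreal (indicator {0<..} v * ((1 - exp (- l * (1 / v))) * v powr (s - 1))) \<partial>lborel)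
    = ennreal (l powr s * (Gamma (1 - s) / s))"
  proof (rule nn_integral_one_minus_exp[OF assms])
    fix q :: real assume q: "q > 0"
    then have "{v. 0 < v \<and> q \<le> 1 / v} = {0<..1 / q}" by (auto simp: field_simps)
    then show "(\<integral>\<^sup>+v. ennreal (indicator {v. 0 < v \<and> q \<le> 1 / v} v * v powr (s - 1)) \<partial>lborel) = ennreal (q powr (- s) / s)"
      using nn_integral_powr_head[of s "1 / q"] assms q by (simp add: powr_divide powr_minus_divide)
  qed auto
  then show ?thesis by simp
qed

section \<open>Comparison of Laplace transforms under subordination\<close>

text \<open>The Laplace transform of the Levy density of l powr s, truncated to jumps of size at
  least e so that its total mass is finite.\<close>

definition levy_tail :: "real \<Rightarrow> real \<Rightarrow> real \<Rightarrow> real" where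
  "levy_tail s e l = (LINT r|lborel. indicator {e..} r * (exp (- l * r) * r powr (- 1 - s)))"

lemma integrable_powr_tail:
  fixes s e :: real
  assumes "s > 0" "e > 0"
  shows "integrable lborel (\<lambda>r. indicator {e..} r * r powr (- 1 - s))"
  by (rule integrableI_nonneg) (use nn_integral_powr_tail[OF assms] in auto)

lemma integrable_levy_tail:
  fixes s e l :: real
  assumes "s > 0" "e > 0" "l \<ge> 0"
  shows "integrable lborel (\<lambda>r. indicator {e..} r * (exp (- l * r) * r powr (- 1 - s)))"
  by (rule Bochner_Integration.integrable_bound[OF integrable_powr_tail[OF assms(1,2)]])
     (use assms in \<open>auto simp: indicator_def mult_left_le_one_le\<close>)

lemma levy_tail_nonneg: "0 \<le> levy_tail s e l"
  unfolding levy_tail_def by (intro integral_nonneg_AE) auto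

lemma levy_tail_le:
  assumes "s > 0" "e > 0" "l \<ge> 0"
  shows "levy_tail s e l \<le> levy_tail s e 0"
  unfolding levy_tail_def
  by (intro integral_mono integrable_levy_tail)
     (use assms in \<open>auto simp: indicator_def mult_left_le_one_le\<close>)

lemma borel_measurable_levy_tail [measurable]: "levy_tail s e \<in> borel_measurable borel"
  unfolding levy_tail_def[abs_def] by measurable

lemma has_bochner_integral_levy:
  fixes l s :: real
  assumes "l \<ge> 0" "0 < s" "s < 1"
  shows "has_bochner_integral lborel (\<lambda>r. indicator {0<..} r * ((1 - exp (- l * r)) * r powr (- 1 - s)))
    (l powr s * (Gamma (1 - s) / s))"
  by (rule has_bochner_integral_nn_integral[OF _ _ _ nn_integral_levy[OF assms]])
     (use assms in \<open>auto simp: indicator_def intro!: mult_nonneg_nonneg less_imp_le[OF Gamma_real_pos]\<close>)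

lemma levy_tail_tendsto:
  fixes l s :: real
  assumes l: "l \<ge> 0" and s: "0 < s" "s < 1"
  shows "(\<lambda>n. levy_tail s (inverse (Suc n)) 0 - levy_tail s (inverse (Suc n)) l) \<longlonglongrightarrow> l powr s * (Gamma (1 - s) / s)"
proof -
  let ?F = "\<lambda>r. indicator {0<..} r * ((1 - exp (- l * r)) * r powr (- 1 - s))"
  let ?f = "\<lambda>n r. indicator {inverse (real (Suc n))..} r * ((1 - exp (- l * r)) * r powr (- 1 - s))"
  have F: "has_bochner_integral lborel ?F (l powr s * (Gamma (1 - s) / s))"
    by (rule has_bochner_integral_levy[OF assms])
  have "(\<lambda>n. integral\<^sup>L lborel (?f n)) \<longlonglongrightarrow> integral\<^sup>L lborel ?F"
  proof (rule integral_dominated_convergence[where w = ?F])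
    show "AE r in lborel. norm (?f n r) \<le> ?F r" for n
    proof (intro always_eventually allI)
      fix r :: real
      show "norm (?f n r) \<le> ?F r"
      proof (cases "inverse (real (Suc n)) \<le> r")
        case True
        then have "0 < r" by (rule less_le_trans[rotated]) simp
        then show ?thesis using True l by (simp add: indicator_def)
      next
        case False
        then show ?thesis using l by (simp add: indicator_def)
      qed
    qed
    show "AE r in lborel. (\<lambda>n. ?f n r) \<longlonglongrightarrow> ?F r"
    proof (intro always_eventually allI)
      fix r :: real
      have "eventually (\<lambda>n. indicator {inverse (real (Suc n))..} r = (indicator {0<..} r :: real)) sequentially"
      proof (cases "r > 0")
        case True
        then have "eventually (\<lambda>n. inverse (real (Suc n)) < r) sequentially"
          using LIMSEQ_inverse_real_of_nat order_tendstoD(2) by blast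
        then show ?thesis
          by eventually_elim (use True in \<open>auto simp: indicator_def\<close>)
      next
        case False
        have "\<not> inverse (real (Suc n)) \<le> r" for n
        proof -
          have "0 < inverse (real (Suc n))" by simp
          with False show ?thesis by linarith
        qed
        with False show ?thesis by (auto simp: indicator_def)
      qed
      then show "(\<lambda>n. ?f n r) \<longlonglongrightarrow> ?F r"
        by (intro tendsto_eventually) (auto elim!: eventually_mono)
    qed
  qed (use F in \<open>auto simp: has_bochner_integral_iff\<close>)
  moreover have "integral\<^sup>L lborel (?f n) = levy_tail s (inverse (Suc n)) 0 - levy_tail s (inverse (Suc n)) l" for n
  proof -
    let ?e = "inverse (real (Suc n))"
    have "levy_tail s ?e 0 - levy_tail s ?e l
      = (LINT r|lborel. indicator {?e..} r * (exp (- 0 * r) * r powr (- 1 - s)) - indicator {?e..} r * (exp (- l * r) * r powr (- 1 - s)))"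
      unfolding levy_tail_def
      by (rule Bochner_Integration.integral_diff[symmetric]; rule integrable_levy_tail) (use assms in simp_all)
    also have "\<dots> = integral\<^sup>L lborel (?f n)"
      by (intro Bochner_Integration.integral_cong) (simp_all add: algebra_simps)
    finally show ?thesis by simp
  qed
  ultimately show ?thesis using F by (simp add: has_bochner_integral_iff)
qed

text \<open>A factor levy_tail is an integral of exponentials exp (- r * f x), which merge with
  the exponential already present. A power of levy_tail is thereby lowered by one, at the price of
  an average with nonnegative weights over larger values of the Laplace variable.\<close>

lemma laplace_levy_tail_step:
  fixes f v :: "'b \<Rightarrow> real"
  assumes M: "sigma_finite_measure M" and v: "integrable M v"
    and f[measurable]: "f \<in> borel_measurable M" and f0: "\<And>x. 0 \<le> f x"
    and s: "s > 0" and e: "e > 0" and \<sigma>: "\<sigma> \<ge> 0"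
  shows "(LINT x|M. v x * exp (- \<sigma> * f x) * levy_tail s e (f x) ^ Suc j)
     = (LINT r|lborel. indicator {e..} r * r powr (- 1 - s) * (LINT x|M. v x * exp (- (\<sigma> + r) * f x) * levy_tail s e (f x) ^ j))" (is ?eq)
    and "integrable lborel (\<lambda>r. indicator {e..} r * r powr (- 1 - s) * (LINT x|M. v x * exp (- (\<sigma> + r) * f x) * levy_tail s e (f x) ^ j))" (is ?int)
proof -
  interpret M: sigma_finite_measure M by fact
  interpret pair_sigma_finite M "lborel :: real measure" ..
  have [measurable]: "v \<in> borel_measurable M" using v by auto
  let ?h = "\<lambda>x r. v x * exp (- \<sigma> * f x) * levy_tail s e (f x) ^ j * (indicator {e..} r * (exp (- f x * r) * r powr (- 1 - s)))"
  have meas: "case_prod ?h \<in> borel_measurable (M \<Otimes>\<^sub>M lborel)"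
    by measurable
  have inner: "integrable lborel (\<lambda>r. ?h x r)" for x
    by (intro integrable_mult_right integrable_levy_tail s e f0)
  have bnd: "norm (v x * exp (- \<sigma> * f x) * levy_tail s e (f x) ^ k) \<le> levy_tail s e 0 ^ k * norm (v x)" for x k
  proof -
    have "\<bar>v x\<bar> * exp (- \<sigma> * f x) * levy_tail s e (f x) ^ k \<le> \<bar>v x\<bar> * 1 * levy_tail s e 0 ^ k"
      using \<sigma> f0[of x] s e by (intro mult_mono power_mono levy_tail_le levy_tail_nonneg) (auto intro!: mult_nonneg_nonneg zero_le_power levy_tail_nonneg)
    then show ?thesis using levy_tail_nonneg[of s e "f x"] by (simp add: abs_mult mult_ac)
  qed
  have "integrable (M \<Otimes>\<^sub>M lborel) (case_prod ?h)"
  proof (rule Fubini_integrable)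
    have *: "(LINT r|lborel. norm (case_prod ?h (x, r))) = \<bar>v x\<bar> * exp (- \<sigma> * f x) * levy_tail s e (f x) ^ Suc j" for x
    proof -
      have "(LINT r|lborel. norm (case_prod ?h (x, r)))
        = (LINT r|lborel. (\<bar>v x\<bar> * exp (- \<sigma> * f x) * levy_tail s e (f x) ^ j) * (indicator {e..} r * (exp (- f x * r) * r powr (- 1 - s))))"
        by (intro Bochner_Integration.integral_cong) (auto simp: abs_mult levy_tail_nonneg)
      also have "\<dots> = (\<bar>v x\<bar> * exp (- \<sigma> * f x) * levy_tail s e (f x) ^ j) * levy_tail s e (f x)"
        unfolding levy_tail_def by (rule integral_mult_right_zero)
      finally show ?thesis by (simp add: mult_ac)
    qed
    show "integrable M (\<lambda>x. LINT r|lborel. norm (case_prod ?h (x, r)))"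
      unfolding *
    proof (rule Bochner_Integration.integrable_bound)
      show "integrable M (\<lambda>x. levy_tail s e 0 ^ Suc j * norm (v x))"
        using v by auto
      show "AE x in M. norm (\<bar>v x\<bar> * exp (- \<sigma> * f x) * levy_tail s e (f x) ^ Suc j) \<le> norm (levy_tail s e 0 ^ Suc j * norm (v x))"
        using bnd[of _ "Suc j"] levy_tail_nonneg[of s e 0] by (auto simp: abs_mult)
    qed measurable
  qed (use meas inner in auto)
  from integrable_snd[OF this] Fubini_integral[OF this]
  have A: "(LINT r|lborel. LINT x|M. ?h x r) = (LINT x|M. LINT r|lborel. ?h x r)"
    and B: "integrable lborel (\<lambda>r. LINT x|M. ?h x r)" by auto
  have C: "(LINT x|M. ?h x r) = indicator {e..} r * r powr (- 1 - s) * (LINT x|M. v x * exp (- (\<sigma> + r) * f x) * levy_tail s e (f x) ^ j)" for r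
  proof -
    have "exp (- (\<sigma> + r) * f x) = exp (- \<sigma> * f x) * exp (- f x * r)" for x
      by (simp add: algebra_simps flip: exp_add)
    then have "(LINT x|M. ?h x r) = (LINT x|M. indicator {e..} r * r powr (- 1 - s) * (v x * exp (- (\<sigma> + r) * f x) * levy_tail s e (f x) ^ j))"
      by (intro Bochner_Integration.integral_cong) (simp_all only: mult_ac)
    then show ?thesis by simp
  qed
  have D: "(LINT r|lborel. ?h x r) = v x * exp (- \<sigma> * f x) * levy_tail s e (f x) ^ Suc j" for x
    by (subst integral_mult_right_zero) (simp add: levy_tail_def mult_ac)
  show ?eq using A unfolding C D by simp
  show ?int using B unfolding C .
qed

text \<open>By laplace_levy_tail_step both sides are averages of the same two expressions with
  exponent j - 1, taken with the same nonnegative weights.\<close>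

lemma laplace_order_levy_tail_power:
  fixes f v :: "'b \<Rightarrow> real" and g w :: "'c \<Rightarrow> real"
  assumes M: "sigma_finite_measure M" "integrable M v" "f \<in> borel_measurable M" "\<And>x. 0 \<le> f x"
    and N: "sigma_finite_measure N" "integrable N w" "g \<in> borel_measurable N" "\<And>x. 0 \<le> g x"
    and s: "s > 0" and e: "e > 0"
    and le: "\<And>\<sigma>. \<sigma> \<ge> 0 \<Longrightarrow> (LINT x|M. v x * exp (- \<sigma> * f x)) \<le> (LINT y|N. w y * exp (- \<sigma> * g y))"
    and \<sigma>: "\<sigma> \<ge> 0"
  shows "(LINT x|M. v x * exp (- \<sigma> * f x) * levy_tail s e (f x) ^ j)
      \<le> (LINT y|N. w y * exp (- \<sigma> * g y) * levy_tail s e (g y) ^ j)"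
  using \<sigma>
proof (induction j arbitrary: \<sigma>)
  case (Suc j)
  note step = laplace_levy_tail_step[OF M s e Suc.prems, of j] laplace_levy_tail_step[OF N s e Suc.prems, of j]
  show ?case
    unfolding step(1) step(3)
  proof (rule integral_mono[OF step(2) step(4)])
    fix r :: real
    show "indicator {e..} r * r powr (- 1 - s) * (LINT x|M. v x * exp (- (\<sigma> + r) * f x) * levy_tail s e (f x) ^ j)
      \<le> indicator {e..} r * r powr (- 1 - s) * (LINT y|N. w y * exp (- (\<sigma> + r) * g y) * levy_tail s e (g y) ^ j)"
      using Suc.IH[of "\<sigma> + r"] Suc.prems e by (cases "e \<le> r") (auto intro!: mult_left_mono)
  qed
qed (use le in simp)

text \<open>The exponential of a multiple of levy_tail is a power series with nonnegative
  coefficients, so an inequality known for all powers of levy_tail passes to it.\<close>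

lemma integral_exp_levy_tail_sums:
  fixes f v :: "'b \<Rightarrow> real"
  assumes v: "integrable M v"
    and f[measurable]: "f \<in> borel_measurable M" and f0: "\<And>x. 0 \<le> f x"
    and s: "s > 0" and e: "e > 0" and c: "c \<ge> 0"
  shows "(\<lambda>J. \<Sum>j<J. c ^ j / fact j * (LINT x|M. v x * levy_tail s e (f x) ^ j))
     \<longlonglongrightarrow> (LINT x|M. v x * exp (c * levy_tail s e (f x)))"
proof -
  have [measurable]: "v \<in> borel_measurable M" using v by auto
  let ?Q = "levy_tail s e"
  have Q: "0 \<le> ?Q (f x)" "?Q (f x) \<le> ?Q 0" for x
    using levy_tail_nonneg levy_tail_le[OF s e f0] by auto
  have exp_sums: "(\<lambda>J. \<Sum>j<J. (c * ?Q (f x)) ^ j / fact j) \<longlonglongrightarrow> exp (c * ?Q (f x))" for x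
    using exp_converges[of "c * ?Q (f x)"] by (simp add: sums_def divide_inverse mult.commute)
  have int: "integrable M (\<lambda>x. v x * ?Q (f x) ^ j)" for j
  proof (rule Bochner_Integration.integrable_bound)
    show "integrable M (\<lambda>x. ?Q 0 ^ j * v x)" using v by auto
    show "AE x in M. norm (v x * ?Q (f x) ^ j) \<le> norm (?Q 0 ^ j * v x)"
      using Q by (auto simp: abs_mult mult.commute levy_tail_nonneg intro!: mult_left_mono power_mono)
  qed measurable
  have "(\<lambda>J. LINT x|M. v x * (\<Sum>j<J. (c * ?Q (f x)) ^ j / fact j)) \<longlonglongrightarrow> (LINT x|M. v x * exp (c * ?Q (f x)))"
  proof (rule integral_dominated_convergence[where w = "\<lambda>x. norm (v x) * exp (c * ?Q 0)"])
    show "AE x in M. norm (v x * (\<Sum>j<J. (c * ?Q (f x)) ^ j / fact j)) \<le> norm (v x) * exp (c * ?Q 0)" for J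
    proof (intro always_eventually allI)
      fix x
      have "(\<Sum>j<J. (c * ?Q (f x)) ^ j / fact j) \<le> exp (c * ?Q (f x))"
        by (rule incseq_le[OF _ exp_sums]) (use c Q in \<open>auto simp: incseq_Suc_iff\<close>)
      also have "\<dots> \<le> exp (c * ?Q 0)" using c Q by (auto intro: mult_left_mono)
      finally show "norm (v x * (\<Sum>j<J. (c * ?Q (f x)) ^ j / fact j)) \<le> norm (v x) * exp (c * ?Q 0)"
        using c Q by (simp add: abs_mult sum_nonneg mult_left_mono)
    qed
    show "AE x in M. (\<lambda>J. v x * (\<Sum>j<J. (c * ?Q (f x)) ^ j / fact j)) \<longlonglongrightarrow> v x * exp (c * ?Q (f x))"
      using exp_sums by (auto intro!: tendsto_mult_left)
  qed (use v in auto)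
  moreover have "(LINT x|M. v x * (\<Sum>j<J. (c * ?Q (f x)) ^ j / fact j)) = (\<Sum>j<J. c ^ j / fact j * (LINT x|M. v x * ?Q (f x) ^ j))" for J
  proof -
    have "(LINT x|M. v x * (\<Sum>j<J. (c * ?Q (f x)) ^ j / fact j)) = (LINT x|M. (\<Sum>j<J. c ^ j / fact j * (v x * ?Q (f x) ^ j)))"
      by (simp add: sum_distrib_left power_mult_distrib mult_ac)
    also have "\<dots> = (\<Sum>j<J. c ^ j / fact j * (LINT x|M. v x * ?Q (f x) ^ j))"
      using int by (subst Bochner_Integration.integral_sum) auto
    finally show ?thesis .
  qed
  ultimately show ?thesis by simp
qed

text \<open>These are the Laplace transforms of compound Poisson approximations to a stable
  subordinator; the constant c undoes the factor Gamma (1 - s) / s of levy_tail_tendsto.\<close>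

lemma integral_exp_levy_tail_tendsto:
  fixes f v :: "'b \<Rightarrow> real"
  assumes v: "integrable M v"
    and f[measurable]: "f \<in> borel_measurable M" and f0: "\<And>x. 0 \<le> f x"
    and s: "0 < s" "s < 1" and t: "t \<ge> 0"
  defines "c \<equiv> t * (s / Gamma (1 - s))"
  shows "(\<lambda>n. exp (- c * levy_tail s (inverse (Suc n)) 0) * (LINT x|M. v x * exp (c * levy_tail s (inverse (Suc n)) (f x))))
     \<longlonglongrightarrow> (LINT x|M. v x * exp (- t * f x powr s))"
proof -
  have [measurable]: "v \<in> borel_measurable M" using v by auto
  have G: "Gamma (1 - s) > 0" using s by simp
  have c: "c \<ge> 0" using s t G by (simp add: c_def)
  let ?d = "\<lambda>n x. levy_tail s (inverse (Suc n)) 0 - levy_tail s (inverse (Suc n)) (f x)"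
  have "(\<lambda>n. LINT x|M. v x * exp (- c * ?d n x)) \<longlonglongrightarrow> (LINT x|M. v x * exp (- t * f x powr s))"
  proof (rule integral_dominated_convergence[where w = "\<lambda>x. norm (v x)"])
    show "AE x in M. norm (v x * exp (- c * ?d n x)) \<le> norm (v x)" for n
    proof (intro always_eventually allI)
      fix x
      have "?d n x \<ge> 0" using levy_tail_le[of s "inverse (Suc n)" "f x"] s f0 by simp
      then show "norm (v x * exp (- c * ?d n x)) \<le> norm (v x)"
        using c by (simp add: abs_mult mult_left_le)
    qed
    show "AE x in M. (\<lambda>n. v x * exp (- c * ?d n x)) \<longlonglongrightarrow> v x * exp (- t * f x powr s)"
    proof (intro always_eventually allI)
      fix x
      have "- c * (f x powr s * (Gamma (1 - s) / s)) = - t * f x powr s"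
        using s less_imp_neq[OF G] by (simp add: c_def)
      moreover have "(\<lambda>n. v x * exp (- c * ?d n x)) \<longlonglongrightarrow> v x * exp (- c * (f x powr s * (Gamma (1 - s) / s)))"
        by (intro tendsto_intros levy_tail_tendsto f0 s)
      ultimately show "(\<lambda>n. v x * exp (- c * ?d n x)) \<longlonglongrightarrow> v x * exp (- t * f x powr s)"
        by simp
    qed
  qed (use v in auto)
  moreover have "(LINT x|M. v x * exp (- c * ?d n x)) = exp (- c * levy_tail s (inverse (Suc n)) 0) * (LINT x|M. v x * exp (c * levy_tail s (inverse (Suc n)) (f x)))" for n
  proof -
    have "v x * exp (- c * ?d n x) = exp (- c * levy_tail s (inverse (Suc n)) 0) * (v x * exp (c * levy_tail s (inverse (Suc n)) (f x)))" for x
      by (simp add: algebra_simps exp_diff exp_minus divide_inverse)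
    then show ?thesis by (simp only: integral_mult_right_zero)
  qed
  ultimately show ?thesis by simp
qed

text \<open>The order between Laplace transforms is preserved by subordination. The two sides may
  live on different measure spaces. This is used to compare Fourier integrals over space with
  integrals over l > 0 and with sums of two exponentials.\<close>

theorem laplace_order_powr:
  fixes f v :: "'b \<Rightarrow> real" and g w :: "'c \<Rightarrow> real"
  assumes M: "sigma_finite_measure M" "integrable M v" "f \<in> borel_measurable M" "\<And>x. 0 \<le> f x"
    and N: "sigma_finite_measure N" "integrable N w" "g \<in> borel_measurable N" "\<And>x. 0 \<le> g x"
    and s: "0 < s" "s < 1" and t: "t \<ge> 0"
    and le: "\<And>\<sigma>. \<sigma> \<ge> 0 \<Longrightarrow> (LINT x|M. v x * exp (- \<sigma> * f x)) \<le> (LINT y|N. w y * exp (- \<sigma> * g y))"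
  shows "(LINT x|M. v x * exp (- t * f x powr s)) \<le> (LINT y|N. w y * exp (- t * g y powr s))"
proof -
  define c where "c = t * (s / Gamma (1 - s))"
  have "Gamma (1 - s) > 0" using s by simp
  then have c: "c \<ge> 0" using s t by (simp add: c_def)
  have "(LINT x|M. v x * exp (c * levy_tail s e (f x))) \<le> (LINT y|N. w y * exp (c * levy_tail s e (g y)))" if "e > 0" for e
  proof (rule LIMSEQ_le[OF integral_exp_levy_tail_sums[OF M(2-4) s(1) that c] integral_exp_levy_tail_sums[OF N(2-4) s(1) that c]])
    show "\<exists>N0. \<forall>J\<ge>N0. (\<Sum>j<J. c ^ j / fact j * (LINT x|M. v x * levy_tail s e (f x) ^ j))
       \<le> (\<Sum>j<J. c ^ j / fact j * (LINT y|N. w y * levy_tail s e (g y) ^ j))"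
      using laplace_order_levy_tail_power[OF M N s(1) that le, of 0] c
      by (intro exI allI impI sum_mono mult_left_mono) auto
  qed
  then have "(LINT x|M. v x * exp (c * levy_tail s (inverse (Suc n)) (f x))) \<le> (LINT y|N. w y * exp (c * levy_tail s (inverse (Suc n)) (g y)))" for n
    by simp
  then show ?thesis
    by (intro LIMSEQ_le[OF integral_exp_levy_tail_tendsto[OF M(2-4) s t, folded c_def]
              integral_exp_levy_tail_tendsto[OF N(2-4) s t, folded c_def]])
       (intro exI allI impI mult_left_mono, auto)
qed

section \<open>The symbol and the heat kernel\<close>

definition symbol :: "real \<Rightarrow> real \<Rightarrow> real" where
  "symbol s l = l + l powr s"

lemma borel_measurable_symbol [measurable]: "symbol s \<in> borel_measurable borel"
  unfolding symbol_def[abs_def] by measurable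

lemma symbol_nonneg: "l \<ge> 0 \<Longrightarrow> symbol s l \<ge> 0"
  by (simp add: symbol_def)

lemma symbol_pos: "l > 0 \<Longrightarrow> symbol s l > 0"
  by (simp add: symbol_def add_pos_nonneg)

lemma symbol_norm: "symbol s ((norm \<xi>)\<^sup>2) = (norm \<xi>)\<^sup>2 + norm \<xi> powr (2 * s)"
  by (cases "norm \<xi> = 0") (simp_all add: symbol_def powr_powr flip: powr_numeral)

text \<open>The linear part of the symbol only shifts the Laplace variable. It is absorbed into
  the weights, which then need to be integrable only after multiplication by exp (- t * f x), and
  the inequality is only needed for \<tau> \<ge> t. This matters because weights such as cos (x
  \<bullet> \<xi>) are not integrable by themselves.\<close>

lemma laplace_order_symbol:
  fixes f v :: "'b \<Rightarrow> real" and g w :: "'c \<Rightarrow> real"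
  assumes M: "sigma_finite_measure M" "integrable M (\<lambda>x. v x * exp (- t * f x))" "f \<in> borel_measurable M" "\<And>x. 0 \<le> f x"
    and N: "sigma_finite_measure N" "integrable N (\<lambda>y. w y * exp (- t * g y))" "g \<in> borel_measurable N" "\<And>x. 0 \<le> g x"
    and s: "0 < s" "s < 1" and t: "t \<ge> 0"
    and le: "\<And>\<tau>. \<tau> \<ge> t \<Longrightarrow> (LINT x|M. v x * exp (- \<tau> * f x)) \<le> (LINT y|N. w y * exp (- \<tau> * g y))"
  shows "(LINT x|M. v x * exp (- t * symbol s (f x))) \<le> (LINT y|N. w y * exp (- t * symbol s (g y)))"
proof -
  have *: "a * exp (- t * b) * exp (- \<sigma> * b) = a * exp (- (t + \<sigma>) * b)" for a b \<sigma> :: real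
    by (simp add: algebra_simps flip: exp_add)
  have **: "a * exp (- t * b) * exp (- t * b powr s) = a * exp (- t * symbol s b)" for a b :: real
    by (simp add: symbol_def algebra_simps flip: exp_add)
  have "(LINT x|M. v x * exp (- t * f x) * exp (- t * f x powr s)) \<le> (LINT y|N. w y * exp (- t * g y) * exp (- t * g y powr s))"
  proof (rule laplace_order_powr[OF M N s t])
    fix \<sigma> :: real assume "\<sigma> \<ge> 0"
    then show "(LINT x|M. v x * exp (- t * f x) * exp (- \<sigma> * f x)) \<le> (LINT y|N. w y * exp (- t * g y) * exp (- \<sigma> * g y))"
      unfolding * by (intro le) simp
  qed
  then show ?thesis unfolding ** .
qed

definition heat_transform :: "real \<Rightarrow> real \<Rightarrow> 'a::euclidean_space \<Rightarrow> real" where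
  "heat_transform s t x = (LINT \<xi>|lborel. cos (x \<bullet> \<xi>) * exp (- t * symbol s ((norm \<xi>)\<^sup>2)))"

lemma borel_measurable_heat_transform [measurable]:
  "(\<lambda>(t, x). heat_transform s t x) \<in> borel_measurable (borel \<Otimes>\<^sub>M borel)"
  unfolding heat_transform_def by measurable

lemma borel_measurable_heat_transform' [measurable (raw)]:
  assumes "f \<in> borel_measurable M" "g \<in> borel_measurable M"
  shows "(\<lambda>z. heat_transform s (f z) (g z)) \<in> borel_measurable M"
  using measurable_compose[OF measurable_Pair[OF assms] borel_measurable_heat_transform[of s]] by simp

lemma integrable_gauss_bound:
  assumes "t > 0" "f \<in> borel_measurable borel" "\<And>\<xi>. \<bar>f \<xi>\<bar> \<le> C"
  shows "integrable lborel (\<lambda>\<xi>::'a::euclidean_space. f \<xi> * exp (- t * (norm \<xi>)\<^sup>2))"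
proof (rule Bochner_Integration.integrable_bound)
  show "integrable lborel (\<lambda>\<xi>::'a. C * exp (- t * (norm \<xi>)\<^sup>2))"
    using gaussian_integral[OF assms(1)] by (auto simp: has_bochner_integral_iff)
  show "AE x in lborel. norm (f x * exp (- t * (norm x)\<^sup>2)) \<le> norm (C * exp (- t * (norm x)\<^sup>2))"
    using assms(3) by (auto simp: abs_mult intro!: mult_right_mono order_trans[OF assms(3) abs_ge_self])
qed (use assms in measurable)

lemma integrable_symbol_bound:
  assumes "t > 0" "f \<in> borel_measurable borel" "\<And>\<xi>. \<bar>f \<xi>\<bar> \<le> C"
  shows "integrable lborel (\<lambda>\<xi>::'a::euclidean_space. f \<xi> * exp (- t * symbol s ((norm \<xi>)\<^sup>2)))"
proof (rule Bochner_Integration.integrable_bound[OF integrable_gauss_bound[OF assms]])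
  show "AE x in lborel. norm (f x * exp (- t * symbol s ((norm x)\<^sup>2))) \<le> norm (f x * exp (- t * (norm x)\<^sup>2))"
    using assms(1) by (auto simp: abs_mult symbol_def intro!: mult_left_mono)
qed (use assms in measurable)

lemma integrable_heat_transform:
  fixes x :: "'a::euclidean_space"
  assumes "t > 0"
  shows "integrable lborel (\<lambda>\<xi>. cos (x \<bullet> \<xi>) * exp (- t * symbol s ((norm \<xi>)\<^sup>2)))"
  by (rule integrable_symbol_bound[OF assms, of _ 1]) auto

lemma abs_heat_transform_le:
  fixes x :: "'a::euclidean_space"
  assumes t: "t > 0"
  shows "\<bar>heat_transform s t x\<bar> \<le> (pi / t) powr (DIM('a) / 2)"
proof -
  have "\<bar>heat_transform s t x\<bar> \<le> (LINT \<xi>|lborel. \<bar>cos (x \<bullet> \<xi>) * exp (- t * symbol s ((norm \<xi>)\<^sup>2))\<bar>)"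
    unfolding heat_transform_def by (rule integral_abs_bound)
  also have "\<dots> \<le> (LINT \<xi>|lborel. exp (- t * (norm (\<xi>::'a))\<^sup>2))"
  proof (rule integral_mono)
    show "integrable lborel (\<lambda>\<xi>. \<bar>cos (x \<bullet> \<xi>) * exp (- t * symbol s ((norm \<xi>)\<^sup>2))\<bar>)"
      using integrable_heat_transform[OF t, of x s] by auto
    show "integrable lborel (\<lambda>\<xi>::'a. exp (- t * (norm \<xi>)\<^sup>2))"
      using gaussian_integral[OF t] by (auto simp: has_bochner_integral_iff)
    show "\<bar>cos (x \<bullet> \<xi>) * exp (- t * symbol s ((norm \<xi>)\<^sup>2))\<bar> \<le> exp (- t * (norm \<xi>)\<^sup>2)" for \<xi>
    proof -
      have "\<bar>cos (x \<bullet> \<xi>)\<bar> * exp (- t * symbol s ((norm \<xi>)\<^sup>2)) \<le> 1 * exp (- t * (norm \<xi>)\<^sup>2)"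
        using t by (intro mult_mono) (auto simp: symbol_def)
      then show ?thesis by (simp add: abs_mult)
    qed
  qed
  also have "\<dots> = (pi / t) powr (DIM('a) / 2)"
    using gaussian_integral[OF t] by (auto simp: has_bochner_integral_iff)
  finally show ?thesis .
qed

text \<open>Translations and the reflection preserve Lebesgue measure; both are the case
  \<bar>c\<bar> = 1.\<close>

lemma lborel_distr_affine_unit:
  fixes a :: "'a::euclidean_space"
  assumes "\<bar>c\<bar> = (1::real)"
  shows "distr lborel borel (\<lambda>x. a + c *\<^sub>R x) = lborel"
proof -
  have "c \<noteq> 0" using assms by auto
  then have "lborel = density (distr lborel borel (\<lambda>x. a + c *\<^sub>R x)) (\<lambda>_. \<bar>c\<bar>^DIM('a))"
    by (rule lborel_affine)
  then show ?thesis using assms by (simp add: density_1)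
qed

lemma integrable_affine_unit_iff:
  fixes a :: "'a::euclidean_space" and f :: "'a \<Rightarrow> 'b::{banach, second_countable_topology}"
  assumes "\<bar>c\<bar> = (1::real)" "f \<in> borel_measurable borel"
  shows "integrable lborel (\<lambda>x. f (a + c *\<^sub>R x)) \<longleftrightarrow> integrable lborel f"
  by (subst (2) lborel_distr_affine_unit[OF assms(1), of a, symmetric], subst integrable_distr_eq) (use assms in auto)

lemma integral_affine_unit:
  fixes a :: "'a::euclidean_space" and f :: "'a \<Rightarrow> 'b::{banach, second_countable_topology}"
  assumes "\<bar>c\<bar> = (1::real)" "f \<in> borel_measurable borel"
  shows "(LINT x|lborel. f (a + c *\<^sub>R x)) = (LINT x|lborel. f x)"
  by (subst (2) lborel_distr_affine_unit[OF assms(1), of a, symmetric], subst integral_distr) (use assms in auto)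

lemma integral_odd_eq_0:
  fixes f :: "'a::euclidean_space \<Rightarrow> real"
  assumes [measurable]: "f \<in> borel_measurable borel" and odd: "\<And>x. f (- x) = - f x"
  shows "(LINT x|lborel. f x) = 0"
  using integral_affine_unit[of "-1" f 0] by (simp add: odd)

text \<open>The sine part of the Fourier integral is odd in \<xi> and vanishes.\<close>

lemma heat_kernel_eq:
  fixes x :: "'a::euclidean_space"
  assumes t: "t > 0"
  shows "heat_kernel s x t = of_real (heat_transform s t x / (2 * pi) ^ DIM('a))"
proof -
  let ?e = "\<lambda>\<xi>::'a. exp (- t * symbol s ((norm \<xi>)\<^sup>2))"
  have *: "exp (- of_real (t * (norm \<xi> ^ 2 + norm \<xi> powr (2 * s))) + \<i> * of_real (x \<bullet> \<xi>))
    = of_real (cos (x \<bullet> \<xi>) * ?e \<xi>) + \<i> * of_real (sin (x \<bullet> \<xi>) * ?e \<xi>)" for \<xi>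
  proof -
    have "exp (- of_real (t * (norm \<xi> ^ 2 + norm \<xi> powr (2 * s))) + \<i> * of_real (x \<bullet> \<xi>))
      = of_real (?e \<xi>) * cis (x \<bullet> \<xi>)"
      by (simp add: exp_diff exp_minus divide_inverse symbol_norm cis_conv_exp mult.commute flip: exp_of_real)
    then show ?thesis by (simp add: complex_eq_iff)
  qed
  have c: "integrable lborel (\<lambda>\<xi>. cos (x \<bullet> \<xi>) * ?e \<xi>)"
    by (rule integrable_heat_transform[OF t])
  have s: "integrable lborel (\<lambda>\<xi>. sin (x \<bullet> \<xi>) * ?e \<xi>)"
    by (rule integrable_symbol_bound[OF t, of _ 1]) auto
  have s0: "(LINT \<xi>|lborel. sin (x \<bullet> \<xi>) * ?e \<xi>) = 0"
    by (rule integral_odd_eq_0) auto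
  have "(LINT \<xi>|lborel. exp (- of_real (t * (norm \<xi> ^ 2 + norm \<xi> powr (2 * s))) + \<i> * of_real (x \<bullet> \<xi>)))
    = of_real (heat_transform s t x) + \<i> * of_real (LINT \<xi>|lborel. sin (x \<bullet> \<xi>) * ?e \<xi>)"
    unfolding * heat_transform_def
    by (subst Bochner_Integration.integral_add)
       (intro integrable_mult_right integrable_of_real c s | simp only: integral_mult_right_zero integral_complex_of_real)+
  then show ?thesis
    unfolding heat_kernel_def s0 by simp
qed

lemma gauss_integral_eq:
  fixes x :: "'a::euclidean_space"
  assumes "\<tau> > 0"
  shows "(LINT \<xi>|lborel. cos (x \<bullet> \<xi>) * exp (- \<tau> * (norm \<xi>)\<^sup>2)) = (pi / \<tau>) powr (DIM('a) / 2) * exp (- (norm x)\<^sup>2 / (4 * \<tau>))"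
  using gaussian_fourier[OF assms, of x] by (simp add: has_bochner_integral_iff)

lemma integrable_cos_gauss:
  fixes x :: "'a::euclidean_space"
  assumes "\<tau> > 0"
  shows "integrable lborel (\<lambda>\<xi>. cos (x \<bullet> \<xi>) * exp (- \<tau> * (norm \<xi>)\<^sup>2))"
  using gaussian_fourier[OF assms, of x] by (simp add: has_bochner_integral_iff)

text \<open>With the Fourier transform of a Gaussian on one side, laplace_order_symbol turns
  bounds for Gaussians into bounds for the heat kernel. This lemma and the next are the two
  directions.\<close>

lemma heat_transform_leI:
  fixes x :: "'a::euclidean_space" and g w :: "'c \<Rightarrow> real"
  assumes N: "sigma_finite_measure N" "integrable N (\<lambda>y. w y * exp (- t * g y))" "g \<in> borel_measurable N" "\<And>x. 0 \<le> g x"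
    and s: "0 < s" "s < 1" and t: "t > 0"
    and le: "\<And>\<tau>. \<tau> > 0 \<Longrightarrow> (pi / \<tau>) powr (DIM('a) / 2) * exp (- (norm x)\<^sup>2 / (4 * \<tau>)) \<le> (LINT y|N. w y * exp (- \<tau> * g y))"
  shows "heat_transform s t x \<le> (LINT y|N. w y * exp (- t * symbol s (g y)))"
  unfolding heat_transform_def
proof (rule laplace_order_symbol[OF lborel.sigma_finite_measure_axioms _ _ _ N s])
  show "(LINT \<xi>|lborel. cos (x \<bullet> \<xi>) * exp (- \<tau> * (norm \<xi>)\<^sup>2)) \<le> (LINT y|N. w y * exp (- \<tau> * g y))" if "t \<le> \<tau>" for \<tau>
  proof -
    from that t have "\<tau> > 0" by simp
    then show ?thesis unfolding gauss_integral_eq[OF \<open>\<tau> > 0\<close>] by (rule le)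
  qed
qed (rule integrable_cos_gauss[OF t], use t in auto)

lemma heat_transform_geI:
  fixes x :: "'a::euclidean_space" and g w :: "'c \<Rightarrow> real"
  assumes N: "sigma_finite_measure N" "integrable N (\<lambda>y. w y * exp (- t * g y))" "g \<in> borel_measurable N" "\<And>x. 0 \<le> g x"
    and s: "0 < s" "s < 1" and t: "t > 0"
    and le: "\<And>\<tau>. \<tau> > 0 \<Longrightarrow> (LINT y|N. w y * exp (- \<tau> * g y)) \<le> (pi / \<tau>) powr (DIM('a) / 2) * exp (- (norm x)\<^sup>2 / (4 * \<tau>))"
  shows "(LINT y|N. w y * exp (- t * symbol s (g y))) \<le> heat_transform s t x"
  unfolding heat_transform_def
proof (rule laplace_order_symbol[OF N lborel.sigma_finite_measure_axioms _ _ _ s])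
  show "(LINT y|N. w y * exp (- \<tau> * g y)) \<le> (LINT \<xi>|lborel. cos (x \<bullet> \<xi>) * exp (- \<tau> * (norm \<xi>)\<^sup>2))" if "t \<le> \<tau>" for \<tau>
  proof -
    from that t have "\<tau> > 0" by simp
    then show ?thesis unfolding gauss_integral_eq[OF \<open>\<tau> > 0\<close>] by (rule le)
  qed
qed (rule integrable_cos_gauss[OF t], use t in auto)

text \<open>Gaussians are nonnegative: the comparison is with the zero weight.\<close>

lemma heat_transform_nonneg:
  assumes "0 < s" "s < 1" "t > 0"
  shows "0 \<le> heat_transform s t x"
  using heat_transform_geI[of lborel "\<lambda>_::real. 0" t "\<lambda>_. 0" s x] assms
  by (simp add: lborel.sigma_finite_measure_axioms)

lemma heat_transform_antimono:
  fixes x y :: "'a::euclidean_space"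
  assumes s: "0 < s" "s < 1" and t: "t > 0" and xy: "norm x \<le> norm y"
  shows "heat_transform s t y \<le> heat_transform s t x"
  unfolding heat_transform_def[of s t x]
proof (rule heat_transform_leI[OF lborel.sigma_finite_measure_axioms _ _ _ s t])
  show "(pi / \<tau>) powr (DIM('a) / 2) * exp (- (norm y)\<^sup>2 / (4 * \<tau>)) \<le> (LINT \<xi>|lborel. cos (x \<bullet> \<xi>) * exp (- \<tau> * (norm \<xi>)\<^sup>2))"
    if "\<tau> > 0" for \<tau>
    unfolding gauss_integral_eq[OF that]
    using that xy by (auto intro!: mult_left_mono divide_right_mono power_mono)
qed (rule integrable_cos_gauss[OF t], use t in auto)

section \<open>Pointwise bounds for the heat kernel\<close>

lemma powr_mult_exp_le:
  fixes a b y :: real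
  assumes "a > 0" "b > 0" "y > 0"
  shows "y powr a * exp (- b * y) \<le> (a / b) powr a"
proof -
  have "ln (b * y / a) \<le> b * y / a - 1"
    using assms by (intro ln_le_minus_one) auto
  also have "\<dots> \<le> b * y / a" by simp
  finally have "a * (ln b + ln y - ln a) \<le> b * y"
    using assms by (simp add: ln_mult ln_div field_simps)
  then have "a * ln y - b * y \<le> a * (ln a - ln b)"
    by (simp add: algebra_simps)
  then have "exp (a * ln y - b * y) \<le> exp (a * (ln a - ln b))" by simp
  moreover have "exp (a * (ln a - ln b)) = (a / b) powr a"
    using assms by (simp add: powr_def ln_div)
  moreover have "exp (a * ln y - b * y) = y powr a * exp (- b * y)"
    using assms by (simp add: powr_def flip: exp_add)
  ultimately show ?thesis by simp
qed

lemma has_bochner_integral_powr_head: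
  fixes a q :: real
  assumes "a > 0" "q \<ge> 0"
  shows "has_bochner_integral lborel (\<lambda>r. indicator {0<..q} r * r powr (a - 1)) (q powr a / a)"
  by (rule has_bochner_integral_nn_integral[OF _ _ _ nn_integral_powr_head[OF assms]]) (use assms in auto)

lemma integrable_powr_head_exp:
  fixes a q :: real
  assumes "a > 0" "q \<ge> 0" "\<tau> \<ge> 0"
  shows "integrable lborel (\<lambda>r. indicator {0<..q} r * r powr (a - 1) * exp (- \<tau> * \<bar>r\<bar>))"
  by (rule Bochner_Integration.integrable_bound[of _ "\<lambda>r. indicator {0<..q} r * r powr (a - 1)"])
     (use assms has_bochner_integral_powr_head[OF assms(1,2)] in
       \<open>auto simp: has_bochner_integral_iff indicator_def mult_left_le\<close>)

text \<open>Both sides are compared with the minimum of 1 / R and 1 / \<tau>, raised to the power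
  a: up to that minimum the exponential on the right is at least exp (- 1), and on the left the
  exponential beats the power of \<tau> when \<tau> < R.\<close>

lemma gauss_le_laplace:
  fixes a R \<tau> :: real
  assumes a: "a \<ge> 1 / 2" and R: "R > 0" and \<tau>: "\<tau> > 0"
  shows "(pi / \<tau>) powr a * exp (- R / (4 * \<tau>))
    \<le> (pi powr a * (4 * a) powr a * exp 1 * a) * (LINT r|lborel. indicator {0<..1 / R} r * r powr (a - 1) * exp (- \<tau> * \<bar>r\<bar>))"
proof -
  define m where "m = min (1 / R) (1 / \<tau>)"
  have m: "m > 0" "m \<le> 1 / R" "m \<le> 1 / \<tau>" using R \<tau> by (auto simp: m_def)
  let ?I = "LINT r|lborel. indicator {0<..1 / R} r * r powr (a - 1) * exp (- \<tau> * \<bar>r\<bar>)"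
  have "exp (- 1) * (m powr a / a) = (LINT r|lborel. exp (- 1) * (indicator {0<..m} r * r powr (a - 1)))"
    using has_bochner_integral_powr_head[of a m] a m by (simp add: has_bochner_integral_iff)
  also have "\<dots> \<le> ?I"
  proof (rule integral_mono)
    show "integrable lborel (\<lambda>r. exp (- 1) * (indicator {0<..m} r * r powr (a - 1)))"
      using has_bochner_integral_powr_head[of a m] a m by (simp add: has_bochner_integral_iff)
    show "integrable lborel (\<lambda>r. indicator {0<..1 / R} r * r powr (a - 1) * exp (- \<tau> * \<bar>r\<bar>))"
      using a R \<tau> by (intro integrable_powr_head_exp) auto
    show "exp (- 1) * (indicator {0<..m} r * r powr (a - 1)) \<le> indicator {0<..1 / R} r * r powr (a - 1) * exp (- \<tau> * \<bar>r\<bar>)" for r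
    proof (cases "0 < r \<and> r \<le> m")
      case True
      then have "\<tau> * r \<le> \<tau> * (1 / \<tau>)" using m \<tau> by (intro mult_left_mono) auto
      then have "exp (- 1) \<le> exp (- \<tau> * \<bar>r\<bar>)" using True \<tau> by simp
      then have "r powr (a - 1) * exp (- 1) \<le> r powr (a - 1) * exp (- \<tau> * \<bar>r\<bar>)"
        by (rule mult_left_mono) simp
      then show ?thesis using True m by (simp add: mult.commute)
    qed (auto simp: indicator_def)
  qed
  finally have I: "exp (- 1) * (m powr a / a) \<le> ?I" .
  have le: "exp (- R / (4 * \<tau>)) / \<tau> powr a \<le> (4 * a) powr a * m powr a"
  proof (cases "R \<le> \<tau>")
    case True
    then have m_eq: "m = 1 / \<tau>" using R \<tau> by (simp add: m_def frac_le)
    have "1 \<le> (4 * a) powr a" using a by (intro ge_one_powr_ge_zero) auto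
    moreover have "exp (- R / (4 * \<tau>)) \<le> 1" using R \<tau> by simp
    ultimately have "exp (- R / (4 * \<tau>)) \<le> (4 * a) powr a" by linarith
    then show ?thesis using \<tau> by (simp add: m_eq powr_divide divide_right_mono)
  next
    case False
    then have m_eq: "m = 1 / R" using R \<tau> by (simp add: m_def frac_le)
    have "(R / \<tau>) powr a * exp (- (1 / 4) * (R / \<tau>)) \<le> (a / (1 / 4)) powr a"
      using a R \<tau> by (intro powr_mult_exp_le) auto
    then have "R powr a / \<tau> powr a * exp (- R / (4 * \<tau>)) \<le> (4 * a) powr a"
      using R \<tau> by (simp add: powr_divide mult.commute)
    then show ?thesis using R \<tau> by (simp add: m_eq powr_divide field_simps)
  qed
  have "(pi / \<tau>) powr a * exp (- R / (4 * \<tau>)) = pi powr a * (exp (- R / (4 * \<tau>)) / \<tau> powr a)"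
    using \<tau> by (simp add: powr_divide)
  also have "\<dots> \<le> pi powr a * ((4 * a) powr a * m powr a)"
    by (rule mult_left_mono[OF le]) simp
  also have "\<dots> = (pi powr a * (4 * a) powr a * exp 1 * a) * (exp (- 1) * (m powr a / a))"
    using a by (simp add: exp_minus field_simps)
  also have "\<dots> \<le> (pi powr a * (4 * a) powr a * exp 1 * a) * ?I"
    by (rule mult_left_mono[OF I]) (use a in auto)
  finally show ?thesis .
qed

text \<open>For small y the left-hand side is nonpositive, since the coefficient 2 exceeds 1. For
  larger y the factor exp (- 1 / (4 * y)) is bounded below, and exp (- y) is smaller than any
  power. The threshold is y = ln 2 / (B - 1).\<close>

lemma exp_difference_le_gauss:
  fixes a B y :: real
  assumes a: "a > 0" and B: "B > 1" and y: "y > 0"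
  shows "exp (- y) - 2 * exp (- B * y) \<le> a powr a * exp ((B - 1) / (4 * ln 2)) * (y powr (- a) * exp (- 1 / (4 * y)))"
proof (cases "(B - 1) * y \<le> ln 2")
  case True
  then have "exp ((B - 1) * y) \<le> exp (ln 2)" by (simp del: exp_ln)
  then have "exp ((B - 1) * y) * exp (- B * y) \<le> 2 * exp (- B * y)" by simp
  then have "exp (- y) - 2 * exp (- B * y) \<le> 0" by (simp add: algebra_simps flip: exp_add)
  also have "0 \<le> a powr a * exp ((B - 1) / (4 * ln 2)) * (y powr (- a) * exp (- 1 / (4 * y)))" by simp
  finally show ?thesis .
next
  case False
  then have "1 / y \<le> (B - 1) / ln 2" using y by (simp add: field_simps)
  then have "1 \<le> exp ((B - 1) / (4 * ln 2) + - 1 / (4 * y))" by (simp add: field_simps)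
  then have 1: "1 \<le> exp ((B - 1) / (4 * ln 2)) * exp (- 1 / (4 * y))" by (simp only: exp_add)
  have "y powr a * exp (- 1 * y) \<le> (a / 1) powr a" using a y by (intro powr_mult_exp_le) auto
  then have "exp (- y) \<le> a powr a * y powr (- a)" using y by (simp add: powr_minus field_simps)
  also have "\<dots> \<le> a powr a * y powr (- a) * (exp ((B - 1) / (4 * ln 2)) * exp (- 1 / (4 * y)))"
    using mult_left_mono[OF 1, of "a powr a * y powr (- a)"] by simp
  finally have "exp (- y) \<le> a powr a * exp ((B - 1) / (4 * ln 2)) * (y powr (- a) * exp (- 1 / (4 * y)))"
    by (simp only: mult_ac)
  moreover have "0 < exp (- B * y)" by simp
  ultimately show ?thesis by linarith
qed

lemma heat_transform_upper:
  fixes x :: "'a::euclidean_space"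
  assumes s: "0 < s" "s < 1" and t: "t > 0" and x: "x \<noteq> 0"
  defines "a \<equiv> DIM('a) / 2"
  shows "heat_transform s t x \<le> (pi powr a * (4 * a) powr a * exp 1 * a) *
     (LINT r|lborel. indicator {0<..1 / (norm x)\<^sup>2} r * r powr (a - 1) * exp (- t * symbol s \<bar>r\<bar>))"
proof -
  let ?C = "pi powr a * (4 * a) powr a * exp 1 * a"
  let ?w = "\<lambda>r. ?C * (indicator {0<..1 / (norm x)\<^sup>2} r * r powr (a - 1))"
  have "1 \<le> DIM('a)" using DIM_positive[where 'a='a] by linarith
  then have a: "a \<ge> 1 / 2" by (simp add: a_def)
  have "heat_transform s t x \<le> (LINT r|lborel. ?w r * exp (- t * symbol s \<bar>r\<bar>))"
  proof (rule heat_transform_leI[OF lborel.sigma_finite_measure_axioms _ _ _ s t])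
    show "integrable lborel (\<lambda>r. ?w r * exp (- t * \<bar>r\<bar>))"
      using integrable_mult_right[OF integrable_powr_head_exp[of a "1 / (norm x)\<^sup>2" t], of ?C] a t by (simp add: mult.assoc)
    show "(pi / \<tau>) powr (DIM('a) / 2) * exp (- (norm x)\<^sup>2 / (4 * \<tau>)) \<le> (LINT r|lborel. ?w r * exp (- \<tau> * \<bar>r\<bar>))"
      if "\<tau> > 0" for \<tau>
      using gauss_le_laplace[OF a _ that, of "(norm x)\<^sup>2"] x by (simp add: a_def mult.assoc)
  qed auto
  then show ?thesis by (simp add: mult.assoc)
qed

lemma heat_transform_lower:
  fixes x :: "'a::euclidean_space"
  assumes s: "0 < s" "s < 1" and t: "t > 0" and x: "x \<noteq> 0" and B: "B > 1"
  defines "a \<equiv> DIM('a) / 2" and "R \<equiv> (norm x)\<^sup>2"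
  shows "pi powr a / (a powr a * exp ((B - 1) / (4 * ln 2))) * R powr (- a) * (exp (- t * symbol s (1 / R)) - 2 * exp (- t * symbol s (B / R)))
    \<le> heat_transform s t x"
proof -
  let ?C = "a powr a * exp ((B - 1) / (4 * ln 2))"
  let ?w = "\<lambda>b. pi powr a / ?C * R powr (- a) * (if b then 1 else - 2)"
  let ?g = "\<lambda>b. if b then 1 / R else B / R"
  have a: "a > 0" using DIM_positive[where 'a='a] by (simp add: a_def)
  have R: "R > 0" using x by (simp add: R_def)
  have sum: "(LINT b|count_space UNIV. ?w b * exp (- \<tau> * h (?g b))) = pi powr a / ?C * R powr (- a) * (exp (- \<tau> * h (1 / R)) - 2 * exp (- \<tau> * h (B / R)))"
    for \<tau> and h :: "real \<Rightarrow> real"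
    by (subst lebesgue_integral_count_space_finite) (auto simp: UNIV_bool algebra_simps diff_divide_distrib)
  \<comment> \<open>The difference of two exponentials is the Laplace transform of a signed measure with two atoms,
         indexed here by the two truth values.\<close>
  have "(LINT b|count_space UNIV. ?w b * exp (- t * symbol s (?g b))) \<le> heat_transform s t x"
  proof (rule heat_transform_geI[OF sigma_finite_measure_count_space_finite _ _ _ s t])
    show "(LINT b|count_space UNIV. ?w b * exp (- \<tau> * ?g b)) \<le> (pi / \<tau>) powr (DIM('a) / 2) * exp (- (norm x)\<^sup>2 / (4 * \<tau>))"
      if \<tau>: "\<tau> > 0" for \<tau>
    proof -
      let ?y = "\<tau> / R"
      have "pi powr a / ?C * R powr (- a) * (exp (- ?y) - 2 * exp (- B * ?y))
        \<le> pi powr a / ?C * R powr (- a) * (?C * (?y powr (- a) * exp (- 1 / (4 * ?y))))"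
        using exp_difference_le_gauss[OF a B, of ?y] R \<tau> by (intro mult_left_mono) auto
      also have "\<dots> = (pi / \<tau>) powr a * exp (- R / (4 * \<tau>))"
        using a R \<tau> by (simp add: powr_divide powr_minus field_simps)
      finally show ?thesis
        using sum[of \<tau> "\<lambda>l. l"] by (simp add: a_def R_def mult.commute)
    qed
  qed (use R B in \<open>auto intro!: integrable_count_space\<close>)
  then show ?thesis unfolding sum .
qed

section \<open>The time integral of the heat kernel\<close>

lemma nn_integral_exp_neg:
  assumes "l > (0::real)"
  shows "(\<integral>\<^sup>+t. ennreal (indicator {0<..} t * exp (- t * l)) \<partial>lborel) = ennreal (1 / l)"
proof -
  have "(\<integral>\<^sup>+t. ennreal (indicator {0<..} t * exp (- t * l)) \<partial>lborel)
    = (\<integral>\<^sup>+t. ennreal (indicator {0<..} t * (t powr (1 - 1) * exp (- l * t))) \<partial>lborel)"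
    by (intro nn_integral_cong) (auto simp: indicator_def mult.commute)
  also have "\<dots> = ennreal (1 / l)"
    using nn_integral_Gamma_scaled[of 1 l] assms by simp
  finally show ?thesis .
qed

lemma has_bochner_integral_exp_neg:
  assumes "l > (0::real)"
  shows "has_bochner_integral lborel (\<lambda>t. indicator {0<..} t * exp (- t * l)) (1 / l)"
  by (rule has_bochner_integral_nn_integral[OF _ _ _ nn_integral_exp_neg[OF assms]]) (use assms in auto)

definition green :: "real \<Rightarrow> 'a::euclidean_space \<Rightarrow> real" where
  "green s x = (LINT t|lborel. indicator {0<..} t * heat_transform s t x)"

text \<open>Integrating heat_transform_upper in time replaces the exponential by 1 / symbol s r.
  The exponents p = 1 and p = s both satisfy the hypotheses in dimension at least 3; they give the
  bounds near the origin and at infinity.\<close>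

lemma nn_integral_heat_transform_le:
  fixes x :: "'a::euclidean_space" and p :: real
  assumes s: "0 < s" "s < 1" and x: "x \<noteq> 0"
    and p: "p < DIM('a) / 2" "\<And>l. l > 0 \<Longrightarrow> l powr p \<le> symbol s l"
  defines "a \<equiv> DIM('a) / 2"
  shows "(\<integral>\<^sup>+t. ennreal (indicator {0<..} t * heat_transform s t x) \<partial>lborel)
    \<le> ennreal ((pi powr a * (4 * a) powr a * exp 1 * a) / (a - p) * (norm x) powr (2 * p - real DIM('a)))"
proof -
  let ?C = "pi powr a * (4 * a) powr a * exp 1 * a"
  let ?q = "1 / (norm x)\<^sup>2"
  have a: "a > 0" using DIM_positive[where 'a='a] by (simp add: a_def)
  have C: "?C > 0" using a by simp
  let ?k = "\<lambda>t r. indicator {0<..} t * (indicator {0<..?q} r * r powr (a - 1) * exp (- t * symbol s \<bar>r\<bar>)) :: real"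
  have "(\<integral>\<^sup>+t. ennreal (indicator {0<..} t * heat_transform s t x) \<partial>lborel)
    \<le> (\<integral>\<^sup>+t. ennreal ?C * (\<integral>\<^sup>+r. ennreal (?k t r) \<partial>lborel) \<partial>lborel)"
  proof (rule nn_integral_mono)
    fix t :: real
    show "ennreal (indicator {0<..} t * heat_transform s t x) \<le> ennreal ?C * (\<integral>\<^sup>+r. ennreal (?k t r) \<partial>lborel)"
    proof (cases "t > 0")
      case True
      have int: "integrable lborel (\<lambda>r. indicator {0<..?q} r * r powr (a - 1) * exp (- t * symbol s \<bar>r\<bar>))"
        by (rule Bochner_Integration.integrable_bound[OF integrable_powr_head_exp[of a ?q t]])
           (use a True in \<open>auto simp: indicator_def symbol_def intro!: mult_left_mono\<close>)
      have "ennreal (heat_transform s t x) \<le> ennreal (?C * (LINT r|lborel. indicator {0<..?q} r * r powr (a - 1) * exp (- t * symbol s \<bar>r\<bar>)))"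
        using heat_transform_upper[OF s True x] by (intro ennreal_leI) (simp add: a_def)
      also have "\<dots> = ennreal ?C * ennreal (LINT r|lborel. indicator {0<..?q} r * r powr (a - 1) * exp (- t * symbol s \<bar>r\<bar>))"
        using C by (intro ennreal_mult') simp
      also have "ennreal (LINT r|lborel. indicator {0<..?q} r * r powr (a - 1) * exp (- t * symbol s \<bar>r\<bar>))
        = (\<integral>\<^sup>+r. ennreal (?k t r) \<partial>lborel)"
        using True by (subst nn_integral_eq_integral[symmetric]) (use int in auto)
      finally show ?thesis using True by simp
    qed simp
  qed
  also have "\<dots> = ennreal ?C * (\<integral>\<^sup>+t. (\<integral>\<^sup>+r. ennreal (?k t r) \<partial>lborel) \<partial>lborel)"
    by (rule nn_integral_cmult) measurable
  also have "(\<integral>\<^sup>+t. (\<integral>\<^sup>+r. ennreal (?k t r) \<partial>lborel) \<partial>lborel) = (\<integral>\<^sup>+r. (\<integral>\<^sup>+t. ennreal (?k t r) \<partial>lborel) \<partial>lborel)"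
    by (rule lborel_pair.Fubini') measurable
  also have "\<dots> \<le> (\<integral>\<^sup>+r. ennreal (indicator {0<..?q} r * r powr ((a - p) - 1)) \<partial>lborel)"
  proof (rule nn_integral_mono)
    fix r :: real
    show "(\<integral>\<^sup>+t. ennreal (?k t r) \<partial>lborel) \<le> ennreal (indicator {0<..?q} r * r powr ((a - p) - 1))"
    proof (cases "0 < r \<and> r \<le> ?q")
      case True
      have "(\<integral>\<^sup>+t. ennreal (?k t r) \<partial>lborel) = (\<integral>\<^sup>+t. ennreal (r powr (a - 1)) * ennreal (indicator {0<..} t * exp (- t * symbol s r)) \<partial>lborel)"
        using True by (intro nn_integral_cong) (auto simp: indicator_def ennreal_mult'')
      also have "\<dots> = ennreal (r powr (a - 1)) * ennreal (1 / symbol s r)"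
        using True by (subst nn_integral_cmult, simp, subst nn_integral_exp_neg) (auto simp: symbol_pos)
      also have "\<dots> = ennreal (r powr (a - 1) * (1 / symbol s r))"
        using True symbol_pos[of r s] by (intro ennreal_mult''[symmetric]) auto
      also have "\<dots> \<le> ennreal (r powr (a - 1) * (1 / r powr p))"
        using True p(2)[of r] by (intro ennreal_leI mult_left_mono divide_left_mono) (auto simp: symbol_pos)
      also have "r powr (a - 1) * (1 / r powr p) = r powr ((a - p) - 1)"
        using True by (simp add: powr_diff)
      finally show ?thesis using True by simp
    qed (auto simp: indicator_def)
  qed
  also have "\<dots> = ennreal (?q powr (a - p) / (a - p))"
    by (rule nn_integral_powr_head) (use p in \<open>auto simp: a_def\<close>)
  also have "ennreal ?C * ennreal (?q powr (a - p) / (a - p)) = ennreal (?C * (?q powr (a - p) / (a - p)))"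
    using C by (intro ennreal_mult'[symmetric]) simp
  also have "?C * (?q powr (a - p) / (a - p)) = ?C / (a - p) * norm x powr (2 * p - real DIM('a))"
  proof -
    have "?q = norm x powr (- 2)" using x by (simp add: powr_minus divide_inverse)
    then have "?q powr (a - p) = norm x powr (2 * p - real DIM('a))"
      by (simp only: powr_powr) (simp add: a_def algebra_simps)
    then show ?thesis by simp
  qed
  finally show ?thesis by (simp add: mult_left_mono)
qed

lemma green_upper:
  fixes x :: "'a::euclidean_space" and p :: real
  assumes s: "0 < s" "s < 1" and x: "x \<noteq> 0"
    and p: "p < DIM('a) / 2" "\<And>l. l > 0 \<Longrightarrow> l powr p \<le> symbol s l"
  defines "a \<equiv> DIM('a) / 2"
  shows "integrable lborel (\<lambda>t. indicator {0<..} t * heat_transform s t x)"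
    and "green s x \<le> (pi powr a * (4 * a) powr a * exp 1 * a) / (a - p) * (norm x) powr (2 * p - real DIM('a))"
proof -
  note le = nn_integral_heat_transform_le[OF s x p, folded a_def]
  have nn: "0 \<le> indicator {0<..} t * heat_transform s t x" for t
    using heat_transform_nonneg[OF s] by (auto simp: indicator_def)
  show int: "integrable lborel (\<lambda>t. indicator {0<..} t * heat_transform s t x)"
    by (rule integrableI_nonneg) (use nn le in \<open>auto intro: le_less_trans\<close>)
  have "ennreal (green s x) \<le> ennreal ((pi powr a * (4 * a) powr a * exp 1 * a) / (a - p) * (norm x) powr (2 * p - real DIM('a)))"
    using le nn_integral_eq_integral[OF int] nn by (simp add: green_def)
  moreover have "0 \<le> (pi powr a * (4 * a) powr a * exp 1 * a) / (a - p) * (norm x) powr (2 * p - real DIM('a))"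
    using p by (auto simp: a_def)
  ultimately show "green s x \<le> (pi powr a * (4 * a) powr a * exp 1 * a) / (a - p) * (norm x) powr (2 * p - real DIM('a))"
    by (simp only: ennreal_le_iff)
qed

text \<open>B is chosen such that symbol s (B * l) \<ge> 4 * symbol s l, so that in the integral
  of heat_transform_lower the subtracted term takes away at most half of the main term.\<close>

lemma green_lower:
  fixes x :: "'a::euclidean_space"
  assumes s: "0 < s" "s < 1" and x: "x \<noteq> 0"
    and int: "integrable lborel (\<lambda>t. indicator {0<..} t * heat_transform s t x)"
  defines "a \<equiv> DIM('a) / 2" and "B \<equiv> 4 powr (1 / s)" and "R \<equiv> (norm x)\<^sup>2"
  shows "pi powr a / (a powr a * exp ((B - 1) / (4 * ln 2))) / 2 * (R powr (- a) / symbol s (1 / R)) \<le> green s x"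
proof -
  let ?K = "pi powr a / (a powr a * exp ((B - 1) / (4 * ln 2)))"
  have "4 powr 1 \<le> B" unfolding B_def using s by (intro powr_mono) auto
  then have B: "B > 1" "4 \<le> B" by auto
  have Bs: "B powr s = 4" using s by (simp add: B_def powr_powr)
  have R: "R > 0" using x by (simp add: R_def)
  have pos: "symbol s (1 / R) > 0" "symbol s (B / R) > 0" using R B by (auto intro!: symbol_pos)
  have "4 * symbol s (1 / R) \<le> symbol s (B / R)"
    using R B Bs by (simp add: symbol_def powr_divide field_simps)
  then have "2 / symbol s (B / R) \<le> 2 / (4 * symbol s (1 / R))"
    using pos by (intro divide_left_mono) auto
  then have half: "1 / symbol s (1 / R) / 2 \<le> 1 / symbol s (1 / R) - 2 * (1 / symbol s (B / R))"
    by simp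
  let ?f = "\<lambda>t. ?K * R powr (- a) * (indicator {0<..} t * exp (- t * symbol s (1 / R)) - 2 * (indicator {0<..} t * exp (- t * symbol s (B / R))))"
  have f: "has_bochner_integral lborel ?f (?K * R powr (- a) * (1 / symbol s (1 / R) - 2 * (1 / symbol s (B / R))))"
    by (intro has_bochner_integral_mult_right has_bochner_integral_diff has_bochner_integral_exp_neg pos)
  have "?K / 2 * (R powr (- a) / symbol s (1 / R)) = ?K * R powr (- a) * (1 / symbol s (1 / R) / 2)"
    by simp
  also have "\<dots> \<le> ?K * R powr (- a) * (1 / symbol s (1 / R) - 2 * (1 / symbol s (B / R)))"
    by (rule mult_left_mono[OF half]) simp
  also have "\<dots> = integral\<^sup>L lborel ?f" by (rule has_bochner_integral_integral_eq[OF f, symmetric])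
  also have "\<dots> \<le> green s x"
    unfolding green_def
  proof (rule integral_mono[OF _ int])
    show "integrable lborel ?f" using f by (rule integrable.intros)
    show "?f t \<le> indicator {0<..} t * heat_transform s t x" for t
      using heat_transform_lower[OF s _ x B(1), of t, folded a_def R_def] by (cases "t > 0") auto
  qed
  finally show ?thesis .
qed

lemma Gamma_kernel_eq:
  fixes x :: "'a::euclidean_space"
  shows "Gamma_kernel s x = of_real (green s x / (2 * pi) ^ DIM('a))"
proof -
  have "Gamma_kernel s x = (LINT t|lborel. of_real (indicator {0<..} t * heat_transform s t x / (2 * pi) ^ DIM('a)))"
    unfolding Gamma_kernel_def set_lebesgue_integral_def
    by (intro Bochner_Integration.integral_cong) (auto simp: indicator_def heat_kernel_eq)
  also have "\<dots> = of_real (LINT t|lborel. indicator {0<..} t * heat_transform s t x / (2 * pi) ^ DIM('a))"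
    by (rule integral_complex_of_real)
  also have "(LINT t|lborel. indicator {0<..} t * heat_transform s t x / (2 * pi) ^ DIM('a)) = green s x / (2 * pi) ^ DIM('a)"
    unfolding green_def by (rule integral_divide_zero)
  finally show ?thesis .
qed

lemma green_nonneg:
  assumes s: "0 < s" "s < 1"
  shows "0 \<le> green s x"
  unfolding green_def
  by (intro integral_nonneg_AE always_eventually allI) (use heat_transform_nonneg[OF s] in \<open>auto simp: indicator_def\<close>)

lemma green_radial:
  fixes x y :: "'a::euclidean_space"
  assumes s: "0 < s" "s < 1" and xy: "norm x = norm y"
  shows "green s x = green s y"
  unfolding green_def
  by (intro Bochner_Integration.integral_cong) (use heat_transform_antimono[OF s, of _ x y] heat_transform_antimono[OF s, of _ y x] xy in \<open>auto simp: indicator_def intro: antisym\<close>)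

section \<open>Cosine transforms and the maximum principle\<close>

text \<open>The heat kernel is real and even, so the cosine transform carries all the information
  needed from the Fourier transform of a real function.\<close>

definition cos_transform :: "('a::euclidean_space \<Rightarrow> real) \<Rightarrow> 'a \<Rightarrow> real" where
  "cos_transform u \<xi> = (LINT x|lborel. cos (\<xi> \<bullet> x) * u x)"

lemma borel_measurable_cos_transform [measurable]:
  fixes u :: "'a::euclidean_space \<Rightarrow> real"
  assumes [measurable]: "u \<in> borel_measurable borel"
  shows "cos_transform u \<in> borel_measurable borel"
  unfolding cos_transform_def[abs_def] by measurable

lemma integrable_cos_mult:
  fixes u :: "'a::euclidean_space \<Rightarrow> real"
  assumes u: "integrable lborel u"
  shows "integrable lborel (\<lambda>x. cos (\<xi> \<bullet> x) * u x)"
proof (rule Bochner_Integration.integrable_bound[OF u])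
  have [measurable]: "u \<in> borel_measurable borel" using u by auto
  show "(\<lambda>x. cos (\<xi> \<bullet> x) * u x) \<in> borel_measurable lborel" by measurable
qed (auto simp: abs_mult mult_left_le_one_le)

lemma abs_cos_transform_le:
  fixes u :: "'a::euclidean_space \<Rightarrow> real"
  assumes u: "integrable lborel u"
  shows "\<bar>cos_transform u \<xi>\<bar> \<le> (LINT x|lborel. \<bar>u x\<bar>)"
proof -
  have "\<bar>cos_transform u \<xi>\<bar> \<le> (LINT x|lborel. \<bar>cos (\<xi> \<bullet> x) * u x\<bar>)"
    unfolding cos_transform_def by (rule integral_abs_bound)
  also have "\<dots> \<le> (LINT x|lborel. \<bar>u x\<bar>)"
    by (rule integral_mono[OF integrable_abs[OF integrable_cos_mult[OF u]] integrable_abs[OF u]])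
       (auto simp: abs_mult mult_left_le_one_le)
  finally show ?thesis .
qed

lemma integrable_product_bounded:
  fixes u :: "'b \<Rightarrow> real" and w :: "'c \<Rightarrow> real"
  assumes M: "sigma_finite_measure M" and N: "sigma_finite_measure N"
    and u: "integrable M u" and w: "integrable N w"
    and k: "case_prod k \<in> borel_measurable (M \<Otimes>\<^sub>M N)" "\<And>x y. \<bar>k x y\<bar> \<le> 1"
  shows "integrable (M \<Otimes>\<^sub>M N) (\<lambda>(x, y). k x y * (u x * w y))"
proof -
  interpret M: sigma_finite_measure M by fact
  interpret N: sigma_finite_measure N by fact
  interpret pair_sigma_finite M N ..
  have [measurable]: "u \<in> borel_measurable M" "w \<in> borel_measurable N" using u w by auto
  have "integrable (M \<Otimes>\<^sub>M N) (\<lambda>(x, y). u x * w y)"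
  proof (rule Fubini_integrable)
    show "integrable M (\<lambda>x. LINT y|N. norm (case (x, y) of (x, y) \<Rightarrow> u x * w y))"
      using u by (simp add: abs_mult)
    show "AE x in M. integrable N (\<lambda>y. case (x, y) of (x, y) \<Rightarrow> u x * w y)"
      using w by simp
  qed measurable
  then show ?thesis
  proof (rule Bochner_Integration.integrable_bound)
    show "(\<lambda>(x, y). k x y * (u x * w y)) \<in> borel_measurable (M \<Otimes>\<^sub>M N)"
      using k(1) by measurable
    show "AE z in M \<Otimes>\<^sub>M N. norm (case z of (x, y) \<Rightarrow> k x y * (u x * w y)) \<le> norm (case z of (x, y) \<Rightarrow> u x * w y)"
      using k(2) by (auto simp: abs_mult mult_left_le_one_le)
  qed
qed

lemma cos_transform_swap:
  fixes u w :: "'a::euclidean_space \<Rightarrow> real"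
  assumes u: "integrable lborel u" and w: "integrable lborel w"
  shows "(LINT x|lborel. cos_transform w x * u x) = (LINT \<xi>|lborel. w \<xi> * cos_transform u \<xi>)"
proof -
  have "integrable (lborel \<Otimes>\<^sub>M lborel) (\<lambda>(x::'a, \<xi>). cos (x \<bullet> \<xi>) * (u x * w \<xi>))"
    by (rule integrable_product_bounded[OF lborel.sigma_finite_measure_axioms lborel.sigma_finite_measure_axioms u w]) auto
  from lborel_pair.Fubini_integral[OF this]
  have "(LINT \<xi>|lborel. LINT x|lborel. cos (x \<bullet> \<xi>) * (u x * w \<xi>)) = (LINT x|lborel. LINT \<xi>|lborel. cos (x \<bullet> \<xi>) * (u x * w \<xi>))"
    by simp
  moreover have "(LINT x|lborel. cos (x \<bullet> \<xi>) * (u x * w \<xi>)) = w \<xi> * cos_transform u \<xi>" for \<xi>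
    unfolding cos_transform_def
    by (subst integral_mult_right_zero[symmetric]) (intro Bochner_Integration.integral_cong, auto simp: inner_commute)
  moreover have "(LINT \<xi>|lborel. cos (x \<bullet> \<xi>) * (u x * w \<xi>)) = cos_transform w x * u x" for x
    unfolding cos_transform_def
    by (subst integral_mult_left_zero[symmetric]) (intro Bochner_Integration.integral_cong, auto)
  ultimately show ?thesis by simp
qed

lemma integrable_exp_symbol:
  assumes "t > 0"
  shows "integrable lborel (\<lambda>\<xi>::'a::euclidean_space. exp (- t * symbol s ((norm \<xi>)\<^sup>2)))"
  using integrable_symbol_bound[OF assms, of "\<lambda>_. 1" 1] by simp

lemma heat_transform_eq_cos_transform:
  "heat_transform s t = cos_transform (\<lambda>\<xi>. exp (- t * symbol s ((norm \<xi>)\<^sup>2)))"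
  by (simp add: fun_eq_iff heat_transform_def cos_transform_def)

lemma integral_heat_transform_mult:
  fixes u :: "'a::euclidean_space \<Rightarrow> real"
  assumes u: "integrable lborel u" and t: "t > 0"
  shows "(LINT x|lborel. heat_transform s t x * u x) = (LINT \<xi>|lborel. cos_transform u \<xi> * exp (- t * symbol s ((norm \<xi>)\<^sup>2)))"
  unfolding heat_transform_eq_cos_transform cos_transform_swap[OF u integrable_exp_symbol[OF t]]
  by (simp add: mult.commute)

lemma integrable_heat_transform_mult:
  fixes u :: "'a::euclidean_space \<Rightarrow> real"
  assumes u: "integrable lborel u" and t: "t > 0"
  shows "integrable lborel (\<lambda>x. heat_transform s t x * u x)"
proof (rule Bochner_Integration.integrable_bound)
  have [measurable]: "u \<in> borel_measurable borel" using u by auto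
  show "integrable lborel (\<lambda>x. (pi / t) powr (DIM('a) / 2) * u x)" using u by auto
  show "(\<lambda>x. heat_transform s t x * u x) \<in> borel_measurable lborel" by measurable
  show "AE x in lborel. norm (heat_transform s t x * u x) \<le> norm ((pi / t) powr (DIM('a) / 2) * u x)"
    by (auto simp: abs_mult intro!: mult_right_mono abs_heat_transform_le[OF t])
qed

lemma cos_transform_gauss:
  fixes x :: "'a::euclidean_space"
  assumes \<tau>: "\<tau> > 0"
  shows "cos_transform (\<lambda>\<xi>. exp (- \<tau> * (norm \<xi>)\<^sup>2)) x = (pi / \<tau>) powr (DIM('a) / 2) * exp (- (1 / (4 * \<tau>)) * (norm x)\<^sup>2)"
  unfolding cos_transform_def gauss_integral_eq[OF \<tau>] by simp

lemma integral_cos_transform_gauss: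
  assumes \<tau>: "\<tau> > 0"
  shows "has_bochner_integral lborel (cos_transform (\<lambda>\<xi>::'a::euclidean_space. exp (- \<tau> * (norm \<xi>)\<^sup>2))) ((2 * pi) ^ DIM('a))"
proof -
  have "has_bochner_integral lborel (\<lambda>x::'a. (pi / \<tau>) powr (DIM('a) / 2) * exp (- (1 / (4 * \<tau>)) * (norm x)\<^sup>2))
     ((pi / \<tau>) powr (DIM('a) / 2) * (pi / (1 / (4 * \<tau>))) powr (DIM('a) / 2))"
    using \<tau> by (intro has_bochner_integral_mult_right gaussian_integral) auto
  moreover have "(pi / \<tau>) powr (DIM('a) / 2) * (pi / (1 / (4 * \<tau>))) powr (DIM('a) / 2) = (2 * pi) ^ DIM('a)"
  proof -
    have "(pi / \<tau>) powr (DIM('a) / 2) * (pi / (1 / (4 * \<tau>))) powr (DIM('a) / 2) = ((pi / \<tau>) * (pi / (1 / (4 * \<tau>)))) powr (DIM('a) / 2)"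
      using \<tau> by (subst powr_mult) auto
    also have "(pi / \<tau>) * (pi / (1 / (4 * \<tau>))) = (2 * pi) powr 2"
      using \<tau> by (simp add: power2_eq_square)
    also have "((2 * pi) powr 2) powr (DIM('a) / 2) = (2 * pi) ^ DIM('a)"
      by (simp only: powr_powr) (simp add: powr_realpow)
    finally show ?thesis .
  qed
  ultimately show ?thesis by (simp only: cos_transform_gauss[OF \<tau>] cong: has_bochner_integral_cong)
qed

text \<open>The comparison is between the Gaussian averages of u, which are at most C, and the
  constant C, which is the Laplace transform of a point mass at 0.\<close>

lemma heat_transform_maximum_principle:
  fixes u :: "'a::euclidean_space \<Rightarrow> real"
  assumes s: "0 < s" "s < 1" and t: "t > 0" and u: "integrable lborel u" and le: "\<And>x. u x \<le> C"
  shows "(LINT x|lborel. heat_transform s t x * u x) \<le> (2 * pi) ^ DIM('a) * C"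
proof -
  have [measurable]: "u \<in> borel_measurable borel" using u by auto
  have "(LINT \<xi>|lborel. cos_transform u \<xi> * exp (- t * symbol s ((norm \<xi>)\<^sup>2)))
    \<le> (LINT b|count_space (UNIV::unit set). ((2 * pi) ^ DIM('a) * C) * exp (- t * symbol s 0))"
  proof (rule laplace_order_symbol[OF lborel.sigma_finite_measure_axioms _ _ _ sigma_finite_measure_count_space_finite _ _ _ s])
    show "integrable lborel (\<lambda>\<xi>. cos_transform u \<xi> * exp (- t * (norm \<xi>)\<^sup>2))"
      by (rule integrable_gauss_bound[OF t _ abs_cos_transform_le[OF u]]) measurable
    fix \<tau> assume "t \<le> \<tau>"
    then have \<tau>: "\<tau> > 0" using t by simp
    let ?K = "cos_transform (\<lambda>\<xi>::'a. exp (- \<tau> * (norm \<xi>)\<^sup>2))"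
    have g: "integrable lborel (\<lambda>\<xi>::'a. exp (- \<tau> * (norm \<xi>)\<^sup>2))"
      using gaussian_integral[OF \<tau>] by (rule integrable.intros)
    have K: "0 \<le> ?K x" "\<bar>?K x\<bar> \<le> (pi / \<tau>) powr (DIM('a) / 2)" for x
      using \<tau> by (auto simp only: cos_transform_gauss[OF \<tau>] abs_mult abs_exp_cancel) (auto simp: mult_left_le)
    have "(LINT \<xi>|lborel. cos_transform u \<xi> * exp (- \<tau> * (norm \<xi>)\<^sup>2)) = (LINT x|lborel. ?K x * u x)"
      unfolding cos_transform_swap[OF u g] by (simp add: mult.commute)
    also have "\<dots> \<le> (LINT x|lborel. ?K x * C)"
    proof (rule integral_mono)
      show "integrable lborel (\<lambda>x. ?K x * u x)"
      proof (rule Bochner_Integration.integrable_bound)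
        show "integrable lborel (\<lambda>x. (pi / \<tau>) powr (DIM('a) / 2) * u x)" using u by auto
        show "AE x in lborel. norm (?K x * u x) \<le> norm ((pi / \<tau>) powr (DIM('a) / 2) * u x)"
          using K(2) by (auto simp: abs_mult intro!: mult_right_mono)
      qed measurable
      show "integrable lborel (\<lambda>x. ?K x * C)"
        using integrable.intros[OF integral_cos_transform_gauss[OF \<tau>]] by auto
      show "?K x * u x \<le> ?K x * C" for x
        using K(1) le by (intro mult_left_mono)
    qed
    also have "\<dots> = (2 * pi) ^ DIM('a) * C"
      using has_bochner_integral_integral_eq[OF integral_cos_transform_gauss[OF \<tau>, where 'a='a]] by simp
    finally show "(LINT \<xi>|lborel. cos_transform u \<xi> * exp (- \<tau> * (norm \<xi>)\<^sup>2))
      \<le> (LINT b|count_space (UNIV::unit set). ((2 * pi) ^ DIM('a) * C) * exp (- \<tau> * 0))"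
      by (simp add: lebesgue_integral_count_space_finite)
  qed (use t in \<open>auto intro!: integrable_count_space\<close>)
  then show ?thesis
    by (simp add: integral_heat_transform_mult[OF u t] lebesgue_integral_count_space_finite symbol_def)
qed

text \<open>The majorant is built from a Gaussian because the limit of the integral of the heat
  kernel against a Gaussian is known (heat_transform_gauss_tendsto). Continuity gives a ball where
  u is within e of u 0; outside that ball K makes the second term exceed the largest possible
  oscillation 2 * C.\<close>

lemma continuous_bounded_le_gauss:
  fixes u :: "'a::euclidean_space \<Rightarrow> real"
  assumes bnd: "\<And>x. \<bar>u x\<bar> \<le> C" and cont: "isCont u 0" and e: "e > 0"
  obtains K where "K \<ge> 0" "\<And>x. \<bar>u x - u 0\<bar> \<le> e + K * (1 - exp (- (norm x)\<^sup>2))"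
proof -
  from cont e obtain d where d: "d > 0" "\<And>x. norm x < d \<Longrightarrow> \<bar>u x - u 0\<bar> < e"
    unfolding continuous_at_eps_delta by (auto simp: dist_norm)
  have q: "1 - exp (- d\<^sup>2) > 0" using d by simp
  have C: "C \<ge> 0" using bnd[of 0] by linarith
  define K where "K = 2 * C / (1 - exp (- d\<^sup>2))"
  have K: "K \<ge> 0" using C q by (simp add: K_def)
  have "\<bar>u x - u 0\<bar> \<le> e + K * (1 - exp (- (norm x)\<^sup>2))" for x
  proof (cases "norm x < d")
    case True
    have "0 \<le> K * (1 - exp (- (norm x)\<^sup>2))" using K by simp
    with d(2)[OF True] show ?thesis by linarith
  next
    case False
    then have "exp (- (norm x)\<^sup>2) \<le> exp (- d\<^sup>2)" using d by (simp add: power_mono)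
    then have "K * (1 - exp (- d\<^sup>2)) \<le> K * (1 - exp (- (norm x)\<^sup>2))"
      using K by (intro mult_left_mono) auto
    moreover have "K * (1 - exp (- d\<^sup>2)) = 2 * C" using q by (simp add: K_def)
    ultimately show ?thesis using bnd[of x] bnd[of 0] e by linarith
  qed
  with K show ?thesis using that by blast
qed

lemma heat_transform_gauss_tendsto:
  "(\<lambda>n. LINT x|lborel. heat_transform s (inverse (Suc n)) x * exp (- (norm (x::'a::euclidean_space))\<^sup>2)) \<longlonglongrightarrow> (2 * pi) ^ DIM('a)"
proof -
  have g: "integrable lborel (\<lambda>\<xi>::'a. exp (- 1 * (norm \<xi>)\<^sup>2))"
    by (rule integrable.intros[OF gaussian_integral]) simp
  let ?w = "cos_transform (\<lambda>\<xi>::'a. exp (- 1 * (norm \<xi>)\<^sup>2))"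
  have w: "has_bochner_integral lborel ?w ((2 * pi) ^ DIM('a))"
    by (rule integral_cos_transform_gauss) simp
  have w0: "0 \<le> ?w x" for x by (subst cos_transform_gauss) auto
  have [measurable]: "?w \<in> borel_measurable borel" by measurable
  have "(\<lambda>n. LINT \<xi>|lborel. ?w \<xi> * exp (- inverse (Suc n) * symbol s ((norm \<xi>)\<^sup>2))) \<longlonglongrightarrow> (LINT \<xi>|lborel. ?w \<xi>)"
  proof (rule integral_dominated_convergence[where w = ?w])
    show "integrable lborel ?w" by (rule integrable.intros[OF w])
    show "AE \<xi> in lborel. (\<lambda>n. ?w \<xi> * exp (- inverse (Suc n) * symbol s ((norm \<xi>)\<^sup>2))) \<longlonglongrightarrow> ?w \<xi>"
    proof (intro always_eventually allI)
      fix \<xi> :: 'a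
      have "(\<lambda>n. ?w \<xi> * exp (- inverse (Suc n) * symbol s ((norm \<xi>)\<^sup>2))) \<longlonglongrightarrow> ?w \<xi> * exp (- 0 * symbol s ((norm \<xi>)\<^sup>2))"
        by (intro tendsto_intros LIMSEQ_inverse_real_of_nat)
      then show "(\<lambda>n. ?w \<xi> * exp (- inverse (Suc n) * symbol s ((norm \<xi>)\<^sup>2))) \<longlonglongrightarrow> ?w \<xi>" by simp
    qed
    show "AE \<xi> in lborel. norm (?w \<xi> * exp (- inverse (Suc n) * symbol s ((norm \<xi>)\<^sup>2))) \<le> ?w \<xi>" for n
    proof (intro always_eventually allI)
      fix \<xi> :: 'a
      have "exp (- inverse (Suc n) * symbol s ((norm \<xi>)\<^sup>2)) \<le> 1"
        using symbol_nonneg[of "(norm \<xi>)\<^sup>2" s] by simp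
      then show "norm (?w \<xi> * exp (- inverse (Suc n) * symbol s ((norm \<xi>)\<^sup>2))) \<le> ?w \<xi>"
        using w0[of \<xi>] by (subst real_norm_def, subst abs_of_nonneg) (auto intro: mult_left_le)
    qed
  qed measurable
  moreover have "(LINT x|lborel. heat_transform s (inverse (Suc n)) x * exp (- (norm (x::'a))\<^sup>2))
     = (LINT \<xi>|lborel. ?w \<xi> * exp (- inverse (Suc n) * symbol s ((norm \<xi>)\<^sup>2)))" for n
    using integral_heat_transform_mult[OF g, of "inverse (Suc n)" s] by simp
  ultimately show ?thesis using w by (simp add: has_bochner_integral_integral_eq)
qed

text \<open>By continuous_bounded_le_gauss, adding K times a Gaussian to u or to - u produces a
  function whose supremum exceeds its value at 0 by at most e. The maximum principle bounds its
  average, and heat_transform_gauss_tendsto accounts for the Gaussian.\<close>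

lemma heat_transform_approximate_identity:
  fixes u :: "'a::euclidean_space \<Rightarrow> real"
  assumes s: "0 < s" "s < 1" and u: "integrable lborel u" and bnd: "\<And>x. \<bar>u x\<bar> \<le> C" and cont: "isCont u 0"
  shows "(\<lambda>n. LINT x|lborel. heat_transform s (inverse (Suc n)) x * u x) \<longlonglongrightarrow> (2 * pi) ^ DIM('a) * u 0"
proof -
  let ?m = "(2 * pi) ^ DIM('a)"
  let ?J = "\<lambda>v n. LINT x|lborel. heat_transform s (inverse (real (Suc n))) (x::'a) * v x"
  let ?w = "\<lambda>x::'a. exp (- (norm x)\<^sup>2)"
  have w: "integrable lborel ?w"
    using integrable.intros[OF gaussian_integral[of 1]] by simp
  have key: "?J v n \<le> ?m * (v 0 + e) + K * (?m - ?J ?w n)"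
    if v: "integrable lborel v" and K: "\<And>x. v x \<le> v 0 + e + K * (1 - ?w x)" for v e K n
  proof -
    have t: "inverse (real (Suc n)) > 0" by simp
    note int = integrable_heat_transform_mult[OF v t, of s] integrable_heat_transform_mult[OF w t, of s]
    have "?J v n + K * ?J ?w n = (LINT x|lborel. heat_transform s (inverse (real (Suc n))) x * (v x + K * ?w x))"
      using int by (simp add: distrib_left mult.left_commute)
    also have "\<dots> \<le> ?m * (v 0 + e + K)"
    proof (rule heat_transform_maximum_principle[OF s t])
      show "integrable lborel (\<lambda>x. v x + K * ?w x)" using v w by auto
      show "v x + K * ?w x \<le> v 0 + e + K" for x
        using K[of x] by (simp add: right_diff_distrib)
    qed
    finally show ?thesis by (simp add: algebra_simps)
  qed
  show ?thesis
  proof (rule LIMSEQ_I)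
    fix r :: real assume r: "r > 0"
    have m: "?m > 0" by simp
    define e where "e = r / (2 * ?m)"
    have e: "e > 0" "?m * e = r / 2" using r m by (auto simp: e_def)
    obtain K where K: "K \<ge> 0" "\<And>x. \<bar>u x - u 0\<bar> \<le> e + K * (1 - ?w x)"
      using continuous_bounded_le_gauss[OF bnd cont e(1)] by blast
    \<comment> \<open>The constant e absorbs the oscillation near 0; the rest is a multiple of what the
           integral of the heat kernel against a Gaussian lacks to its limit.\<close>
    have up: "?J u n \<le> ?m * (u 0 + e) + K * (?m - ?J ?w n)" for n
      by (rule key[OF u]) (use K(2) in \<open>smt (verit)\<close>)
    have "?J (\<lambda>x. - u x) n \<le> ?m * (- u 0 + e) + K * (?m - ?J ?w n)" for n
      by (rule key) (use u K(2) in \<open>auto, smt (verit)\<close>)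
    then have lo: "- ?J u n \<le> ?m * (- u 0 + e) + K * (?m - ?J ?w n)" for n by simp
    have "(\<lambda>n. K * (?m - ?J ?w n)) \<longlonglongrightarrow> K * (?m - ?m)"
      by (intro tendsto_intros heat_transform_gauss_tendsto)
    then have "eventually (\<lambda>n. K * (?m - ?J ?w n) < r / 2) sequentially"
      using r by (intro order_tendstoD(2)) auto
    then obtain N where N: "\<And>n. n \<ge> N \<Longrightarrow> K * (?m - ?J ?w n) < r / 2"
      by (auto simp: eventually_sequentially)
    have "norm (?J u n - ?m * u 0) < r" if "n \<ge> N" for n
      using up[of n] lo[of n] N[OF that] e(2)
      unfolding distrib_left mult_minus_right real_norm_def abs_less_iff by linarith
    then show "\<exists>no. \<forall>n\<ge>no. norm (?J u n - ?m * u 0) < r" by blast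
  qed
qed

lemma heat_transform_large_time:
  fixes u :: "'a::euclidean_space \<Rightarrow> real"
  assumes u: "integrable lborel u"
  shows "(\<lambda>n. LINT x|lborel. heat_transform s (real (Suc n)) x * u x) \<longlonglongrightarrow> 0"
proof (rule Lim_null_comparison)
  let ?a = "DIM('a) / 2"
  have a: "?a > 0" by simp
  show "eventually (\<lambda>n. norm (LINT x|lborel. heat_transform s (real (Suc n)) x * u x) \<le> (pi / real (Suc n)) powr ?a * (LINT x|lborel. \<bar>u x\<bar>)) sequentially"
  proof (intro always_eventually allI)
    fix n
    have t: "real (Suc n) > 0" by simp
    have "norm (LINT x|lborel. heat_transform s (real (Suc n)) x * u x) \<le> (LINT x|lborel. \<bar>heat_transform s (real (Suc n)) x * u x\<bar>)"
      unfolding real_norm_def by (rule integral_abs_bound)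
    also have "\<dots> \<le> (LINT x|lborel. (pi / real (Suc n)) powr ?a * \<bar>u x\<bar>)"
    proof (rule integral_mono)
      show "integrable lborel (\<lambda>x. \<bar>heat_transform s (real (Suc n)) x * u x\<bar>)"
        using integrable_heat_transform_mult[OF u t, of s] by auto
      show "\<bar>heat_transform s (real (Suc n)) x * u x\<bar> \<le> (pi / real (Suc n)) powr ?a * \<bar>u x\<bar>" for x
        unfolding abs_mult by (intro mult_right_mono abs_heat_transform_le[OF t]) auto
    qed (use u in auto)
    finally show "norm (LINT x|lborel. heat_transform s (real (Suc n)) x * u x) \<le> (pi / real (Suc n)) powr ?a * (LINT x|lborel. \<bar>u x\<bar>)"
      by simp
  qed
  have "(\<lambda>n. pi * inverse (real (Suc n))) \<longlonglongrightarrow> pi * 0"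
    by (intro tendsto_intros LIMSEQ_inverse_real_of_nat)
  then have "(\<lambda>n. pi / real (Suc n)) \<longlonglongrightarrow> 0" by (simp add: divide_inverse)
  then have "(\<lambda>n. (pi / real (Suc n)) powr ?a) \<longlonglongrightarrow> 0 powr ?a"
    by (rule tendsto_powr2[OF _ tendsto_const]) (use a in auto)
  then have "(\<lambda>n. (pi / real (Suc n)) powr ?a * (LINT x|lborel. \<bar>u x\<bar>)) \<longlonglongrightarrow> 0 powr ?a * (LINT x|lborel. \<bar>u x\<bar>)"
    by (rule tendsto_mult_right)
  then show "(\<lambda>n. (pi / real (Suc n)) powr ?a * (LINT x|lborel. \<bar>u x\<bar>)) \<longlonglongrightarrow> 0" by simp
qed

section \<open>Pairing the time integral with a function\<close>

text \<open>The hypothesis says that g is the operator applied to u. On the transform side the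
  integral over t of symbol * exp (- t * symbol) is the difference of the exponentials at the end
  points, and each of these, integrated against the transform of u, is a pairing of u with the
  heat kernel.\<close>

lemma heat_transform_time_integral:
  fixes u g :: "'a::euclidean_space \<Rightarrow> real"
  assumes u: "integrable lborel u" and g: "integrable lborel g"
    and ug: "\<And>\<xi>. cos_transform g \<xi> = symbol s ((norm \<xi>)\<^sup>2) * cos_transform u \<xi>"
    and dT: "0 < d" "d \<le> T"
  shows "(LINT t|lborel. indicator {d..T} t * (LINT x|lborel. heat_transform s t x * g x))
     = (LINT x|lborel. heat_transform s d x * u x) - (LINT x|lborel. heat_transform s T x * u x)"
proof -
  have T: "T > 0" using dT by simp
  have [measurable]: "u \<in> borel_measurable borel" "g \<in> borel_measurable borel" using u g by auto
  let ?p = "\<lambda>\<xi>::'a. symbol s ((norm \<xi>)\<^sup>2)"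
  let ?k = "\<lambda>\<xi> t. cos_transform u \<xi> * ((?p \<xi> * exp (- t * ?p \<xi>)) * indicator {d..T} t)"
  have p0: "?p \<xi> \<ge> 0" for \<xi> by (simp add: symbol_nonneg)
  have ftc: "has_bochner_integral lborel (\<lambda>t. (?p \<xi> * exp (- t * ?p \<xi>)) * indicator {d..T} t) (exp (- d * ?p \<xi>) - exp (- T * ?p \<xi>))" for \<xi>
  proof -
    have "has_bochner_integral lborel (\<lambda>t. (?p \<xi> * exp (- t * ?p \<xi>)) * indicator {d..T} t) ((- exp (- T * ?p \<xi>)) - (- exp (- d * ?p \<xi>)))"
      using dT p0 by (intro has_bochner_integral_FTC_Icc_nonneg) (auto intro!: derivative_eq_intros)
    then show ?thesis by simp
  qed
  have int_u: "integrable lborel (\<lambda>\<xi>. cos_transform u \<xi> * exp (- t * ?p \<xi>))" if "t > 0" for t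
    by (rule integrable_symbol_bound[OF that _ abs_cos_transform_le[OF u]]) measurable
  have "integrable (lborel \<Otimes>\<^sub>M lborel) (case_prod ?k)"
  proof (rule lborel_pair.Fubini_integrable)
    have *: "(LINT t|lborel. norm (case_prod ?k (\<xi>, t))) = \<bar>cos_transform u \<xi>\<bar> * (exp (- d * ?p \<xi>) - exp (- T * ?p \<xi>))" for \<xi>
    proof -
      have "(LINT t|lborel. norm (case_prod ?k (\<xi>, t))) = (LINT t|lborel. \<bar>cos_transform u \<xi>\<bar> * ((?p \<xi> * exp (- t * ?p \<xi>)) * indicator {d..T} t))"
        using p0[of \<xi>] by (intro Bochner_Integration.integral_cong) (auto simp: abs_mult)
      also have "\<dots> = \<bar>cos_transform u \<xi>\<bar> * (exp (- d * ?p \<xi>) - exp (- T * ?p \<xi>))"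
        unfolding integral_mult_right_zero has_bochner_integral_integral_eq[OF ftc] ..
      finally show ?thesis .
    qed
    have "integrable lborel (\<lambda>\<xi>. \<bar>cos_transform u \<xi> * exp (- d * ?p \<xi>)\<bar> - \<bar>cos_transform u \<xi> * exp (- T * ?p \<xi>)\<bar>)"
      by (intro Bochner_Integration.integrable_diff integrable_abs int_u dT T)
    then show "integrable lborel (\<lambda>\<xi>. LINT t|lborel. norm (case_prod ?k (\<xi>, t)))"
      unfolding * by (simp add: abs_mult right_diff_distrib)
    show "AE \<xi> in lborel. integrable lborel (\<lambda>t. case_prod ?k (\<xi>, t))"
      by (auto simp only: prod.case intro!: always_eventually integrable_mult_right integrable.intros[OF ftc])
  qed measurable
  from lborel_pair.Fubini_integral[OF this]
  have fub: "(LINT t|lborel. LINT \<xi>|lborel. ?k \<xi> t) = (LINT \<xi>|lborel. LINT t|lborel. ?k \<xi> t)" by simp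
  have "(LINT t|lborel. indicator {d..T} t * (LINT x|lborel. heat_transform s t x * g x)) = (LINT t|lborel. LINT \<xi>|lborel. ?k \<xi> t)"
  proof (rule Bochner_Integration.integral_cong[OF refl])
    fix t :: real
    show "indicator {d..T} t * (LINT x|lborel. heat_transform s t x * g x) = (LINT \<xi>|lborel. ?k \<xi> t)"
    proof (cases "t \<in> {d..T}")
      case True
      then have "t > 0" using dT by auto
      then show ?thesis
        using True by (simp only: integral_heat_transform_mult[OF g \<open>t > 0\<close>] ug) (simp add: mult_ac)
    qed simp
  qed
  also have "\<dots> = (LINT \<xi>|lborel. cos_transform u \<xi> * (exp (- d * ?p \<xi>) - exp (- T * ?p \<xi>)))"
    unfolding fub integral_mult_right_zero has_bochner_integral_integral_eq[OF ftc] ..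
  also have "\<dots> = (LINT \<xi>|lborel. cos_transform u \<xi> * exp (- d * ?p \<xi>)) - (LINT \<xi>|lborel. cos_transform u \<xi> * exp (- T * ?p \<xi>))"
    using int_u[OF dT(1)] int_u[OF T] by (simp add: right_diff_distrib)
  finally show ?thesis
    unfolding integral_heat_transform_mult[OF u dT(1)] integral_heat_transform_mult[OF u T] .
qed

text \<open>For t \<le> 1 the maximum principle bounds the space integral by a constant; for t
  \<ge> 1 the decay t powr (- n / 2) of the heat kernel is integrable because n \<ge> 3.\<close>

lemma integrable_heat_transform_spacetime:
  fixes g :: "'a::euclidean_space \<Rightarrow> real"
  assumes s: "0 < s" "s < 1" and dim: "DIM('a) \<ge> 3" and g: "integrable lborel g" and bnd: "\<And>x. \<bar>g x\<bar> \<le> C"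
  shows "integrable (lborel \<Otimes>\<^sub>M lborel) (\<lambda>(t, x). indicator {0<..} t * heat_transform s t x * g x)"
proof (rule lborel_pair.Fubini_integrable)
  have [measurable]: "g \<in> borel_measurable borel" using g by auto
  have abs_g: "integrable lborel (\<lambda>x. \<bar>g x\<bar>)" using g by auto
  let ?a = "DIM('a) / 2"
  let ?f = "\<lambda>t x. indicator {0<..} t * heat_transform s t x * g x"
  show meas: "case_prod ?f \<in> borel_measurable (lborel \<Otimes>\<^sub>M lborel)" by measurable
  show "AE t in lborel. integrable lborel (\<lambda>x. case_prod ?f (t, x))"
  proof (intro always_eventually allI)
    fix t :: real
    show "integrable lborel (\<lambda>x. case_prod ?f (t, x))"
      using integrable_heat_transform_mult[OF g, of t s] by (cases "t > 0") auto
  qed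
  \<comment> \<open>Majorant of the space integral: a constant for small times and a multiple of t powr (- n / 2) for large
         times, written with the exponent - 1 - (n / 2 - 1) of an integrable power tail.\<close>
  let ?b = "\<lambda>t. (2 * pi) ^ DIM('a) * C * indicator {0..1} t
       + pi powr ?a * (LINT x|lborel. \<bar>g x\<bar>) * (indicator {1..} t * t powr (- 1 - (?a - 1)))"
  have b1: "0 \<le> (2 * pi) ^ DIM('a) * C" using bnd[of 0] by (auto intro: order_trans[OF abs_ge_zero])
  have b2: "0 \<le> pi powr ?a * (LINT x|lborel. \<bar>g x\<bar>)" by simp
  have "integrable lborel ?b"
    by (intro Bochner_Integration.integrable_add integrable_mult_right integrable_powr_tail) (use dim in auto)
  then show "integrable lborel (\<lambda>t. LINT x|lborel. norm (case_prod ?f (t, x)))"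
  proof (rule Bochner_Integration.integrable_bound)
    show "AE t in lborel. norm (LINT x|lborel. norm (case_prod ?f (t, x))) \<le> norm (?b t)"
    proof (intro always_eventually allI)
      fix t :: real
      have I: "(LINT x|lborel. norm (case_prod ?f (t, x))) = indicator {0<..} t * (LINT x|lborel. heat_transform s t x * \<bar>g x\<bar>)"
        by (cases "t > 0") (auto simp: abs_mult heat_transform_nonneg[OF s])
      have I0: "0 \<le> (LINT x|lborel. norm (case_prod ?f (t, x)))" by simp
      have "(LINT x|lborel. norm (case_prod ?f (t, x))) \<le> ?b t"
      proof (cases "t > 0")
        case t: True
        show ?thesis
        proof (cases "t \<le> 1")
          case True
          have "(LINT x|lborel. heat_transform s t x * \<bar>g x\<bar>) \<le> (2 * pi) ^ DIM('a) * C"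
            by (rule heat_transform_maximum_principle[OF s t abs_g bnd])
          moreover have "0 \<le> pi powr ?a * (LINT x|lborel. \<bar>g x\<bar>) * (indicator {1..} t * t powr (- 1 - (?a - 1)))"
            using b2 by (intro mult_nonneg_nonneg) auto
          moreover have "indicator {0<..} t = (1::real)" "indicator {0..1} t = (1::real)"
            using t True by auto
          ultimately show ?thesis unfolding I by (simp only: mult_1_left mult_1_right)
        next
          case False
          have "(LINT x|lborel. heat_transform s t x * \<bar>g x\<bar>) \<le> (LINT x|lborel. (pi / t) powr ?a * \<bar>g x\<bar>)"
          proof (rule integral_mono)
            show "heat_transform s t x * \<bar>g x\<bar> \<le> (pi / t) powr ?a * \<bar>g x\<bar>" for x
              by (rule mult_right_mono[OF order_trans[OF abs_ge_self abs_heat_transform_le[OF t]]]) simp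
          qed (use integrable_heat_transform_mult[OF abs_g t, of s] abs_g in auto)
          also have "\<dots> = pi powr ?a * (LINT x|lborel. \<bar>g x\<bar>) * t powr (- 1 - (?a - 1))"
          proof -
            have "- 1 - (?a - 1) = - ?a" by simp
            moreover have "(pi / t) powr ?a = pi powr ?a * t powr (- ?a)"
              using t by (simp only: powr_divide pi_ge_zero less_imp_le powr_minus_divide) simp
            ultimately show ?thesis unfolding integral_mult_right_zero by (simp only: mult_ac)
          qed
          finally have "(LINT x|lborel. heat_transform s t x * \<bar>g x\<bar>) \<le> pi powr ?a * (LINT x|lborel. \<bar>g x\<bar>) * t powr (- 1 - (?a - 1))" .
          moreover have "indicator {0<..} t = (1::real)" "indicator {0..1} t = (0::real)" "indicator {1..} t = (1::real)"
            using t False by auto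
          ultimately show ?thesis
            unfolding I by (simp only: mult_1_left mult_zero_right add_0_left)
        qed
      next
        case False
        then show ?thesis unfolding I using b1 b2 by (auto simp: indicator_def)
      qed
      then show "norm (LINT x|lborel. norm (case_prod ?f (t, x))) \<le> norm (?b t)"
        using I0 by simp
    qed
    show "(\<lambda>t. LINT x|lborel. norm (case_prod ?f (t, x))) \<in> borel_measurable lborel"
      unfolding prod.case by measurable
  qed
qed

theorem green_pairing:
  fixes u g :: "'a::euclidean_space \<Rightarrow> real"
  assumes s: "0 < s" "s < 1" and dim: "DIM('a) \<ge> 3"
    and u: "integrable lborel u" "\<And>x. \<bar>u x\<bar> \<le> B" "isCont u 0"
    and g: "integrable lborel g" "\<And>x. \<bar>g x\<bar> \<le> C"
    and ug: "\<And>\<xi>. cos_transform g \<xi> = symbol s ((norm \<xi>)\<^sup>2) * cos_transform u \<xi>"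
  shows "has_bochner_integral lborel (\<lambda>x. green s x * g x) ((2 * pi) ^ DIM('a) * u 0)"
proof -
  let ?f = "\<lambda>t x. indicator {0<..} t * heat_transform s t x * g x"
  let ?I = "\<lambda>t. LINT x|lborel. heat_transform s t x * g x"
  have int: "integrable (lborel \<Otimes>\<^sub>M lborel) (\<lambda>(t, x). ?f t x)"
    by (rule integrable_heat_transform_spacetime[OF s dim g])
  have snd: "(LINT t|lborel. ?f t x) = green s x * g x" for x
    by (simp add: green_def)
  have fst: "(LINT x|lborel. ?f t x) = indicator {0<..} t * ?I t" for t
    by (simp add: mult.assoc)
  have 1: "integrable lborel (\<lambda>x. green s x * g x)"
    using lborel_pair.integrable_snd[OF int] by (simp only: snd)
  have 2: "integrable lborel (\<lambda>t. indicator {0<..} t * ?I t)"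
    using lborel_pair.integrable_fst[OF int] by (simp only: fst)
  have 3: "(LINT x|lborel. green s x * g x) = (LINT t|lborel. indicator {0<..} t * ?I t)"
    using lborel_pair.Fubini_integral[OF int] by (simp only: snd fst)
  let ?d = "\<lambda>n. inverse (real (Suc n))"
  have d: "0 < ?d n" "?d n \<le> real (Suc n)" for n
  proof -
    show "0 < ?d n" by simp
    have "?d n \<le> 1" by (simp add: inverse_eq_divide)
    then show "?d n \<le> real (Suc n)" by (simp add: le_trans)
  qed
  have "(\<lambda>n. LINT t|lborel. indicator {?d n..real (Suc n)} t * ?I t) \<longlonglongrightarrow> (LINT t|lborel. indicator {0<..} t * ?I t)"
  proof (rule integral_dominated_convergence[where w = "\<lambda>t. \<bar>indicator {0<..} t * ?I t\<bar>"])
    have [measurable]: "g \<in> borel_measurable borel" using g by auto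
    show "(\<lambda>t. indicator {?d n..real (Suc n)} t * ?I t) \<in> borel_measurable lborel" for n
      by measurable
    show "(\<lambda>t. indicator {0<..} t * ?I t) \<in> borel_measurable lborel" using 2 by auto
    show "integrable lborel (\<lambda>t. \<bar>indicator {0<..} t * ?I t\<bar>)" using 2 by (rule integrable_abs)
    show "AE t in lborel. norm (indicator {?d n..real (Suc n)} t * ?I t) \<le> \<bar>indicator {0<..} t * ?I t\<bar>" for n
    proof (intro always_eventually allI)
      fix t :: real
      show "norm (indicator {?d n..real (Suc n)} t * ?I t) \<le> \<bar>indicator {0<..} t * ?I t\<bar>"
        using less_le_trans[OF d(1)[of n], of t] by (cases "?d n \<le> t") (auto simp: indicator_def)
    qed
    show "AE t in lborel. (\<lambda>n. indicator {?d n..real (Suc n)} t * ?I t) \<longlonglongrightarrow> indicator {0<..} t * ?I t"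
    proof (intro always_eventually allI)
      fix t :: real
      have "eventually (\<lambda>n. indicator {?d n..real (Suc n)} t = (indicator {0<..} t :: real)) sequentially"
      proof (cases "t > 0")
        case True
        have "eventually (\<lambda>n. ?d n < t) sequentially"
          using True LIMSEQ_inverse_real_of_nat order_tendstoD(2) by blast
        moreover have "eventually (\<lambda>n. t \<le> real n) sequentially"
          using filterlim_real_sequentially by (simp add: filterlim_at_top)
        ultimately show ?thesis
          by eventually_elim (use True in \<open>auto simp: indicator_def\<close>)
      next
        case False
        have "\<not> ?d n \<le> t" for n using False d(1)[of n] by linarith
        with False show ?thesis by (auto simp: indicator_def)
      qed
      then show "(\<lambda>n. indicator {?d n..real (Suc n)} t * ?I t) \<longlonglongrightarrow> indicator {0<..} t * ?I t"
        by (intro tendsto_eventually) (auto elim!: eventually_mono)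
    qed
  qed
  moreover have "(\<lambda>n. LINT t|lborel. indicator {?d n..real (Suc n)} t * ?I t) \<longlonglongrightarrow> (2 * pi) ^ DIM('a) * u 0 - 0"
    unfolding heat_transform_time_integral[OF u(1) g(1) ug d]
    by (intro tendsto_diff heat_transform_approximate_identity[OF s u] heat_transform_large_time[OF u(1)])
  ultimately have "(LINT t|lborel. indicator {0<..} t * ?I t) = (2 * pi) ^ DIM('a) * u 0"
    using LIMSEQ_unique by fastforce
  with 1 3 show ?thesis by (simp add: has_bochner_integral_iff)
qed

section \<open>Test functions and their Laplacians\<close>

lemma test_function_partial_deriv:
  assumes \<phi>: "test_function \<phi>" and b: "b \<in> Basis"
  shows "test_function (partial_deriv b \<phi>)"
proof -
  have "smooth_fun (partial_deriv b \<phi>)"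
    unfolding smooth_fun_def
  proof (intro allI impI)
    fix bs :: "'a list" assume "set bs \<subseteq> Basis"
    then have "set (bs @ [b]) \<subseteq> Basis" using b by simp
    moreover have "iter_partial (bs @ [b]) \<phi> = iter_partial bs (partial_deriv b \<phi>)"
      by (simp add: iter_partial_def)
    ultimately show "continuous_on UNIV (iter_partial bs (partial_deriv b \<phi>)) \<and>
        (\<forall>c\<in>Basis. \<forall>x. (\<lambda>h. iter_partial bs (partial_deriv b \<phi>) (x + h *\<^sub>R c)) differentiable (at 0))"
      using \<phi> unfolding test_function_def smooth_fun_def by metis
  qed
  moreover have "compact (closure {x. partial_deriv b \<phi> x \<noteq> 0})"
  proof -
    let ?K = "closure {x. \<phi> x \<noteq> 0}"
    have "partial_deriv b \<phi> x = 0" if "x \<notin> ?K" for x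
    proof -
      have "open ((\<lambda>h::real. x + h *\<^sub>R b) -` (- ?K))"
        by (rule open_vimage) (auto intro!: continuous_intros)
      moreover have "0 \<in> (\<lambda>h::real. x + h *\<^sub>R b) -` (- ?K)" using that by simp
      ultimately have "eventually (\<lambda>h. h \<in> (\<lambda>h::real. x + h *\<^sub>R b) -` (- ?K)) (nhds 0)"
        by (rule eventually_nhds_in_open)
      then have "eventually (\<lambda>h::real. \<phi> (x + h *\<^sub>R b) = 0) (nhds 0)"
        by eventually_elim (use closure_subset[of "{x. \<phi> x \<noteq> 0}"] in auto)
      then have "deriv (\<lambda>h. \<phi> (x + h *\<^sub>R b)) 0 = deriv (\<lambda>_. 0) 0"
        by (rule deriv_cong_ev) simp
      then show ?thesis by (simp add: partial_deriv_def)
    qed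
    then have "{x. partial_deriv b \<phi> x \<noteq> 0} \<subseteq> ?K" by blast
    then have "closure {x. partial_deriv b \<phi> x \<noteq> 0} \<subseteq> ?K" by (simp add: closure_minimal)
    moreover have "compact ?K" using \<phi> by (simp add: test_function_def)
    ultimately show ?thesis by (metis bounded_subset closed_closure compact_eq_bounded_closed)
  qed
  ultimately show ?thesis by (simp add: test_function_def)
qed

lemma test_function_continuous:
  assumes "test_function \<phi>"
  shows "continuous_on UNIV \<phi>"
proof -
  have "set [] \<subseteq> (Basis :: 'a set)" by simp
  then have "continuous_on UNIV (iter_partial [] \<phi>)"
    using assms unfolding test_function_def smooth_fun_def by blast
  then show ?thesis by (simp add: iter_partial_def)
qed

lemma test_function_measurable:
  assumes "test_function \<phi>"
  shows "\<phi> \<in> borel_measurable borel"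
  by (rule borel_measurable_continuous_onI[OF test_function_continuous[OF assms]])

lemma test_function_support:
  fixes \<phi> :: "'a::euclidean_space \<Rightarrow> real"
  assumes "test_function \<phi>"
  obtains \<rho> where "\<rho> > 0" "\<And>x. norm x > \<rho> \<Longrightarrow> \<phi> x = 0"
proof -
  have "bounded (closure {x. \<phi> x \<noteq> 0})"
    using assms by (auto simp: test_function_def intro: compact_imp_bounded)
  then obtain \<rho> where "\<rho> > 0" and \<rho>: "\<And>x. x \<in> closure {x. \<phi> x \<noteq> 0} \<Longrightarrow> norm x \<le> \<rho>"
    unfolding bounded_pos by blast
  moreover have "\<phi> x = 0" if "norm x > \<rho>" for x
    using \<rho>[of x] that closure_subset[of "{x. \<phi> x \<noteq> 0}"] by fastforce
  ultimately show ?thesis using that by blast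
qed

lemma continuous_supported_bounded:
  fixes f :: "'a::euclidean_space \<Rightarrow> real"
  assumes cont: "continuous_on UNIV f" and supp: "\<And>x. norm x > \<rho> \<Longrightarrow> f x = 0"
  shows "\<exists>B\<ge>0. \<forall>x. \<bar>f x\<bar> \<le> B"
proof -
  have "compact (f ` cball 0 \<rho>)"
    by (intro compact_continuous_image continuous_on_subset[OF cont]) auto
  then obtain B where B: "\<And>x. x \<in> cball 0 \<rho> \<Longrightarrow> \<bar>f x\<bar> \<le> B"
    using compact_imp_bounded bounded_iff by (metis imageI real_norm_def)
  have "\<bar>f x\<bar> \<le> \<bar>B\<bar>" for x
    using B[of x] supp[of x] by (cases "norm x \<le> \<rho>") (auto simp: not_le)
  then show ?thesis by (intro exI[of _ "\<bar>B\<bar>"]) auto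
qed

lemma continuous_supported_integrable:
  fixes f :: "'a::euclidean_space \<Rightarrow> real"
  assumes cont: "continuous_on UNIV f" and supp: "\<And>x. norm x > \<rho> \<Longrightarrow> f x = 0"
  shows "integrable lborel f"
proof -
  have "integrable lborel (\<lambda>x. indicator (cball 0 \<rho>) x *\<^sub>R f x)"
    by (rule borel_integrable_compact) (auto intro: continuous_on_subset[OF cont])
  moreover have "(\<lambda>x. indicator (cball 0 \<rho>) x *\<^sub>R f x) = f"
    using supp by (auto simp: fun_eq_iff indicator_def)
  ultimately show ?thesis by simp
qed

lemma test_function_bounded:
  fixes \<phi> :: "'a::euclidean_space \<Rightarrow> real"
  assumes "test_function \<phi>"
  shows "\<exists>B\<ge>0. \<forall>x. \<bar>\<phi> x\<bar> \<le> B"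
  using test_function_support[OF assms] continuous_supported_bounded[OF test_function_continuous[OF assms]] by metis

lemma test_function_integrable:
  fixes \<phi> :: "'a::euclidean_space \<Rightarrow> real"
  assumes "test_function \<phi>"
  shows "integrable lborel \<phi>"
  using test_function_support[OF assms] continuous_supported_integrable[OF test_function_continuous[OF assms]] by metis

lemma test_function_deriv:
  assumes \<phi>: "test_function \<phi>" and b: "b \<in> Basis"
  shows "((\<lambda>h. \<phi> (x + h *\<^sub>R b)) has_real_derivative partial_deriv b \<phi> (x + h *\<^sub>R b)) (at h)"
proof -
  have "set [] \<subseteq> (Basis :: 'a set)" by simp
  then have "(\<lambda>k. iter_partial [] \<phi> ((x + h *\<^sub>R b) + k *\<^sub>R b)) differentiable (at 0)"
    using \<phi> b unfolding test_function_def smooth_fun_def by blast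
  then have "(\<lambda>k. \<phi> ((x + h *\<^sub>R b) + k *\<^sub>R b)) differentiable (at 0)"
    by (simp add: iter_partial_def)
  then have "((\<lambda>k. \<phi> ((x + h *\<^sub>R b) + k *\<^sub>R b)) has_real_derivative partial_deriv b \<phi> (x + h *\<^sub>R b)) (at 0)"
    unfolding partial_deriv_def by (simp add: DERIV_deriv_iff_real_differentiable)
  then have "((\<lambda>k. \<phi> (x + (h + k) *\<^sub>R b)) has_real_derivative partial_deriv b \<phi> (x + h *\<^sub>R b)) (at 0)"
    by (simp add: scaleR_add_left add.assoc)
  then show ?thesis
    using DERIV_at_within_shift_lemma[of "\<lambda>h. \<phi> (x + h *\<^sub>R b)" "partial_deriv b \<phi> (x + h *\<^sub>R b)" h 0 UNIV]
    by (simp add: o_def DERIV_shift[of "\<lambda>h. \<phi> (x + h *\<^sub>R b)" _ 0 h, symmetric] add.commute)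
qed

lemma mvt_line:
  fixes f :: "'a::euclidean_space \<Rightarrow> real"
  assumes "\<And>h. ((\<lambda>h. f (y + h *\<^sub>R b)) has_real_derivative f' (y + h *\<^sub>R b)) (at h)"
  obtains k where "\<bar>k\<bar> \<le> \<bar>h\<bar>" "f (y + h *\<^sub>R b) - f y = h * f' (y + k *\<^sub>R b)"
proof (cases h "0::real" rule: linorder_cases)
  case less
  obtain k where "h < k" "k < 0" "f (y + 0 *\<^sub>R b) - f (y + h *\<^sub>R b) = (0 - h) * f' (y + k *\<^sub>R b)"
    using MVT2[OF less, of "\<lambda>h. f (y + h *\<^sub>R b)" "\<lambda>h. f' (y + h *\<^sub>R b)"] assms by blast
  then show ?thesis by (intro that[of k]) auto
next
  case equal
  then show ?thesis by (intro that[of 0]) auto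
next
  case greater
  obtain k where "0 < k" "k < h" "f (y + h *\<^sub>R b) - f (y + 0 *\<^sub>R b) = (h - 0) * f' (y + k *\<^sub>R b)"
    using MVT2[OF greater, of "\<lambda>h. f (y + h *\<^sub>R b)" "\<lambda>h. f' (y + h *\<^sub>R b)"] assms by blast
  then show ?thesis by (intro that[of k]) auto
qed

lemma norm_partial_sum_le:
  fixes z :: "'a::euclidean_space"
  assumes "A \<subseteq> Basis"
  shows "norm (\<Sum>b\<in>A. (z \<bullet> b) *\<^sub>R b) \<le> DIM('a) * norm z"
proof -
  have "norm (\<Sum>b\<in>A. (z \<bullet> b) *\<^sub>R b) \<le> (\<Sum>b\<in>A. norm z)"
    by (rule order_trans[OF norm_sum sum_mono]) (use assms Basis_le_norm in \<open>auto simp: subset_iff\<close>)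
  also have "\<dots> \<le> DIM('a) * norm z"
    using assms by (auto intro!: mult_right_mono card_mono)
  finally show ?thesis .
qed

text \<open>Taylor expansion along the coordinate path from x to x + z, one mean value theorem per
  coordinate. With d = 0 and j = 0 this is a Lipschitz bound, with d the partial derivatives and j
  = 1 a second order bound.\<close>

lemma test_function_taylor1:
  fixes \<phi> :: "'a::euclidean_space \<Rightarrow> real" and L :: real
  assumes \<phi>: "test_function \<phi>"
    and osc: "\<And>b x z. b \<in> Basis \<Longrightarrow> \<bar>partial_deriv b \<phi> (x + z) - d b x\<bar> \<le> L * norm z ^ j" and L: "L \<ge> 0"
  shows "\<bar>\<phi> (x + z) - \<phi> x - (\<Sum>b\<in>Basis. (z \<bullet> b) * d b x)\<bar> \<le> real DIM('a) * (L * (real DIM('a) + 1) ^ j) * norm z ^ Suc j"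
proof -
  have "\<bar>\<phi> (x + (\<Sum>b\<in>A. (z \<bullet> b) *\<^sub>R b)) - \<phi> x - (\<Sum>b\<in>A. (z \<bullet> b) * d b x)\<bar> \<le> real (card A) * ((L * (real DIM('a) + 1) ^ j) * norm z ^ Suc j)"
    if "finite A" "A \<subseteq> Basis" for A
    using that
  proof (induction A rule: finite_induct)
    case (insert c A)
    let ?zA = "\<Sum>b\<in>A. (z \<bullet> b) *\<^sub>R b"
    let ?y = "x + ?zA"
    have c: "c \<in> Basis" using insert by simp
    obtain k where k: "\<bar>k\<bar> \<le> \<bar>z \<bullet> c\<bar>" "\<phi> (?y + (z \<bullet> c) *\<^sub>R c) - \<phi> ?y = (z \<bullet> c) * partial_deriv c \<phi> (?y + k *\<^sub>R c)"
      using mvt_line[OF test_function_deriv[OF \<phi> c]] by blast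
    have zc: "\<bar>z \<bullet> c\<bar> \<le> norm z" using c by (rule Basis_le_norm)
    have "norm (?zA + k *\<^sub>R c) \<le> DIM('a) * norm z + norm z"
      using norm_triangle_ineq[of ?zA "k *\<^sub>R c"] norm_partial_sum_le[of A z] insert k(1) zc c by simp
    also have "\<dots> = (real DIM('a) + 1) * norm z" by (simp add: algebra_simps)
    finally have "norm (?zA + k *\<^sub>R c) ^ j \<le> ((real DIM('a) + 1) * norm z) ^ j"
      by (rule power_mono) simp
    then have "L * norm (?zA + k *\<^sub>R c) ^ j \<le> L * ((real DIM('a) + 1) * norm z) ^ j"
      using L by (rule mult_left_mono)
    moreover have "\<bar>partial_deriv c \<phi> (?y + k *\<^sub>R c) - d c x\<bar> \<le> L * norm (?zA + k *\<^sub>R c) ^ j"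
      using osc[OF c, of x "?zA + k *\<^sub>R c"] by (simp add: add.assoc)
    ultimately have "\<bar>partial_deriv c \<phi> (?y + k *\<^sub>R c) - d c x\<bar> \<le> L * ((real DIM('a) + 1) * norm z) ^ j"
      by linarith
    then have "\<bar>z \<bullet> c\<bar> * \<bar>partial_deriv c \<phi> (?y + k *\<^sub>R c) - d c x\<bar> \<le> norm z * (L * ((real DIM('a) + 1) * norm z) ^ j)"
      using zc by (intro mult_mono) auto
    then have step: "\<bar>\<phi> (?y + (z \<bullet> c) *\<^sub>R c) - \<phi> ?y - (z \<bullet> c) * d c x\<bar> \<le> (L * (real DIM('a) + 1) ^ j) * norm z ^ Suc j"
      unfolding k(2) right_diff_distrib[symmetric] abs_mult by (simp add: power_mult_distrib mult_ac)
    have "\<phi> (x + (\<Sum>b\<in>insert c A. (z \<bullet> b) *\<^sub>R b)) - \<phi> x - (\<Sum>b\<in>insert c A. (z \<bullet> b) * d b x)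
      = (\<phi> (?y + (z \<bullet> c) *\<^sub>R c) - \<phi> ?y - (z \<bullet> c) * d c x) + (\<phi> ?y - \<phi> x - (\<Sum>b\<in>A. (z \<bullet> b) * d b x))"
      using insert by (simp add: add_ac)
    also have "\<bar>\<dots>\<bar> \<le> (L * (real DIM('a) + 1) ^ j) * norm z ^ Suc j + card A * ((L * (real DIM('a) + 1) ^ j) * norm z ^ Suc j)"
      using step insert by (intro order_trans[OF abs_triangle_ineq] add_mono) auto
    also have "\<dots> = card (insert c A) * ((L * (real DIM('a) + 1) ^ j) * norm z ^ Suc j)"
      using insert by (simp add: distrib_right)
    finally show ?case .
  qed simp
  from this[of Basis] show ?thesis by (simp add: euclidean_representation mult.assoc)
qed

text \<open>The first order terms at z and - z cancel.\<close>

lemma test_function_second_difference: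
  fixes \<phi> :: "'a::euclidean_space \<Rightarrow> real"
  assumes \<phi>: "test_function \<phi>"
  shows "\<exists>C\<ge>0. \<forall>x z. \<bar>2 * \<phi> x - \<phi> (x + z) - \<phi> (x - z)\<bar> \<le> C * (norm z)\<^sup>2"
proof -
  have lip: "\<exists>L\<ge>0. \<forall>x z. \<bar>\<psi> (x + z) - \<psi> x\<bar> \<le> L * norm z" if \<psi>: "test_function \<psi>" for \<psi> :: "'a \<Rightarrow> real"
  proof -
    have "\<forall>b\<in>Basis. \<exists>B\<ge>0. \<forall>x. \<bar>partial_deriv b \<psi> x\<bar> \<le> B"
      using test_function_bounded[OF test_function_partial_deriv[OF \<psi>]] by blast
    then obtain B where B: "\<And>b. b \<in> Basis \<Longrightarrow> B b \<ge> 0 \<and> (\<forall>x. \<bar>partial_deriv b \<psi> x\<bar> \<le> B b)"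
      by metis
    have le: "\<bar>partial_deriv b \<psi> x\<bar> \<le> (\<Sum>b\<in>Basis. B b)" if "b \<in> Basis" for b x
      using B that member_le_sum[of b Basis B] by (meson DiffD1 finite_Basis order_trans)
    have S: "(\<Sum>b\<in>Basis. B b) \<ge> 0" using B by (simp add: sum_nonneg)
    have "\<bar>\<psi> (x + z) - \<psi> x - (\<Sum>b\<in>Basis. (z \<bullet> b) * 0)\<bar> \<le> real DIM('a) * ((\<Sum>b\<in>Basis. B b) * (real DIM('a) + 1) ^ 0) * norm z ^ Suc 0" for x z
      by (rule test_function_taylor1[OF \<psi> _ S]) (use le in simp)
    then show ?thesis using S
      by (intro exI[of _ "DIM('a) * (\<Sum>b\<in>Basis. B b)"]) simp
  qed
  have "\<forall>b\<in>Basis. \<exists>L\<ge>0. \<forall>x z. \<bar>partial_deriv b \<phi> (x + z) - partial_deriv b \<phi> x\<bar> \<le> L * norm z"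
    using lip[OF test_function_partial_deriv[OF \<phi>]] by blast
  then obtain L where L: "\<And>b. b \<in> Basis \<Longrightarrow> L b \<ge> 0 \<and> (\<forall>x z. \<bar>partial_deriv b \<phi> (x + z) - partial_deriv b \<phi> x\<bar> \<le> L b * norm z)"
    by metis
  have S: "(\<Sum>b\<in>Basis. L b) \<ge> 0" using L by (simp add: sum_nonneg)
  have le: "\<bar>partial_deriv b \<phi> (x + z) - partial_deriv b \<phi> x\<bar> \<le> (\<Sum>b\<in>Basis. L b) * norm z ^ 1" if b: "b \<in> Basis" for b x z
  proof -
    have "\<bar>partial_deriv b \<phi> (x + z) - partial_deriv b \<phi> x\<bar> \<le> L b * norm z" using L[OF b] by blast
    also have "\<dots> \<le> (\<Sum>b\<in>Basis. L b) * norm z"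
      using L b by (intro mult_right_mono member_le_sum) auto
    finally show ?thesis by simp
  qed
  define C where "C = real DIM('a) * ((\<Sum>b\<in>Basis. L b) * (real DIM('a) + 1) ^ 1)"
  have C: "C \<ge> 0" unfolding C_def using S by simp
  have T: "\<bar>\<phi> (x + z) - \<phi> x - (\<Sum>b\<in>Basis. (z \<bullet> b) * partial_deriv b \<phi> x)\<bar> \<le> C * norm z ^ Suc 1" for x z
    unfolding C_def by (rule test_function_taylor1[OF \<phi> le S])
  have "\<bar>2 * \<phi> x - \<phi> (x + z) - \<phi> (x - z)\<bar> \<le> 2 * C * (norm z)\<^sup>2" for x z
    using T[of x z] T[of x "- z"] by (simp add: sum_negf power2_eq_square)
  with C show ?thesis by (intro exI[of _ "2 * C"]) auto
qed

text \<open>Difference quotients have integral 0 by translation invariance, and they converge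
  boundedly on a fixed ball.\<close>

lemma integral_partial_derivative_eq_0:
  fixes F F' :: "'a::euclidean_space \<Rightarrow> real"
  assumes b: "norm b = 1"
    and deriv: "\<And>x h. ((\<lambda>h. F (x + h *\<^sub>R b)) has_real_derivative F' (x + h *\<^sub>R b)) (at h)"
    and cont: "continuous_on UNIV F" "continuous_on UNIV F'"
    and supp: "\<And>x. norm x > \<rho> \<Longrightarrow> F x = 0" "\<And>x. norm x > \<rho> \<Longrightarrow> F' x = 0"
  shows "(LINT x|lborel. F' x) = 0"
proof -
  obtain B where B: "B \<ge> 0" "\<And>x. \<bar>F' x\<bar> \<le> B"
    using continuous_supported_bounded[OF cont(2) supp(2)] by blast
  have [measurable]: "F \<in> borel_measurable borel" "F' \<in> borel_measurable borel"
    using cont by (auto intro: borel_measurable_continuous_onI)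
  let ?d = "\<lambda>n. inverse (real (Suc n))"
  have d: "0 < ?d n" "?d n \<le> 1" for n by (auto simp: inverse_eq_divide)
  have int: "integrable lborel F" by (rule continuous_supported_integrable[OF cont(1) supp(1)])
  let ?q = "\<lambda>n x. (F (x + ?d n *\<^sub>R b) - F x) / ?d n"
  have "(\<lambda>n. LINT x|lborel. ?q n x) \<longlonglongrightarrow> (LINT x|lborel. F' x)"
  proof (rule integral_dominated_convergence[where w = "\<lambda>x. B * indicator (cball 0 (\<rho> + 1)) x"])
    show "integrable lborel (\<lambda>x. B * indicator (cball (0::'a) (\<rho> + 1)) x)"
      by (intro integrable_mult_right integrable_real_indicator emeasure_bounded_finite) auto
    show "AE x in lborel. (\<lambda>n. ?q n x) \<longlonglongrightarrow> F' x"
    proof (intro always_eventually allI)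
      fix x
      have "((\<lambda>h. (F (x + (0 + h) *\<^sub>R b) - F (x + 0 *\<^sub>R b)) / h) \<longlongrightarrow> F' (x + 0 *\<^sub>R b)) (at 0)"
        using deriv[of x 0] unfolding DERIV_def .
      moreover have "filterlim ?d (at 0) sequentially"
        unfolding filterlim_at using LIMSEQ_inverse_real_of_nat by auto
      ultimately have "(\<lambda>n. (F (x + (0 + ?d n) *\<^sub>R b) - F (x + 0 *\<^sub>R b)) / ?d n) \<longlonglongrightarrow> F' (x + 0 *\<^sub>R b)"
        by (rule filterlim_compose)
      then show "(\<lambda>n. ?q n x) \<longlonglongrightarrow> F' x" by simp
    qed
    show "AE x in lborel. norm (?q n x) \<le> B * indicator (cball 0 (\<rho> + 1)) x" for n
    proof (intro always_eventually allI)
      fix x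
      obtain k where k: "\<bar>k\<bar> \<le> \<bar>?d n\<bar>" "F (x + ?d n *\<^sub>R b) - F x = ?d n * F' (x + k *\<^sub>R b)"
        using mvt_line[OF deriv] by blast
      have q: "?q n x = F' (x + k *\<^sub>R b)" unfolding k(2) using d(1)[of n] by simp
      show "norm (?q n x) \<le> B * indicator (cball 0 (\<rho> + 1)) x"
      proof (cases "norm x \<le> \<rho> + 1")
        case True
        then show ?thesis unfolding q using B by simp
      next
        case False
        have "\<bar>k\<bar> \<le> 1" using k(1) d[of n] by linarith
        then have "norm (k *\<^sub>R b) \<le> 1" using b by simp
        then have "norm (x + k *\<^sub>R b) > \<rho>"
          using False norm_triangle_ineq2[of x "- (k *\<^sub>R b)"] by simp
        then show ?thesis unfolding q using supp(2) B by simp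
      qed
    qed
  qed measurable
  moreover have "(LINT x|lborel. ?q n x) = 0" for n
  proof -
    have shift: "(\<lambda>x. F (x + ?d n *\<^sub>R b)) = (\<lambda>x. F (?d n *\<^sub>R b + 1 *\<^sub>R x))" by (simp add: add.commute)
    have "integrable lborel (\<lambda>x. F (x + ?d n *\<^sub>R b))"
      unfolding shift by (subst integrable_affine_unit_iff) (use int in auto)
    moreover have "(LINT x|lborel. F (x + ?d n *\<^sub>R b)) = (LINT x|lborel. F x)"
      unfolding shift by (rule integral_affine_unit) auto
    ultimately show ?thesis using int by simp
  qed
  ultimately show ?thesis using LIMSEQ_unique[of "\<lambda>_. 0"] by auto
qed

text \<open>Two integrations by parts at once: the integrand of the difference of both sides is
  the derivative in direction b of cos (\<xi> \<bullet> x) * partial_deriv b \<phi> x + (\<xi>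
  \<bullet> b) * sin (\<xi> \<bullet> x) * \<phi> x.\<close>

lemma cos_transform_second_derivative:
  fixes \<phi> :: "'a::euclidean_space \<Rightarrow> real"
  assumes \<phi>: "test_function \<phi>" and b: "b \<in> Basis"
  shows "cos_transform (partial_deriv b (partial_deriv b \<phi>)) \<xi> = - (\<xi> \<bullet> b)\<^sup>2 * cos_transform \<phi> \<xi>"
proof -
  let ?\<phi>1 = "partial_deriv b \<phi>" and ?\<phi>2 = "partial_deriv b (partial_deriv b \<phi>)"
  have \<phi>1: "test_function ?\<phi>1" by (rule test_function_partial_deriv[OF \<phi> b])
  have \<phi>2: "test_function ?\<phi>2" by (rule test_function_partial_deriv[OF \<phi>1 b])
  obtain r0 r1 r2 where r: "\<And>x. norm x > r0 \<Longrightarrow> \<phi> x = 0" "\<And>x. norm x > r1 \<Longrightarrow> ?\<phi>1 x = 0" "\<And>x. norm x > r2 \<Longrightarrow> ?\<phi>2 x = 0"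
    using test_function_support[OF \<phi>] test_function_support[OF \<phi>1] test_function_support[OF \<phi>2] by metis
  define \<rho> where "\<rho> = max r0 (max r1 r2)"
  \<comment> \<open>In the derivative of this function the mixed terms with sin and the first derivative cancel.\<close>
  let ?F = "\<lambda>x. cos (\<xi> \<bullet> x) * ?\<phi>1 x + (\<xi> \<bullet> b) * sin (\<xi> \<bullet> x) * \<phi> x"
  let ?F' = "\<lambda>x. cos (\<xi> \<bullet> x) * ?\<phi>2 x + (\<xi> \<bullet> b)\<^sup>2 * (cos (\<xi> \<bullet> x) * \<phi> x)"
  have "(LINT x|lborel. ?F' x) = 0"
  proof (rule integral_partial_derivative_eq_0[of b ?F])
    show "norm b = 1" using b by simp
    show "((\<lambda>h. ?F (x + h *\<^sub>R b)) has_real_derivative ?F' (x + h *\<^sub>R b)) (at h)" for x h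
      by (rule derivative_eq_intros test_function_deriv[OF \<phi> b] test_function_deriv[OF \<phi>1 b] refl
          | simp add: inner_add_right)+
         (simp add: algebra_simps power2_eq_square)
    show "continuous_on UNIV ?F" "continuous_on UNIV ?F'"
      by (intro continuous_intros test_function_continuous \<phi> \<phi>1 \<phi>2)+
    show "?F x = 0" "?F' x = 0" if "norm x > \<rho>" for x
      using that r by (auto simp: \<rho>_def)
  qed
  moreover have "(LINT x|lborel. ?F' x) = cos_transform ?\<phi>2 \<xi> + (\<xi> \<bullet> b)\<^sup>2 * cos_transform \<phi> \<xi>"
    unfolding cos_transform_def
    using integrable_cos_mult[OF test_function_integrable[OF \<phi>2], of \<xi>] integrable_cos_mult[OF test_function_integrable[OF \<phi>], of \<xi>]
    by simp
  ultimately show ?thesis by simp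
qed

lemma cos_transform_laplacian:
  fixes \<phi> :: "'a::euclidean_space \<Rightarrow> real"
  assumes \<phi>: "test_function \<phi>"
  shows "integrable lborel (laplacian \<phi>)" "\<exists>B\<ge>0. \<forall>x. \<bar>laplacian \<phi> x\<bar> \<le> B"
    "cos_transform (laplacian \<phi>) \<xi> = - (norm \<xi>)\<^sup>2 * cos_transform \<phi> \<xi>"
proof -
  let ?d = "\<lambda>b. partial_deriv b (partial_deriv b \<phi>)"
  have d: "test_function (?d b)" if "b \<in> Basis" for b
    by (intro test_function_partial_deriv \<phi> that)
  have lap: "laplacian \<phi> = (\<lambda>x. \<Sum>b\<in>Basis. ?d b x)" by (simp add: fun_eq_iff laplacian_def)
  show "integrable lborel (laplacian \<phi>)"
    unfolding lap by (intro Bochner_Integration.integrable_sum test_function_integrable d)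
  obtain B where B: "\<And>b. b \<in> Basis \<Longrightarrow> B b \<ge> 0 \<and> (\<forall>x. \<bar>?d b x\<bar> \<le> B b)"
    using test_function_bounded[OF d] by metis
  show "\<exists>B\<ge>0. \<forall>x. \<bar>laplacian \<phi> x\<bar> \<le> B"
    unfolding lap
    by (intro exI[of _ "\<Sum>b\<in>Basis. B b"] conjI allI sum_nonneg order_trans[OF sum_abs] sum_mono) (use B in auto)
  have "cos_transform (laplacian \<phi>) \<xi> = (\<Sum>b\<in>Basis. cos_transform (?d b) \<xi>)"
    unfolding lap cos_transform_def sum_distrib_left
    by (rule Bochner_Integration.integral_sum) (intro integrable_cos_mult test_function_integrable d)
  also have "\<dots> = - (\<Sum>b\<in>Basis. (\<xi> \<bullet> b)\<^sup>2) * cos_transform \<phi> \<xi>"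
    by (simp add: cos_transform_second_derivative[OF \<phi>] sum_distrib_right flip: sum_negf)
  also have "(\<Sum>b\<in>Basis. (\<xi> \<bullet> b)\<^sup>2) = (norm \<xi>)\<^sup>2"
    unfolding power2_norm_eq_inner by (simp add: power2_eq_square euclidean_inner[of \<xi> \<xi>])
  finally show "cos_transform (laplacian \<phi>) \<xi> = - (norm \<xi>)\<^sup>2 * cos_transform \<phi> \<xi>" .
qed

section \<open>The fractional Laplacian of a test function\<close>

text \<open>The kernel of the fractional Laplacian. Its value 0 at the origin is harmless because
  it is always multiplied by a function that vanishes there.\<close>

definition jump_kernel :: "real \<Rightarrow> 'a::euclidean_space \<Rightarrow> real" where
  "jump_kernel s z = norm z powr (- (real DIM('a) + 2 * s))"

lemma jump_kernel_eq: "jump_kernel s (z::'a::euclidean_space) = 1 / norm z powr (real DIM('a) + 2 * s)"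
  unfolding jump_kernel_def powr_minus_divide ..

lemma gauss_power_cancel:
  fixes v a s :: real
  assumes "v > 0"
  shows "v powr (a + s - 1) * ((pi / v) powr a * c) = pi powr a * (c * v powr (s - 1))"
proof -
  have "v powr (a + s - 1) = v powr a * v powr (s - 1)"
    using assms by (simp add: algebra_simps flip: powr_add)
  moreover have "(pi / v) powr a = pi powr a / v powr a"
    by (rule powr_divide)
  ultimately show ?thesis using assms by simp
qed

lemma jump_kernel_nonneg: "0 \<le> jump_kernel s z"
  by (simp add: jump_kernel_def)

lemma borel_measurable_jump_kernel [measurable]: "jump_kernel s \<in> borel_measurable borel"
  unfolding jump_kernel_def[abs_def] by measurable

text \<open>A negative power of the norm is a mixture of Gaussians, by the Gamma integral. This
  replaces polar coordinates in all integrals against the kernel.\<close>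

lemma nn_integral_mult_jump_kernel:
  fixes f :: "'a::euclidean_space \<Rightarrow> real"
  assumes [measurable]: "f \<in> borel_measurable borel" and f: "\<And>z. 0 \<le> f z" "f 0 = 0" and s: "s > 0"
  shows "(\<integral>\<^sup>+z. ennreal (f z * jump_kernel s z) \<partial>lborel)
    = ennreal (1 / Gamma (real DIM('a) / 2 + s)) * (\<integral>\<^sup>+v. ennreal (indicator {0<..} v * v powr (real DIM('a) / 2 + s - 1)) *
        (\<integral>\<^sup>+z. ennreal (f z * exp (- v * (norm z)\<^sup>2)) \<partial>lborel) \<partial>lborel)"
proof -
  let ?p = "DIM('a) / 2 + s"
  have p: "?p > 0" using s by (simp add: add_nonneg_pos)
  let ?k = "\<lambda>z v. ennreal (f z) * ennreal (indicator {0<..} v * (v powr (?p - 1) * exp (- (norm z)\<^sup>2 * v)))"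
  have G: "Gamma ?p > 0" using p by simp
  have "ennreal (f z * jump_kernel s z) = ennreal (1 / Gamma ?p) * (\<integral>\<^sup>+v. ?k z v \<partial>lborel)" for z
  proof (cases "z = 0")
    case False
    have "(\<integral>\<^sup>+v. ?k z v \<partial>lborel) = ennreal (f z) * ennreal (Gamma ?p / ((norm z)\<^sup>2) powr ?p)"
      using False p by (subst nn_integral_cmult, simp, subst nn_integral_Gamma_scaled) auto
    also have "\<dots> = ennreal (f z * (Gamma ?p / ((norm z)\<^sup>2) powr ?p))"
      using f by (intro ennreal_mult'[symmetric]) auto
    finally have "ennreal (1 / Gamma ?p) * (\<integral>\<^sup>+v. ?k z v \<partial>lborel) = ennreal (1 / Gamma ?p * (f z * (Gamma ?p / ((norm z)\<^sup>2) powr ?p)))"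
      using G by (simp only:) (intro ennreal_mult'[symmetric], simp)
    also have "1 / Gamma ?p * (f z * (Gamma ?p / ((norm z)\<^sup>2) powr ?p)) = f z * jump_kernel s z"
    proof -
      have "((norm z)\<^sup>2) powr ?p = norm z powr (real DIM('a) + 2 * s)"
        using False by (simp add: powr_powr flip: powr_numeral)
      then show ?thesis using less_imp_neq[OF G] by (simp add: jump_kernel_eq)
    qed
    finally show ?thesis by simp
  qed (simp add: f)
  then have "(\<integral>\<^sup>+z. ennreal (f z * jump_kernel s z) \<partial>lborel) = ennreal (1 / Gamma ?p) * (\<integral>\<^sup>+z. \<integral>\<^sup>+v. ?k z v \<partial>lborel \<partial>lborel)"
    by (simp only:) (rule nn_integral_cmult, measurable)
  also have "(\<integral>\<^sup>+z. \<integral>\<^sup>+v. ?k z v \<partial>lborel \<partial>lborel) = (\<integral>\<^sup>+v. \<integral>\<^sup>+z. ?k z v \<partial>lborel \<partial>lborel)"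
    by (rule lborel_pair.Fubini') measurable
  also have "\<dots> = (\<integral>\<^sup>+v. ennreal (indicator {0<..} v * v powr (?p - 1)) *
        (\<integral>\<^sup>+z. ennreal (f z * exp (- v * (norm z)\<^sup>2)) \<partial>lborel) \<partial>lborel)"
  proof (rule nn_integral_cong)
    fix v :: real
    have "?k z v = ennreal (indicator {0<..} v * v powr (?p - 1)) * ennreal (f z * exp (- v * (norm z)\<^sup>2))" for z
      using f by (simp add: mult_ac flip: ennreal_mult'')
    then show "(\<integral>\<^sup>+z. ?k z v \<partial>lborel) = ennreal (indicator {0<..} v * v powr (?p - 1)) *
        (\<integral>\<^sup>+z. ennreal (f z * exp (- v * (norm z)\<^sup>2)) \<partial>lborel)"
      by (simp only:) (rule nn_integral_cmult, measurable)
  qed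
  finally show ?thesis .
qed

lemma nn_integral_one_minus_cos_gauss:
  fixes \<xi> :: "'a::euclidean_space"
  assumes v: "v > 0"
  shows "(\<integral>\<^sup>+z. ennreal ((1 - cos (\<xi> \<bullet> z)) * exp (- v * (norm z)\<^sup>2)) \<partial>lborel)
    = ennreal ((pi / v) powr (real DIM('a) / 2) * (1 - exp (- ((norm \<xi>)\<^sup>2 / 4) / v)))"
proof -
  have "has_bochner_integral lborel (\<lambda>z. exp (- v * (norm z)\<^sup>2) - cos (\<xi> \<bullet> z) * exp (- v * (norm z)\<^sup>2))
     ((pi / v) powr (real DIM('a) / 2) - (pi / v) powr (real DIM('a) / 2) * exp (- (norm \<xi>)\<^sup>2 / (4 * v)))"
    by (intro has_bochner_integral_diff gaussian_integral gaussian_fourier v)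
  then have "has_bochner_integral lborel (\<lambda>z. (1 - cos (\<xi> \<bullet> z)) * exp (- v * (norm z)\<^sup>2))
     ((pi / v) powr (real DIM('a) / 2) * (1 - exp (- ((norm \<xi>)\<^sup>2 / 4) / v)))"
    by (simp add: algebra_simps)
  then show ?thesis
    by (subst nn_integral_eq_integral) (auto simp: has_bochner_integral_iff)
qed

text \<open>Gamma (- s) is negative for 0 < s < 1, and Gamma (1 - s) = - s * Gamma (- s).\<close>

lemma frac_laplacian_const_pos:
  fixes s :: real
  assumes "0 < s" "s < 1"
  shows "frac_laplacian_const n s > 0"
    and "1 / frac_laplacian_const n s = pi powr (real n / 2) / (Gamma (real n / 2 + s) * 4 powr s) * (Gamma (1 - s) / s)"
proof -
  have "- s \<notin> \<int>\<^sub>\<le>\<^sub>0"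
  proof
    assume "- s \<in> \<int>\<^sub>\<le>\<^sub>0"
    then have "s \<in> \<int>" by (metis Ints_minus add.inverse_inverse nonpos_Ints_Int)
    with assms show False by (auto elim!: Ints_cases)
  qed
  then have "Gamma (- s + 1) = - s * Gamma (- s)" by (rule Gamma_plus1)
  then have 1: "Gamma (1 - s) = - s * Gamma (- s)" by simp
  moreover have "Gamma (1 - s) > 0" using assms by simp
  ultimately have "Gamma (- s) < 0" using assms by (auto simp: mult_less_0_iff zero_less_mult_iff)
  then have abs: "\<bar>Gamma (- s)\<bar> = Gamma (1 - s) / s" "\<bar>Gamma (- s)\<bar> > 0" using 1 assms by auto
  have G: "Gamma (s + real n / 2) > 0" using assms by (intro Gamma_real_pos) (simp add: add_pos_nonneg)
  show "frac_laplacian_const n s > 0"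
    unfolding frac_laplacian_const_def using G abs(2) by (intro divide_pos_pos mult_pos_pos) auto
  have "(2::real) powr (2 * s) = 4 powr s"
    by (simp flip: powr_powr)
  then show "1 / frac_laplacian_const n s = pi powr (real n / 2) / (Gamma (real n / 2 + s) * 4 powr s) * (Gamma (1 - s) / s)"
    unfolding frac_laplacian_const_def abs(1) by (simp add: add.commute mult_ac)
qed

text \<open>This determines the constant of the fractional Laplacian: after
  nn_integral_mult_jump_kernel the inner integral is a Gaussian one, and the outer one is
  nn_integral_levy_inverse.\<close>

lemma nn_integral_one_minus_cos_jump_kernel:
  fixes \<xi> :: "'a::euclidean_space"
  assumes s: "0 < s" "s < 1"
  shows "(\<integral>\<^sup>+z. ennreal ((1 - cos (\<xi> \<bullet> z)) * jump_kernel s z) \<partial>lborel) = ennreal (norm \<xi> powr (2 * s) / frac_laplacian_const DIM('a) s)"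
proof -
  let ?a = "real DIM('a) / 2"
  let ?l = "(norm \<xi>)\<^sup>2 / 4"
  have G: "Gamma (?a + s) > 0" using s by (intro Gamma_real_pos) (simp add: add_nonneg_pos)
  have "(\<integral>\<^sup>+z. ennreal ((1 - cos (\<xi> \<bullet> z)) * jump_kernel s z) \<partial>lborel)
    = ennreal (1 / Gamma (?a + s)) * (\<integral>\<^sup>+v. ennreal (indicator {0<..} v * v powr (?a + s - 1)) *
        (\<integral>\<^sup>+z. ennreal ((1 - cos (\<xi> \<bullet> z)) * exp (- v * (norm z)\<^sup>2)) \<partial>lborel) \<partial>lborel)"
    by (rule nn_integral_mult_jump_kernel) (use s in auto)
  also have "(\<integral>\<^sup>+v. ennreal (indicator {0<..} v * v powr (?a + s - 1)) *
        (\<integral>\<^sup>+z. ennreal ((1 - cos (\<xi> \<bullet> z)) * exp (- v * (norm z)\<^sup>2)) \<partial>lborel) \<partial>lborel)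
     = (\<integral>\<^sup>+v. ennreal (pi powr ?a) * ennreal (indicator {0<..} v * ((1 - exp (- ?l / v)) * v powr (s - 1))) \<partial>lborel)"
  proof (rule nn_integral_cong)
    fix v :: real
    show "ennreal (indicator {0<..} v * v powr (?a + s - 1)) *
        (\<integral>\<^sup>+z. ennreal ((1 - cos (\<xi> \<bullet> z)) * exp (- v * (norm z)\<^sup>2)) \<partial>lborel)
      = ennreal (pi powr ?a) * ennreal (indicator {0<..} v * ((1 - exp (- ?l / v)) * v powr (s - 1)))"
    proof (cases "v > 0")
      case True
      have "v powr (?a + s - 1) * ((pi / v) powr ?a * (1 - exp (- ?l / v))) = pi powr ?a * ((1 - exp (- ?l / v)) * v powr (s - 1))"
        by (rule gauss_power_cancel[OF True])
      then show ?thesis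
        unfolding nn_integral_one_minus_cos_gauss[OF True]
        using True by (simp flip: ennreal_mult')
    qed simp
  qed
  also have "\<dots> = ennreal (pi powr ?a) * ennreal (?l powr s * (Gamma (1 - s) / s))"
    by (subst nn_integral_cmult, measurable, subst nn_integral_levy_inverse) (use s in auto)
  also have "ennreal (1 / Gamma (?a + s)) * (ennreal (pi powr ?a) * ennreal (?l powr s * (Gamma (1 - s) / s)))
     = ennreal (1 / Gamma (?a + s) * (pi powr ?a * (?l powr s * (Gamma (1 - s) / s))))"
    using G by (subst ennreal_mult'[symmetric], simp, subst ennreal_mult'[symmetric], simp_all)
  also have "1 / Gamma (?a + s) * (pi powr ?a * (?l powr s * (Gamma (1 - s) / s)))
     = ?l powr s * 4 powr s * (1 / frac_laplacian_const DIM('a) s)"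
    unfolding frac_laplacian_const_pos(2)[OF s] by simp
  also have "?l powr s * 4 powr s = norm \<xi> powr (2 * s)"
    by (cases "\<xi> = 0") (simp_all add: powr_divide powr_powr flip: powr_numeral)
  finally show ?thesis by simp
qed

lemma has_bochner_integral_one_minus_cos_jump_kernel:
  fixes \<xi> :: "'a::euclidean_space"
  assumes s: "0 < s" "s < 1"
  shows "has_bochner_integral lborel (\<lambda>z. (1 - cos (\<xi> \<bullet> z)) * jump_kernel s z) (norm \<xi> powr (2 * s) / frac_laplacian_const DIM('a) s)"
  by (rule has_bochner_integral_nn_integral[OF _ _ _ nn_integral_one_minus_cos_jump_kernel[OF s]])
     (use frac_laplacian_const_pos(1)[OF s, of "DIM('a)"] in \<open>auto simp: jump_kernel_nonneg\<close>)

text \<open>The function 1 - exp (- (norm z)^2) is a smooth substitute for the minimum of (norm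
  z)^2 and 1, with explicit Gaussian integrals. It dominates second differences of test functions
  and serves as the majorant in every convergence statement for the fractional Laplacian.\<close>

lemma integrable_one_minus_gauss_jump_kernel:
  assumes s: "0 < s" "s < 1"
  shows "integrable lborel (\<lambda>z::'a::euclidean_space. (1 - exp (- (norm z)\<^sup>2)) * jump_kernel s z)"
proof (rule integrableI_nonneg)
  let ?a = "real DIM('a) / 2"
  have a: "?a > 0" by simp
  have "(\<integral>\<^sup>+z. ennreal ((1 - exp (- (norm (z::'a))\<^sup>2)) * jump_kernel s z) \<partial>lborel)
    = ennreal (1 / Gamma (?a + s)) * (\<integral>\<^sup>+v. ennreal (indicator {0<..} v * v powr (?a + s - 1)) *
        (\<integral>\<^sup>+z. ennreal ((1 - exp (- (norm (z::'a))\<^sup>2)) * exp (- v * (norm z)\<^sup>2)) \<partial>lborel) \<partial>lborel)"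
    by (rule nn_integral_mult_jump_kernel) (use s in auto)
  also have "\<dots> \<le> ennreal (1 / Gamma (?a + s)) * (\<integral>\<^sup>+v. ennreal (pi powr ?a) * ennreal (indicator {0<..} v * ((1 - exp (- ?a / v)) * v powr (s - 1))) \<partial>lborel)"
  proof (intro mult_left_mono nn_integral_mono)
    fix v :: real
    show "ennreal (indicator {0<..} v * v powr (?a + s - 1)) *
        (\<integral>\<^sup>+z. ennreal ((1 - exp (- (norm (z::'a))\<^sup>2)) * exp (- v * (norm z)\<^sup>2)) \<partial>lborel)
      \<le> ennreal (pi powr ?a) * ennreal (indicator {0<..} v * ((1 - exp (- ?a / v)) * v powr (s - 1)))"
    proof (cases "v > 0")
      case True
      have "has_bochner_integral lborel (\<lambda>z::'a. exp (- v * (norm z)\<^sup>2) - exp (- (v + 1) * (norm z)\<^sup>2))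
         ((pi / v) powr ?a - (pi / (v + 1)) powr ?a)"
        using True by (intro has_bochner_integral_diff gaussian_integral) auto
      then have I: "has_bochner_integral lborel (\<lambda>z::'a. (1 - exp (- (norm z)\<^sup>2)) * exp (- v * (norm z)\<^sup>2))
         ((pi / v) powr ?a - (pi / (v + 1)) powr ?a)"
        by (simp add: algebra_simps flip: exp_add)
      \<comment> \<open>The mixture over v must be integrable at infinity; the estimate (1 + 1/v)^a \<le> exp (a/v) brings it to the
             form of the Levy integral.\<close>
      have "(pi / v) powr ?a * exp (- ?a / v) \<le> (pi / (v + 1)) powr ?a"
      proof -
        have "(v + 1) / v \<le> exp (1 / v)" using True exp_ge_add_one_self[of "1 / v"] by (simp add: field_simps)
        then have "((v + 1) / v) powr ?a \<le> exp (1 / v) powr ?a"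
          using True by (intro powr_mono2) auto
        then have "((v + 1) / v) powr ?a \<le> exp (?a / v)" by (simp add: powr_def)
        then have "(v + 1) powr ?a \<le> v powr ?a * exp (?a / v)"
          using True by (simp add: powr_divide field_simps)
        then show ?thesis using True
          by (simp add: powr_divide exp_minus field_simps)
      qed
      then have "(pi / v) powr ?a - (pi / (v + 1)) powr ?a \<le> (pi / v) powr ?a * (1 - exp (- ?a / v))"
        by (simp add: right_diff_distrib)
      then have "v powr (?a + s - 1) * ((pi / v) powr ?a - (pi / (v + 1)) powr ?a) \<le> v powr (?a + s - 1) * ((pi / v) powr ?a * (1 - exp (- ?a / v)))"
        by (rule mult_left_mono) simp
      also have "\<dots> = pi powr ?a * ((1 - exp (- ?a / v)) * v powr (s - 1))"
        by (rule gauss_power_cancel[OF True])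
      finally have le: "v powr (?a + s - 1) * ((pi / v) powr ?a - (pi / (v + 1)) powr ?a) \<le> pi powr ?a * ((1 - exp (- ?a / v)) * v powr (s - 1))" .
      have "(\<integral>\<^sup>+z. ennreal ((1 - exp (- (norm (z::'a))\<^sup>2)) * exp (- v * (norm z)\<^sup>2)) \<partial>lborel) = ennreal ((pi / v) powr ?a - (pi / (v + 1)) powr ?a)"
        using I by (subst nn_integral_eq_integral) (auto simp: has_bochner_integral_iff)
      then show ?thesis
        using True le by (simp add: ennreal_leI flip: ennreal_mult')
    qed simp
  qed simp
  also have "\<dots> = ennreal (1 / Gamma (?a + s)) * (ennreal (pi powr ?a) * ennreal (?a powr s * (Gamma (1 - s) / s)))"
    by (subst nn_integral_cmult, measurable, subst nn_integral_levy_inverse) (use s in auto)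
  also have "\<dots> < \<infinity>" by (simp add: ennreal_mult_less_top)
  finally show "(\<integral>\<^sup>+z. ennreal ((1 - exp (- (norm (z::'a))\<^sup>2)) * jump_kernel s z) \<partial>lborel) < \<infinity>" .
qed (auto simp: jump_kernel_nonneg)

lemma min_le_one_minus_exp:
  fixes u :: real
  assumes "u \<ge> 0"
  shows "min u 1 \<le> 2 * (1 - exp (- u))"
proof -
  have "1 + u \<le> exp u" by (rule exp_ge_add_one_self)
  then have "exp (- u) \<le> 1 / (1 + u)" using assms by (simp add: exp_minus field_simps)
  moreover have "min u 1 \<le> 2 * (1 - 1 / (1 + u))"
    using assms by (cases "u \<le> 1") (auto simp: field_simps power2_eq_square intro: mult_left_le)
  moreover have "2 * (1 - 1 / (1 + u)) \<le> 2 * (1 - exp (- u))"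
    using \<open>exp (- u) \<le> 1 / (1 + u)\<close> by simp
  ultimately show ?thesis by (blast intro: order_trans)
qed

definition second_diff :: "('a::euclidean_space \<Rightarrow> real) \<Rightarrow> 'a \<Rightarrow> 'a \<Rightarrow> real" where
  "second_diff \<phi> z x = 2 * \<phi> x - \<phi> (x + z) - \<phi> (x - z)"

lemma borel_measurable_second_diff [measurable]:
  fixes \<phi> :: "'a::euclidean_space \<Rightarrow> real"
  assumes [measurable]: "\<phi> \<in> borel_measurable borel"
  shows "(\<lambda>(z, x). second_diff \<phi> z x) \<in> borel_measurable (borel \<Otimes>\<^sub>M borel)"
  unfolding second_diff_def by measurable

lemma second_diff_bound:
  fixes \<phi> :: "'a::euclidean_space \<Rightarrow> real"
  assumes \<phi>: "test_function \<phi>"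
  shows "\<exists>C\<ge>0. \<forall>z x. \<bar>second_diff \<phi> z x\<bar> \<le> C * (1 - exp (- (norm z)\<^sup>2))"
proof -
  obtain C where C: "C \<ge> 0" "\<And>x z. \<bar>second_diff \<phi> z x\<bar> \<le> C * (norm z)\<^sup>2"
    using test_function_second_difference[OF \<phi>] unfolding second_diff_def by blast
  obtain B where B: "B \<ge> 0" "\<And>x. \<bar>\<phi> x\<bar> \<le> B"
    using test_function_bounded[OF \<phi>] by blast
  have "\<bar>second_diff \<phi> z x\<bar> \<le> (2 * (C + 4 * B)) * (1 - exp (- (norm z)\<^sup>2))" for z x
  proof -
    have "\<bar>second_diff \<phi> z x\<bar> \<le> 4 * B"
      using B(2)[of x] B(2)[of "x + z"] B(2)[of "x - z"] unfolding second_diff_def by linarith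
    then have "\<bar>second_diff \<phi> z x\<bar> \<le> (C + 4 * B) * min ((norm z)\<^sup>2) 1"
      using C(2)[of z x] C(1) B(1) by (auto simp: min_def distrib_right intro: order_trans add_increasing add_increasing2)
    also have "\<dots> \<le> (C + 4 * B) * (2 * (1 - exp (- (norm z)\<^sup>2)))"
      using C(1) B(1) by (intro mult_left_mono min_le_one_minus_exp) auto
    finally show ?thesis by (simp add: algebra_simps)
  qed
  then show ?thesis using C(1) B(1) by (intro exI[of _ "2 * (C + 4 * B)"]) auto
qed

lemma integral_shift:
  fixes f :: "'a::euclidean_space \<Rightarrow> real"
  assumes f: "integrable lborel f"
  shows "has_bochner_integral lborel (\<lambda>x. f (x + z)) (LINT x|lborel. f x)"
proof -
  have [measurable]: "f \<in> borel_measurable borel" using f by auto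
  have eq: "(\<lambda>x. f (x + z)) = (\<lambda>x. f (z + 1 *\<^sub>R x))" by (simp add: add.commute)
  show ?thesis
    unfolding eq has_bochner_integral_iff
    by (subst integrable_affine_unit_iff, simp, simp, subst integral_affine_unit) (use f in auto)
qed

text \<open>For norm z \<le> 1 the second difference is small and supported in a fixed ball; for
  larger z the L1 norm is bounded by translation invariance.\<close>

lemma second_diff_integral_bound:
  fixes \<phi> :: "'a::euclidean_space \<Rightarrow> real"
  assumes \<phi>: "test_function \<phi>"
  shows "\<And>z. integrable lborel (second_diff \<phi> z)"
    and "\<exists>C\<ge>0. \<forall>z. (LINT x|lborel. \<bar>second_diff \<phi> z x\<bar>) \<le> C * (1 - exp (- (norm z)\<^sup>2))"
proof -
  note int = test_function_integrable[OF \<phi>]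
  have plus: "integrable lborel (\<lambda>x. \<phi> (x + z))" for z
    using integral_shift[OF int] by (rule integrable.intros)
  have minus: "integrable lborel (\<lambda>x. \<phi> (x - z))" for z
    using plus[of "- z"] by simp
  show sd: "integrable lborel (second_diff \<phi> z)" for z
    unfolding second_diff_def[abs_def]
    by (intro Bochner_Integration.integrable_diff integrable_mult_right plus minus int)
  obtain C where C: "C \<ge> 0" "\<And>z x. \<bar>second_diff \<phi> z x\<bar> \<le> C * (1 - exp (- (norm z)\<^sup>2))"
    using second_diff_bound[OF \<phi>] by blast
  obtain \<rho> where \<rho>: "\<rho> > 0" "\<And>x. norm x > \<rho> \<Longrightarrow> \<phi> x = 0"
    using test_function_support[OF \<phi>] by blast
  let ?V = "measure lborel (cball (0::'a) (\<rho> + 1))"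
  let ?N = "LINT x|lborel. \<bar>\<phi> x\<bar>"
  have N: "?N \<ge> 0" by simp
  have "(LINT x|lborel. \<bar>second_diff \<phi> z x\<bar>) \<le> (C * ?V + 8 * ?N) * (1 - exp (- (norm z)\<^sup>2))" for z
  proof (cases "norm z \<le> 1")
    case True
    have "(LINT x|lborel. \<bar>second_diff \<phi> z x\<bar>) \<le> (LINT x|lborel. C * (1 - exp (- (norm z)\<^sup>2)) * indicator (cball (0::'a) (\<rho> + 1)) x)"
    proof (rule integral_mono)
      show "integrable lborel (\<lambda>x. C * (1 - exp (- (norm z)\<^sup>2)) * indicator (cball (0::'a) (\<rho> + 1)) x)"
        by (intro integrable_mult_right integrable_real_indicator emeasure_bounded_finite) auto
      show "\<bar>second_diff \<phi> z x\<bar> \<le> C * (1 - exp (- (norm z)\<^sup>2)) * indicator (cball 0 (\<rho> + 1)) x" for x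
      proof (cases "norm x \<le> \<rho> + 1")
        case True
        then show ?thesis using C(2) by simp
      next
        case False
        then have "norm (x + z) > \<rho>" "norm (x - z) > \<rho>" "norm x > \<rho>"
          using \<open>norm z \<le> 1\<close> norm_triangle_ineq2[of x z] norm_triangle_ineq2[of x "- z"] by auto
        then have "second_diff \<phi> z x = 0" using \<rho>(2) by (simp add: second_diff_def)
        then show ?thesis using C(1) by simp
      qed
    qed (use sd[of z] in auto)
    also have "\<dots> = C * (1 - exp (- (norm z)\<^sup>2)) * ?V" by simp
    also have "\<dots> \<le> (C * ?V + 8 * ?N) * (1 - exp (- (norm z)\<^sup>2))"
      using N by (simp add: algebra_simps mult_left_le)
    finally show ?thesis .
  next
    case False
    have "(LINT x|lborel. \<bar>second_diff \<phi> z x\<bar>) \<le> (LINT x|lborel. 2 * \<bar>\<phi> x\<bar> + \<bar>\<phi> (x + z)\<bar> + \<bar>\<phi> (x - z)\<bar>)"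
      by (rule integral_mono)
         (use sd[of z] int plus[of z] minus[of z] in \<open>auto simp: second_diff_def\<close>)
    also have "\<dots> = 2 * ?N + (LINT x|lborel. \<bar>\<phi> (x + z)\<bar>) + (LINT x|lborel. \<bar>\<phi> (x - z)\<bar>)"
      using int plus[of z] minus[of z] by simp
    also have "(LINT x|lborel. \<bar>\<phi> (x + z)\<bar>) = ?N"
      by (rule has_bochner_integral_integral_eq[OF integral_shift[OF integrable_abs[OF int]]])
    also have "(LINT x|lborel. \<bar>\<phi> (x - z)\<bar>) = ?N"
      using has_bochner_integral_integral_eq[OF integral_shift[OF integrable_abs[OF int], of "- z"]] by simp
    finally have "(LINT x|lborel. \<bar>second_diff \<phi> z x\<bar>) \<le> 4 * ?N * 1" by simp
    also have "\<dots> \<le> 4 * ?N * (2 * (1 - exp (- (norm z)\<^sup>2)))"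
    proof (rule mult_left_mono)
      have "1 \<le> (norm z)\<^sup>2" using False by (simp add: one_le_power)
      then show "1 \<le> 2 * (1 - exp (- (norm z)\<^sup>2))" using min_le_one_minus_exp[of "(norm z)\<^sup>2"] by simp
    qed (use N in auto)
    also have "\<dots> \<le> (C * ?V + 8 * ?N) * (1 - exp (- (norm z)\<^sup>2))"
    proof -
      have "0 \<le> C * ?V * (1 - exp (- (norm z)\<^sup>2))" using C(1) by simp
      then show ?thesis by (simp only: distrib_right mult.assoc)
    qed
    finally show ?thesis .
  qed
  then show "\<exists>C\<ge>0. \<forall>z. (LINT x|lborel. \<bar>second_diff \<phi> z x\<bar>) \<le> C * (1 - exp (- (norm z)\<^sup>2))"
    using C(1) N by (intro exI[of _ "C * ?V + 8 * ?N"]) auto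
qed

lemma integrable_second_diff_jump_kernel:
  fixes \<phi> :: "'a::euclidean_space \<Rightarrow> real"
  assumes s: "0 < s" "s < 1" and \<phi>: "test_function \<phi>"
  shows "integrable lborel (\<lambda>z. second_diff \<phi> z x * jump_kernel s z)"
proof -
  have [measurable]: "\<phi> \<in> borel_measurable borel" by (rule test_function_measurable[OF \<phi>])
  obtain C where C: "C \<ge> 0" "\<And>z x. \<bar>second_diff \<phi> z x\<bar> \<le> C * (1 - exp (- (norm z)\<^sup>2))"
    using second_diff_bound[OF \<phi>] by blast
  show ?thesis
  proof (rule Bochner_Integration.integrable_bound[OF integrable_mult_right[OF integrable_one_minus_gauss_jump_kernel[OF s], of C]])
    show "(\<lambda>z. second_diff \<phi> z x * jump_kernel s z) \<in> borel_measurable lborel"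
      unfolding second_diff_def by measurable
    show "AE z in lborel. norm (second_diff \<phi> z x * jump_kernel s z) \<le> norm (C * ((1 - exp (- (norm z)\<^sup>2)) * jump_kernel s z))"
    proof (intro always_eventually allI)
      fix z :: 'a
      have "\<bar>second_diff \<phi> z x\<bar> * jump_kernel s z \<le> (C * (1 - exp (- (norm z)\<^sup>2))) * jump_kernel s z"
        by (rule mult_right_mono[OF C(2) jump_kernel_nonneg])
      then show "norm (second_diff \<phi> z x * jump_kernel s z) \<le> norm (C * ((1 - exp (- (norm z)\<^sup>2)) * jump_kernel s z))"
        using C(1) by (simp add: abs_mult jump_kernel_nonneg mult.assoc)
    qed
  qed
qed

text \<open>The principal value becomes an absolutely convergent integral after averaging over z
  and - z.\<close>

definition symmetric_frac_laplacian :: "real \<Rightarrow> ('a::euclidean_space \<Rightarrow> real) \<Rightarrow> 'a \<Rightarrow> real" where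
  "symmetric_frac_laplacian s \<phi> x = (LINT z|lborel. second_diff \<phi> z x * jump_kernel s z)"

text \<open>Outside a ball the integral converges absolutely, so it can be written with y = x + z
  as well as with y = x - z; the right-hand side is the mean of the two.\<close>

lemma truncated_frac_laplacian:
  fixes \<phi> :: "'a::euclidean_space \<Rightarrow> real"
  assumes s: "0 < s" "s < 1" and \<phi>: "test_function \<phi>" and e: "e > 0"
  shows "(LINT y : UNIV - ball x e | lborel. (\<phi> x - \<phi> y) / norm (x - y) powr (real DIM('a) + 2 * s))
    = (LINT z|lborel. indicator {z. e \<le> norm z} z * (second_diff \<phi> z x * jump_kernel s z)) / 2"
proof -
  have [measurable]: "\<phi> \<in> borel_measurable borel" by (rule test_function_measurable[OF \<phi>])
  obtain B where B: "B \<ge> 0" "\<And>x. \<bar>\<phi> x\<bar> \<le> B"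
    using test_function_bounded[OF \<phi>] by blast
  let ?P = "\<lambda>z::'a. indicator {z. e \<le> norm z} z * jump_kernel s z"
  have P: "integrable lborel ?P"
  proof (rule Bochner_Integration.integrable_bound)
    let ?q = "1 - exp (- e\<^sup>2)"
    have q: "?q > 0" using e by simp
    show "integrable lborel (\<lambda>z::'a. 1 / ?q * ((1 - exp (- (norm z)\<^sup>2)) * jump_kernel s z))"
      by (intro integrable_mult_right integrable_one_minus_gauss_jump_kernel s)
    show "AE z in lborel. norm (?P z) \<le> norm (1 / ?q * ((1 - exp (- (norm z)\<^sup>2)) * jump_kernel s z))"
    proof (intro always_eventually allI)
      fix z :: 'a
      show "norm (?P z) \<le> norm (1 / ?q * ((1 - exp (- (norm z)\<^sup>2)) * jump_kernel s z))"
      proof (cases "e \<le> norm z")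
        case True
        then have "?q \<le> 1 - exp (- (norm z)\<^sup>2)" using e by (simp add: power_mono)
        then have "1 \<le> (1 - exp (- (norm z)\<^sup>2)) / ?q" using q by simp
        then have "1 * jump_kernel s z \<le> (1 - exp (- (norm z)\<^sup>2)) / ?q * jump_kernel s z"
          by (rule mult_right_mono) (rule jump_kernel_nonneg)
        then show ?thesis using True q by (simp add: abs_mult jump_kernel_nonneg)
      qed simp
    qed
  qed measurable
  have diff: "integrable lborel (\<lambda>z. ?P z * (\<phi> x - \<phi> (x + c *\<^sub>R z)))" for c :: real
  proof (rule Bochner_Integration.integrable_bound)
    show "integrable lborel (\<lambda>z. ?P z * (2 * B))" using P by auto
    show "AE z in lborel. norm (?P z * (\<phi> x - \<phi> (x + c *\<^sub>R z))) \<le> norm (?P z * (2 * B))"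
    proof (intro always_eventually allI)
      fix z :: 'a
      have "\<bar>\<phi> x - \<phi> (x + c *\<^sub>R z)\<bar> \<le> 2 * B"
        using B(2)[of x] B(2)[of "x + c *\<^sub>R z"] by linarith
      then show "norm (?P z * (\<phi> x - \<phi> (x + c *\<^sub>R z))) \<le> norm (?P z * (2 * B))"
        using B(1) by (simp add: abs_mult mult_left_mono)
    qed
  qed measurable
  let ?T = "LINT y : UNIV - ball x e | lborel. (\<phi> x - \<phi> y) / norm (x - y) powr (real DIM('a) + 2 * s)"
  have T: "?T = (LINT z|lborel. ?P z * (\<phi> x - \<phi> (x + c *\<^sub>R z)))" if c: "\<bar>c\<bar> = 1" for c :: real
  proof -
    let ?f = "\<lambda>y. indicator (UNIV - ball x e) y * ((\<phi> x - \<phi> y) / norm (x - y) powr (real DIM('a) + 2 * s))"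
    have "?T = (LINT y|lborel. ?f y)"
      by (simp add: set_lebesgue_integral_def)
    also have "\<dots> = (LINT z|lborel. ?f (x + c *\<^sub>R z))"
    proof (rule integral_affine_unit[symmetric, OF c])
      have "(\<lambda>y. (\<phi> x - \<phi> y) / norm (x - y) powr (real DIM('a) + 2 * s)) \<in> borel_measurable borel"
        by measurable
      then show "?f \<in> borel_measurable borel"
        by (intro borel_measurable_times borel_measurable_indicator) auto
    qed
    also have "\<dots> = (LINT z|lborel. ?P z * (\<phi> x - \<phi> (x + c *\<^sub>R z)))"
    proof (rule Bochner_Integration.integral_cong[OF refl])
      fix z :: 'a
      have n: "norm (x - (x + c *\<^sub>R z)) = norm z" using c by simp
      have i: "indicator (UNIV - ball x e) (x + c *\<^sub>R z) = (indicator {z. e \<le> norm z} z :: real)"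
        using c by (simp add: indicator_def dist_norm not_less)
      show "?f (x + c *\<^sub>R z) = ?P z * (\<phi> x - \<phi> (x + c *\<^sub>R z))"
        unfolding n i by (simp add: jump_kernel_eq)
    qed
    finally show ?thesis .
  qed
  have "?T + ?T = (LINT z|lborel. ?P z * (\<phi> x - \<phi> (x + 1 *\<^sub>R z)) + ?P z * (\<phi> x - \<phi> (x + (- 1) *\<^sub>R z)))"
    using T[of 1] T[of "- 1"] by (subst Bochner_Integration.integral_add[OF diff diff]) simp
  also have "\<dots> = (LINT z|lborel. indicator {z. e \<le> norm z} z * (second_diff \<phi> z x * jump_kernel s z))"
    by (intro Bochner_Integration.integral_cong) (simp_all add: second_diff_def algebra_simps)
  finally show ?thesis by simp
qed

lemma frac_laplacian_eq_symmetric: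
  fixes \<phi> :: "'a::euclidean_space \<Rightarrow> real"
  assumes s: "0 < s" "s < 1" and \<phi>: "test_function \<phi>"
  shows "frac_laplacian s \<phi> x = frac_laplacian_const DIM('a) s * (symmetric_frac_laplacian s \<phi> x / 2)"
proof -
  let ?X = "\<lambda>e. LINT y : UNIV - ball x e | lborel. (\<phi> x - \<phi> y) / norm (x - y) powr (real DIM('a) + 2 * s)"
  have [measurable]: "\<phi> \<in> borel_measurable borel" by (rule test_function_measurable[OF \<phi>])
  have "(?X \<longlongrightarrow> symmetric_frac_laplacian s \<phi> x / 2) (at_right 0)"
  proof (rule tendsto_at_right_sequentially[of 0 1])
    fix S :: "nat \<Rightarrow> real" assume S: "\<And>n. 0 < S n" "S \<longlonglongrightarrow> 0"
    have "(\<lambda>n. LINT z|lborel. indicator {z. S n \<le> norm z} z * (second_diff \<phi> z x * jump_kernel s z)) \<longlonglongrightarrow> symmetric_frac_laplacian s \<phi> x"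
      unfolding symmetric_frac_laplacian_def
    proof (rule integral_dominated_convergence[where w = "\<lambda>z. \<bar>second_diff \<phi> z x * jump_kernel s z\<bar>"])
      show "integrable lborel (\<lambda>z. \<bar>second_diff \<phi> z x * jump_kernel s z\<bar>)"
        by (rule integrable_abs[OF integrable_second_diff_jump_kernel[OF s \<phi>]])
      show "AE z in lborel. (\<lambda>n. indicator {z. S n \<le> norm z} z * (second_diff \<phi> z x * jump_kernel s z)) \<longlonglongrightarrow> second_diff \<phi> z x * jump_kernel s z"
      proof (intro always_eventually allI)
        fix z :: 'a
        show "(\<lambda>n. indicator {z. S n \<le> norm z} z * (second_diff \<phi> z x * jump_kernel s z)) \<longlonglongrightarrow> second_diff \<phi> z x * jump_kernel s z"
        proof (cases "z = 0")
          case True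
          then show ?thesis by (simp add: second_diff_def)
        next
          case False
          then have "eventually (\<lambda>n. S n < norm z) sequentially"
            using S(2) by (intro order_tendstoD(2)) auto
          then have "eventually (\<lambda>n. indicator {z. S n \<le> norm z} z * (second_diff \<phi> z x * jump_kernel s z) = second_diff \<phi> z x * jump_kernel s z) sequentially"
            by eventually_elim simp
          then show ?thesis by (rule tendsto_eventually)
        qed
      qed
    qed (auto simp: indicator_def second_diff_def)
    then show "(\<lambda>n. ?X (S n)) \<longlonglongrightarrow> symmetric_frac_laplacian s \<phi> x / 2"
      unfolding truncated_frac_laplacian[OF s \<phi> S(1)] by (intro tendsto_intros) auto
  qed simp
  then show ?thesis
    unfolding frac_laplacian_def by (subst tendsto_Lim) auto
qed

lemma cos_transform_second_diff:
  fixes \<phi> :: "'a::euclidean_space \<Rightarrow> real"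
  assumes \<phi>: "integrable lborel \<phi>"
  shows "cos_transform (second_diff \<phi> z) \<xi> = 2 * (1 - cos (\<xi> \<bullet> z)) * cos_transform \<phi> \<xi>"
proof -
  have [measurable]: "\<phi> \<in> borel_measurable borel" using \<phi> by auto
  have c: "integrable lborel (\<lambda>x. cos (\<xi> \<bullet> x) * \<phi> x)" by (rule integrable_cos_mult[OF \<phi>])
  have plain: "integrable lborel (\<lambda>x. cos (\<xi> \<bullet> (x - w)) * \<phi> x)" for w
    by (rule Bochner_Integration.integrable_bound[OF \<phi>]) (auto simp: abs_mult mult_left_le_one_le)
  have sh: "has_bochner_integral lborel (\<lambda>x. cos (\<xi> \<bullet> x) * \<phi> (x + w)) (LINT x|lborel. cos (\<xi> \<bullet> (x - w)) * \<phi> x)" for w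
    using integral_shift[OF plain[of w], of w] by simp
  have "cos_transform (second_diff \<phi> z) \<xi> = (LINT x|lborel. 2 * (cos (\<xi> \<bullet> x) * \<phi> x) - cos (\<xi> \<bullet> x) * \<phi> (x + z) - cos (\<xi> \<bullet> x) * \<phi> (x + - z))"
    unfolding cos_transform_def second_diff_def
    by (intro Bochner_Integration.integral_cong) (simp_all add: algebra_simps)
  also have "\<dots> = 2 * cos_transform \<phi> \<xi> - (LINT x|lborel. cos (\<xi> \<bullet> (x - z)) * \<phi> x) - (LINT x|lborel. cos (\<xi> \<bullet> (x - - z)) * \<phi> x)"
    unfolding cos_transform_def
    by (rule has_bochner_integral_integral_eq)
       (intro has_bochner_integral_diff has_bochner_integral_mult_right sh has_bochner_integral_integrable c)
  also have "\<dots> = 2 * cos_transform \<phi> \<xi> - (LINT x|lborel. cos (\<xi> \<bullet> (x - z)) * \<phi> x + cos (\<xi> \<bullet> (x - - z)) * \<phi> x)"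
    by (subst Bochner_Integration.integral_add[OF plain plain]) simp
  also have "(LINT x|lborel. cos (\<xi> \<bullet> (x - z)) * \<phi> x + cos (\<xi> \<bullet> (x - - z)) * \<phi> x) = (LINT x|lborel. 2 * cos (\<xi> \<bullet> z) * (cos (\<xi> \<bullet> x) * \<phi> x))"
    by (intro Bochner_Integration.integral_cong) (simp_all add: inner_diff_right inner_add_right cos_add cos_diff algebra_simps)
  also have "\<dots> = 2 * cos (\<xi> \<bullet> z) * cos_transform \<phi> \<xi>"
    unfolding cos_transform_def by (rule integral_mult_right_zero)
  finally show ?thesis by (simp add: algebra_simps)
qed

text \<open>Fubini's theorem, with the cosine transform of a second difference inside and
  has_bochner_integral_one_minus_cos_jump_kernel outside.\<close>

lemma cos_transform_symmetric_frac_laplacian: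
  fixes \<phi> :: "'a::euclidean_space \<Rightarrow> real"
  assumes s: "0 < s" "s < 1" and \<phi>: "test_function \<phi>"
  shows "integrable lborel (symmetric_frac_laplacian s \<phi>)"
    and "\<exists>B\<ge>0. \<forall>x. \<bar>symmetric_frac_laplacian s \<phi> x\<bar> \<le> B"
    and "cos_transform (symmetric_frac_laplacian s \<phi>) \<xi> = 2 * (norm \<xi> powr (2 * s) / frac_laplacian_const DIM('a) s) * cos_transform \<phi> \<xi>"
proof -
  have [measurable]: "\<phi> \<in> borel_measurable borel" by (rule test_function_measurable[OF \<phi>])
  have prod: "integrable (lborel \<Otimes>\<^sub>M lborel) (\<lambda>(z, x). cos (\<eta> \<bullet> x) * (second_diff \<phi> z x * jump_kernel s z))" for \<eta>
  proof (rule lborel_pair.Fubini_integrable)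
    let ?f = "\<lambda>z x. cos (\<eta> \<bullet> x) * (second_diff \<phi> z x * jump_kernel s z)"
    show "case_prod ?f \<in> borel_measurable (lborel \<Otimes>\<^sub>M lborel)"
      unfolding second_diff_def by measurable
    have inner: "integrable lborel (\<lambda>x. ?f z x)" for z
      using integrable_mult_left[OF integrable_cos_mult[OF second_diff_integral_bound(1)[OF \<phi>, of z], of \<eta>], of "jump_kernel s z"]
      by (simp add: mult.assoc)
    show "AE z in lborel. integrable lborel (\<lambda>x. case_prod ?f (z, x))"
      using inner by simp
    obtain C where C: "C \<ge> 0" "\<And>z. (LINT x|lborel. \<bar>second_diff \<phi> z x\<bar>) \<le> C * (1 - exp (- (norm z)\<^sup>2))"
      using second_diff_integral_bound(2)[OF \<phi>] by blast
    show "integrable lborel (\<lambda>z. LINT x|lborel. norm (case_prod ?f (z, x)))"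
    proof (rule Bochner_Integration.integrable_bound[OF integrable_mult_right[OF integrable_one_minus_gauss_jump_kernel[OF s], of C]])
      show "(\<lambda>z. LINT x|lborel. norm (case_prod ?f (z, x))) \<in> borel_measurable lborel"
        unfolding prod.case second_diff_def by measurable
      show "AE z in lborel. norm (LINT x|lborel. norm (case_prod ?f (z, x))) \<le> norm (C * ((1 - exp (- (norm z)\<^sup>2)) * jump_kernel s z))"
      proof (intro always_eventually allI)
        fix z :: 'a
        have "(LINT x|lborel. norm (case_prod ?f (z, x))) \<le> (LINT x|lborel. \<bar>second_diff \<phi> z x\<bar> * jump_kernel s z)"
        proof (rule integral_mono)
          show "integrable lborel (\<lambda>x. norm (case_prod ?f (z, x)))"
            using inner[of z] by simp
          show "integrable lborel (\<lambda>x. \<bar>second_diff \<phi> z x\<bar> * jump_kernel s z)"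
            by (intro integrable_mult_left integrable_abs second_diff_integral_bound(1) \<phi>)
          show "norm (case_prod ?f (z, x)) \<le> \<bar>second_diff \<phi> z x\<bar> * jump_kernel s z" for x
            by (simp add: abs_mult jump_kernel_nonneg mult_left_le_one_le)
        qed
        also have "\<dots> = (LINT x|lborel. \<bar>second_diff \<phi> z x\<bar>) * jump_kernel s z"
          by (rule integral_mult_left_zero)
        also have "\<dots> \<le> C * (1 - exp (- (norm z)\<^sup>2)) * jump_kernel s z"
          by (rule mult_right_mono[OF C(2) jump_kernel_nonneg])
        finally have "(LINT x|lborel. norm (case_prod ?f (z, x))) \<le> C * ((1 - exp (- (norm z)\<^sup>2)) * jump_kernel s z)"
          by (simp only: mult.assoc)
        moreover have "0 \<le> (LINT x|lborel. norm (case_prod ?f (z, x)))" by simp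
        ultimately show "norm (LINT x|lborel. norm (case_prod ?f (z, x))) \<le> norm (C * ((1 - exp (- (norm z)\<^sup>2)) * jump_kernel s z))"
          by simp
      qed
    qed
  qed
  have snd: "(LINT z|lborel. cos (\<eta> \<bullet> x) * (second_diff \<phi> z x * jump_kernel s z)) = cos (\<eta> \<bullet> x) * symmetric_frac_laplacian s \<phi> x" for \<eta> x
    unfolding symmetric_frac_laplacian_def by (rule integral_mult_right_zero)
  show "integrable lborel (symmetric_frac_laplacian s \<phi>)"
    using lborel_pair.integrable_snd[OF prod[of 0]] unfolding snd by simp
  have "cos_transform (symmetric_frac_laplacian s \<phi>) \<xi> = (LINT z|lborel. LINT x|lborel. cos (\<xi> \<bullet> x) * (second_diff \<phi> z x * jump_kernel s z))"
    using lborel_pair.Fubini_integral[OF prod[of \<xi>]] unfolding snd cos_transform_def[of "symmetric_frac_laplacian s \<phi>"] by simp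
  also have "\<dots> = (LINT z|lborel. 2 * cos_transform \<phi> \<xi> * ((1 - cos (\<xi> \<bullet> z)) * jump_kernel s z))"
  proof (rule Bochner_Integration.integral_cong[OF refl])
    fix z :: 'a
    have "(LINT x|lborel. cos (\<xi> \<bullet> x) * (second_diff \<phi> z x * jump_kernel s z)) = cos_transform (second_diff \<phi> z) \<xi> * jump_kernel s z"
      unfolding cos_transform_def mult.assoc[symmetric] by (rule integral_mult_left_zero)
    then show "(LINT x|lborel. cos (\<xi> \<bullet> x) * (second_diff \<phi> z x * jump_kernel s z)) = 2 * cos_transform \<phi> \<xi> * ((1 - cos (\<xi> \<bullet> z)) * jump_kernel s z)"
      unfolding cos_transform_second_diff[OF test_function_integrable[OF \<phi>]] by (simp only: mult_ac)
  qed
  also have "\<dots> = 2 * cos_transform \<phi> \<xi> * (norm \<xi> powr (2 * s) / frac_laplacian_const DIM('a) s)"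
    unfolding integral_mult_right_zero has_bochner_integral_integral_eq[OF has_bochner_integral_one_minus_cos_jump_kernel[OF s]] ..
  finally show "cos_transform (symmetric_frac_laplacian s \<phi>) \<xi> = 2 * (norm \<xi> powr (2 * s) / frac_laplacian_const DIM('a) s) * cos_transform \<phi> \<xi>"
    by (simp only: mult_ac)
  obtain C where C: "C \<ge> 0" "\<And>z x. \<bar>second_diff \<phi> z x\<bar> \<le> C * (1 - exp (- (norm z)\<^sup>2))"
    using second_diff_bound[OF \<phi>] by blast
  let ?B = "LINT z|lborel. C * ((1 - exp (- (norm (z::'a))\<^sup>2)) * jump_kernel s z)"
  have "\<bar>symmetric_frac_laplacian s \<phi> x\<bar> \<le> ?B" for x
  proof -
    have "\<bar>symmetric_frac_laplacian s \<phi> x\<bar> \<le> (LINT z|lborel. \<bar>second_diff \<phi> z x * jump_kernel s z\<bar>)"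
      unfolding symmetric_frac_laplacian_def by (rule integral_abs_bound)
    also have "\<dots> \<le> ?B"
    proof (rule integral_mono)
      show "integrable lborel (\<lambda>z. \<bar>second_diff \<phi> z x * jump_kernel s z\<bar>)"
        by (rule integrable_abs[OF integrable_second_diff_jump_kernel[OF s \<phi>]])
      show "integrable lborel (\<lambda>z::'a. C * ((1 - exp (- (norm z)\<^sup>2)) * jump_kernel s z))"
        by (intro integrable_mult_right integrable_one_minus_gauss_jump_kernel s)
      show "\<bar>second_diff \<phi> z x * jump_kernel s z\<bar> \<le> C * ((1 - exp (- (norm z)\<^sup>2)) * jump_kernel s z)" for z
        using mult_right_mono[OF C(2) jump_kernel_nonneg, of z x s] by (simp add: abs_mult jump_kernel_nonneg mult.assoc)
    qed
    finally show ?thesis .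
  qed
  moreover from this[of 0] have "?B \<ge> 0" by linarith
  ultimately show "\<exists>B\<ge>0. \<forall>x. \<bar>symmetric_frac_laplacian s \<phi> x\<bar> \<le> B" by blast
qed

section \<open>The fundamental solution and the two-sided estimate\<close>

theorem green_fundamental_solution:
  assumes s: "0 < s" "s < 1" and dim: "DIM('a::euclidean_space) \<ge> 3"
  shows "fundamental_solution s (Gamma_kernel s :: 'a \<Rightarrow> complex)"
  unfolding fundamental_solution_def
proof (intro allI impI)
  fix \<phi> :: "'a \<Rightarrow> real" assume \<phi>: "test_function \<phi>"
  let ?c = "frac_laplacian_const DIM('a) s"
  let ?S = "symmetric_frac_laplacian s \<phi>"
  let ?g = "\<lambda>x. - laplacian \<phi> x + frac_laplacian s \<phi> x"
  have c: "?c > 0" by (rule frac_laplacian_const_pos[OF s])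
  have g: "?g = (\<lambda>x. - laplacian \<phi> x + ?c / 2 * ?S x)"
    by (simp add: fun_eq_iff frac_laplacian_eq_symmetric[OF s \<phi>])
  note L = cos_transform_laplacian[OF \<phi>] and S = cos_transform_symmetric_frac_laplacian[OF s \<phi>]
  have int: "integrable lborel ?g"
    unfolding g by (intro Bochner_Integration.integrable_add integrable_minus integrable_mult_right L(1) S(1))
  obtain B1 where B1: "\<And>x. \<bar>laplacian \<phi> x\<bar> \<le> B1" using L(2) by blast
  obtain B2 where B2: "\<And>x. \<bar>?S x\<bar> \<le> B2" using S(2) by blast
  have bnd: "\<bar>?g x\<bar> \<le> B1 + ?c / 2 * B2" for x
  proof -
    have "\<bar>?g x\<bar> \<le> \<bar>laplacian \<phi> x\<bar> + \<bar>?c / 2 * ?S x\<bar>"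
      unfolding fun_cong[OF g] using abs_triangle_ineq[of "- laplacian \<phi> x" "?c / 2 * ?S x"] by simp
    also have "\<bar>?c / 2 * ?S x\<bar> = ?c / 2 * \<bar>?S x\<bar>" using c by (simp add: abs_mult)
    also have "\<bar>laplacian \<phi> x\<bar> + ?c / 2 * \<bar>?S x\<bar> \<le> B1 + ?c / 2 * B2"
      using c B1[of x] B2[of x] by (intro add_mono mult_left_mono) auto
    finally show ?thesis .
  qed
  have "cos_transform ?g \<xi> = symbol s ((norm \<xi>)\<^sup>2) * cos_transform \<phi> \<xi>" for \<xi>
  proof -
    have "cos_transform ?g \<xi> = (LINT x|lborel. - (cos (\<xi> \<bullet> x) * laplacian \<phi> x) + ?c / 2 * (cos (\<xi> \<bullet> x) * ?S x))"
      unfolding g cos_transform_def by (intro Bochner_Integration.integral_cong) (simp_all add: algebra_simps)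
    also have "\<dots> = - cos_transform (laplacian \<phi>) \<xi> + ?c / 2 * cos_transform ?S \<xi>"
      unfolding cos_transform_def
      by (rule has_bochner_integral_integral_eq)
         (intro has_bochner_integral_add has_bochner_integral_minus has_bochner_integral_mult_right
           has_bochner_integral_integrable integrable_cos_mult L(1) S(1))
    also have "\<dots> = symbol s ((norm \<xi>)\<^sup>2) * cos_transform \<phi> \<xi>"
      unfolding L(3) S(3) symbol_norm using c by (simp add: algebra_simps)
    finally show ?thesis .
  qed
  moreover obtain B where B: "\<And>x. \<bar>\<phi> x\<bar> \<le> B" using test_function_bounded[OF \<phi>] by blast
  moreover have "isCont \<phi> 0"
    using test_function_continuous[OF \<phi>] by (simp add: continuous_on_eq_continuous_at)
  ultimately have "has_bochner_integral lborel (\<lambda>x. green s x * ?g x) ((2 * pi) ^ DIM('a) * \<phi> 0)"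
    by (intro green_pairing[OF s dim test_function_integrable[OF \<phi>] _ _ int bnd])
  then have "has_bochner_integral lborel (\<lambda>x. complex_of_real (green s x * ?g x / (2 * pi) ^ DIM('a))) (of_real ((2 * pi) ^ DIM('a) * \<phi> 0 / (2 * pi) ^ DIM('a)))"
    by (intro has_bochner_integral_of_real has_bochner_integral_divide_zero) 
  then show "has_bochner_integral lborel (\<lambda>x. Gamma_kernel s x * of_real (?g x)) (of_real (\<phi> 0))"
    by (simp add: Gamma_kernel_eq)
qed

lemma green_antimono:
  fixes x y :: "'a::euclidean_space"
  assumes s: "0 < s" "s < 1" and dim: "DIM('a) \<ge> 3" and x: "x \<noteq> 0" and xy: "norm x \<le> norm y"
  shows "green s y \<le> green s x"
proof -
  have y: "y \<noteq> 0" using x xy by auto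
  have p: "1 < real DIM('a) / 2" "\<And>l::real. l > 0 \<Longrightarrow> l powr 1 \<le> symbol s l"
    using dim by (auto simp: symbol_def)
  show ?thesis
    unfolding green_def
  proof (rule integral_mono[OF green_upper(1)[OF s y p] green_upper(1)[OF s x p]])
    show "indicator {0<..} t * heat_transform s t y \<le> indicator {0<..} t * heat_transform s t x" for t
      using heat_transform_antimono[OF s _ xy, of t] by (cases "t > 0") auto
  qed
qed

text \<open>Near the origin the linear term of the symbol at 1 / (norm x)^2 dominates, away from
  it the power with exponent s; accordingly green_upper is used with p = 1 or p = s, and the
  symbol in green_lower is at most twice the dominating term.\<close>

lemma Gamma_kernel_two_sided_bounds:
  assumes s: "0 < s" "s < 1" and dim: "DIM('a::euclidean_space) \<ge> 3"
  shows "\<exists>C>0.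
      (\<forall>x::'a. 0 < norm x \<and> norm x < 1 \<longrightarrow>
        1 / C * (1 / norm x powr (real DIM('a) - 2)) \<le> Re (Gamma_kernel s x) \<and>
        Re (Gamma_kernel s x) \<le> C * (1 / norm x powr (real DIM('a) - 2))) \<and>
      (\<forall>x::'a. 1 \<le> norm x \<longrightarrow>
        1 / C * (1 / norm x powr (real DIM('a) - 2 * s)) \<le> Re (Gamma_kernel s x) \<and>
        Re (Gamma_kernel s x) \<le> C * (1 / norm x powr (real DIM('a) - 2 * s)))"
proof -
  let ?a = "real DIM('a) / 2"
  let ?m = "(2 * pi) ^ DIM('a)"
  define A where "A = pi powr ?a * (4 * ?a) powr ?a * exp 1 * ?a"
  define U where "U = max (A / (?a - 1)) (A / (?a - s)) / ?m"
  define D where "D = pi powr ?a / (?a powr ?a * exp ((4 powr (1 / s) - 1) / (4 * ln 2))) / 4 / ?m"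
  have m: "?m > 0" by simp
  have A: "A > 0" using dim by (simp add: A_def)
  have U: "U > 0" using A dim m by (auto simp: U_def less_max_iff_disj intro!: divide_pos_pos)
  have D: "D > 0" using dim m by (auto simp: D_def intro!: divide_pos_pos mult_pos_pos)
  have p1: "1 < real DIM('a) / 2" "\<And>l::real. l > 0 \<Longrightarrow> l powr 1 \<le> symbol s l"
    using dim by (auto simp: symbol_def)
  have ps: "s < real DIM('a) / 2" "\<And>l::real. l > 0 \<Longrightarrow> l powr s \<le> symbol s l"
    using dim s by (auto simp: symbol_def)
  have Re: "Re (Gamma_kernel s x) = green s x / ?m" for x :: 'a
    by (simp add: Gamma_kernel_eq)
  have upper: "green s x / ?m \<le> U * (1 / norm x powr (real DIM('a) - 2 * p))"
    if x: "x \<noteq> 0" and p: "p = 1 \<or> p = s" for x :: 'a and p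
  proof -
    have "green s x \<le> A / (?a - p) * norm x powr (2 * p - real DIM('a))"
      using p green_upper(2)[OF s x p1] green_upper(2)[OF s x ps] unfolding A_def by auto
    also have "\<dots> \<le> max (A / (?a - 1)) (A / (?a - s)) * norm x powr (2 * p - real DIM('a))"
      using p by (intro mult_right_mono) auto
    finally have "green s x / ?m \<le> max (A / (?a - 1)) (A / (?a - s)) * norm x powr (2 * p - real DIM('a)) / ?m"
      by (rule divide_right_mono) simp
    also have "norm x powr (2 * p - real DIM('a)) = 1 / norm x powr (real DIM('a) - 2 * p)"
      by (simp flip: powr_minus_divide)
    finally show ?thesis unfolding U_def by (simp add: mult_ac)
  qed
  have lower: "D * (1 / norm x powr (real DIM('a) - 2 * p)) \<le> green s x / ?m"
    if x: "x \<noteq> 0" and p: "symbol s (1 / (norm x)\<^sup>2) \<le> 2 * (1 / (norm x)\<^sup>2) powr p" for x :: 'a and p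
  proof -
    let ?R = "(norm x)\<^sup>2"
    have R: "?R > 0" using x by simp
    have sp: "symbol s (1 / ?R) > 0" using R by (intro symbol_pos) simp
    have "?R powr (- ?a) / (2 * (1 / ?R) powr p) \<le> ?R powr (- ?a) / symbol s (1 / ?R)"
      using p sp R by (intro divide_left_mono mult_pos_pos) auto
    also have "?R powr (- ?a) / (2 * (1 / ?R) powr p) = (1 / norm x powr (real DIM('a) - 2 * p)) / 2"
    proof -
      have "?R = norm x powr 2" using x by simp
      then have "?R powr q = norm x powr (2 * q)" for q by (simp only: powr_powr)
      then show ?thesis using x
        by (simp add: powr_divide powr_diff powr_minus_divide)
    qed
    finally have le: "(1 / norm x powr (real DIM('a) - 2 * p)) / 2 \<le> ?R powr (- ?a) / symbol s (1 / ?R)" .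
    have "pi powr ?a / (?a powr ?a * exp ((4 powr (1 / s) - 1) / (4 * ln 2))) / 2 * ((1 / norm x powr (real DIM('a) - 2 * p)) / 2)
      \<le> pi powr ?a / (?a powr ?a * exp ((4 powr (1 / s) - 1) / (4 * ln 2))) / 2 * (?R powr (- ?a) / symbol s (1 / ?R))"
      by (rule mult_left_mono[OF le]) simp
    also have "\<dots> \<le> green s x"
      by (rule green_lower[OF s x green_upper(1)[OF s x p1]])
    finally have "pi powr ?a / (?a powr ?a * exp ((4 powr (1 / s) - 1) / (4 * ln 2))) / 2 * ((1 / norm x powr (real DIM('a) - 2 * p)) / 2) / ?m \<le> green s x / ?m"
      by (rule divide_right_mono) simp
    then show ?thesis unfolding D_def by (simp add: mult_ac)
  qed
  define C where "C = max U (1 / D)"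
  have C: "C > 0" "U \<le> C" "1 / C \<le> D"
  proof -
    show "C > 0" "U \<le> C" using U by (auto simp: C_def)
    have "1 / D \<le> C" "1 / D > 0" using D by (auto simp: C_def)
    then show "1 / C \<le> D" using D \<open>C > 0\<close> by (simp add: field_simps)
  qed
  have both: "1 / C * (1 / norm x powr (real DIM('a) - 2 * p)) \<le> Re (Gamma_kernel s x) \<and>
        Re (Gamma_kernel s x) \<le> C * (1 / norm x powr (real DIM('a) - 2 * p))"
    if x: "x \<noteq> 0" and p: "p = 1 \<or> p = s" "symbol s (1 / (norm x)\<^sup>2) \<le> 2 * (1 / (norm x)\<^sup>2) powr p" for x :: 'a and p
  proof
    have "1 / C * (1 / norm x powr (real DIM('a) - 2 * p)) \<le> D * (1 / norm x powr (real DIM('a) - 2 * p))"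
      by (rule mult_right_mono[OF C(3)]) simp
    then show "1 / C * (1 / norm x powr (real DIM('a) - 2 * p)) \<le> Re (Gamma_kernel s x)"
      using lower[OF x p(2)] unfolding Re by linarith
    have "U * (1 / norm x powr (real DIM('a) - 2 * p)) \<le> C * (1 / norm x powr (real DIM('a) - 2 * p))"
      by (rule mult_right_mono[OF C(2)]) simp
    then show "Re (Gamma_kernel s x) \<le> C * (1 / norm x powr (real DIM('a) - 2 * p))"
      using upper[OF x p(1)] unfolding Re by linarith
  qed
  show ?thesis
  proof (intro exI[of _ C] conjI[OF C(1)] conjI allI impI)
    fix x :: 'a assume x: "0 < norm x \<and> norm x < 1"
    have "(norm x)\<^sup>2 \<le> 1" using x by (simp add: power_le_one)
    then have "1 \<le> 1 / (norm x)\<^sup>2" using x by simp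
    then have "(1 / (norm x)\<^sup>2) powr s \<le> (1 / (norm x)\<^sup>2) powr 1" using s by (intro powr_mono) auto
    then have "symbol s (1 / (norm x)\<^sup>2) \<le> 2 * (1 / (norm x)\<^sup>2) powr 1" by (simp add: symbol_def)
    with both[of x 1] x show "1 / C * (1 / norm x powr (real DIM('a) - 2)) \<le> Re (Gamma_kernel s x)"
      "Re (Gamma_kernel s x) \<le> C * (1 / norm x powr (real DIM('a) - 2))" by auto
  next
    fix x :: 'a assume x: "1 \<le> norm x"
    then have n1: "1 \<le> (norm x)\<^sup>2" by (simp add: one_le_power)
    then have n0: "0 < (norm x)\<^sup>2" by linarith
    have "0 < 1 / (norm x)\<^sup>2" "1 / (norm x)\<^sup>2 \<le> 1"
      using n0 divide_le_eq_1_pos[OF n0, THEN iffD2, OF n1] by auto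
    then have "(1 / (norm x)\<^sup>2) powr 1 \<le> (1 / (norm x)\<^sup>2) powr s" using s by (intro powr_mono') auto
    then have "symbol s (1 / (norm x)\<^sup>2) \<le> 2 * (1 / (norm x)\<^sup>2) powr s" by (simp add: symbol_def)
    moreover have "x \<noteq> 0" using x by auto
    ultimately show "1 / C * (1 / norm x powr (real DIM('a) - 2 * s)) \<le> Re (Gamma_kernel s x)"
      "Re (Gamma_kernel s x) \<le> C * (1 / norm x powr (real DIM('a) - 2 * s))"
      using both[of x s] by blast+
  qed
qed

theorem proposition2p1:
  fixes s :: real and \<Gamma> :: "real ^ 'n \<Rightarrow> complex"
  assumes n: "CARD('n) \<ge> 3"
    and s: "0 < s" "s < 1"
  defines "\<Gamma> \<equiv> Gamma_kernel s"
  shows "(\<forall>x. \<Gamma> x \<in> \<real> \<and> 0 \<le> Re (\<Gamma> x)) \<and>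
    (\<forall>x y. norm x = norm y \<longrightarrow> \<Gamma> x = \<Gamma> y) \<and>
    (\<forall>x y. 0 < norm x \<and> norm x \<le> norm y \<longrightarrow> Re (\<Gamma> y) \<le> Re (\<Gamma> x)) \<and>
    (\<exists>C>0.
      (\<forall>x. 0 < norm x \<and> norm x < 1 \<longrightarrow>
        1 / C * (1 / norm x powr (real CARD('n) - 2)) \<le> Re (\<Gamma> x) \<and>
        Re (\<Gamma> x) \<le> C * (1 / norm x powr (real CARD('n) - 2))) \<and>
      (\<forall>x. 1 \<le> norm x \<longrightarrow>
        1 / C * (1 / norm x powr (real CARD('n) - 2 * s)) \<le> Re (\<Gamma> x) \<and>
        Re (\<Gamma> x) \<le> C * (1 / norm x powr (real CARD('n) - 2 * s)))) \<and>
    fundamental_solution s \<Gamma>"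
proof -
  have dim: "DIM(real ^ 'n) = CARD('n)" by simp
  have dim3: "DIM(real ^ 'n) \<ge> 3" using n by simp
  show ?thesis
    unfolding \<Gamma>_def
  proof (intro conjI)
    show "\<forall>x::real^'n. Gamma_kernel s x \<in> \<real> \<and> 0 \<le> Re (Gamma_kernel s x)"
      by (auto simp: Gamma_kernel_eq green_nonneg[OF s])
    show "\<forall>(x::real^'n) y::real^'n. norm x = norm y \<longrightarrow> Gamma_kernel s x = Gamma_kernel s y"
    proof (intro allI impI)
      fix x y :: "real^'n" assume "norm x = norm y"
      then have "green s x = green s y" by (rule green_radial[OF s])
      then show "Gamma_kernel s x = Gamma_kernel s y" by (simp add: Gamma_kernel_eq)
    qed
    show "\<forall>(x::real^'n) y::real^'n. 0 < norm x \<and> norm x \<le> norm y \<longrightarrow> Re (Gamma_kernel s y) \<le> Re (Gamma_kernel s x)"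
      using green_antimono[OF s dim3] by (auto simp: Gamma_kernel_eq intro!: divide_right_mono)
    show "fundamental_solution s (Gamma_kernel s :: real^'n \<Rightarrow> complex)"
      by (rule green_fundamental_solution[OF s dim3])
  qed (use Gamma_kernel_two_sided_bounds[OF s dim3] in \<open>simp only: dim\<close>)
qed

end
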